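(* Let $h:[0,1)\to\mathbb{R}$ and $\sigma:[0,1)\to(0,\infty)$ be functions of class $C^1$ on $[0,1)$, let $B$ be a standard Brownian motion, and for $x,y\in\mathbb{R}$ let $(X^{xy}_t)_{t\in[0,1)}$ be the unique strong solution of $$dX_t = h(t)(y-X_t)\,dt+\sigma(t)\,dB_t,\quad t\in[0,1),\qquad X_0=x.$$ Assume that the processes $\{X^{xy},\,x,y\in\mathbb{R}\}$ are pinned diffusions, i.e. $\mathbf{P}(\lim_{t\to1}X^{xy}_t=y)=1$ for all $x,y\in\mathbb{R}$. Then $\{X^{xy},\,x,y\in\mathbb{R}\}$ correspond to the bridges of a regular Itô diffusion $Z=(Z_t)_{t\in[0,1]}$ if and only if $$\Sigma:=\lim_{t\to1}\int_0^t\sigma^2(r)\,dr<+\infty$$ and $$h(t)=\frac{\sigma^2(t)}{\Sigma-\int_0^t\sigma^2(r)\,dr},\quad t\in[0,1).$$ In this case $Z$ is indeed Gaussian and one can choose its drift coefficient $b\equiv0$ and its diffusion coefficient $\rho^2(t,z)\equiv\sigma^2(t)$, i.e. $dZ_t=\sigma(t)\,dB_t$.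
   Context: All processes live on a filtered probability space $(\Omega,\mathscr{F},(\mathscr{F}_t)_{t\in[0,1]},\mathbf{P})$ satisfying the usual conditions, and $B$ is a standard Brownian motion with respect to $(\mathscr{F}_t)$. Regular Itô diffusion: a weak solution $Z=(Z_t)_{t\in[0,1]}$ of an SDE of the form $dZ_t=b(t,Z_t)\,dt+\rho(t,Z_t)\,dB_t$ is called a regular Itô diffusion if the coefficients $b$ and $\rho$ are in $C^{1,2}([0,1]\times\mathbb{R})$, if $\rho$ is strictly positive, and if $Z$ admits a strictly positive transition density $p=p(t_1,z_1;t_2,z_2)$ such that (i) $p$ is differentiable in all variables; (ii) for any $(t_1,z_1)\in[0,1)\times\mathbb{R}$, the partial derivatives of $p(t_1,z_1;\cdot,\cdot)$ exist up to order two and are continuous. The bridge of $Z$ between $x$ and $y$ is the Markov process on $[0,1)$ started in $x$ with transition density $$p^y(s,u;t,v)=\frac{p(s,u;t,v)\,p(t,v;1,y)}{p(s,u;1,y)},\quad 0\le s<t<1,\ u,v\in\mathbb{R}.$$ The family $\{X^{xy},\,x,y\in\mathbb{R}\}$ "corresponds to the bridges of $Z$" means that for all $x,y\in\mathbb{R}$ the law of $(X^{xy}_t)_{t\in[0,1)}$ equals the law of the bridge of $Z$ between $x$ and $y$.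
   Formalization: Regularity of b, ρ, the SDE and p's forward-time derivatives is required on [0,1), and on all of [0,1] if σ extends C¹ and positive (else "if" fails, e.g. σ=(1-t)^{-1/4}); "Z is Gaussian" means Z can be chosen Gaussian (dZ=tanh(Z)dt+dB has Brownian bridges). *)

theory Defs
  imports "HOL-Probability.Probability"
begin

section \<open>Differentiability classes\<close>

text \<open>Derivatives are taken within the set, hence are one-sided at an endpoint that belongs to it.\<close>

definition C1_on :: "real set \<Rightarrow> (real \<Rightarrow> real) \<Rightarrow> bool" where
  "C1_on S f \<longleftrightarrow> (\<exists>f'. (\<forall>t\<in>S. (f has_real_derivative f' t) (at t within S)) \<and> continuous_on S f')"

definition C12_on :: "real set \<Rightarrow> (real \<Rightarrow> real \<Rightarrow> real) \<Rightarrow> bool" where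
  "C12_on S f \<longleftrightarrow> (\<exists>f\<^sub>t f\<^sub>z f\<^sub>z\<^sub>z.
     (\<forall>t\<in>S. \<forall>z.
        ((\<lambda>t. f t z) has_real_derivative f\<^sub>t t z) (at t within S) \<and>
        (f t has_real_derivative f\<^sub>z t z) (at z) \<and>
        (f\<^sub>z t has_real_derivative f\<^sub>z\<^sub>z t z) (at z)) \<and>
     (\<forall>g\<in>{f, f\<^sub>t, f\<^sub>z, f\<^sub>z\<^sub>z}. continuous_on (S \<times> UNIV) (\<lambda>(t, z). g t z)))"

definition C2_on :: "real set \<Rightarrow> (real \<Rightarrow> real \<Rightarrow> real) \<Rightarrow> bool" where
  "C2_on S f \<longleftrightarrow> (\<exists>f\<^sub>t f\<^sub>z f\<^sub>t\<^sub>t f\<^sub>t\<^sub>z f\<^sub>z\<^sub>t f\<^sub>z\<^sub>z.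
     (\<forall>t\<in>S. \<forall>z.
        ((\<lambda>t. f t z) has_real_derivative f\<^sub>t t z) (at t within S) \<and>
        (f t has_real_derivative f\<^sub>z t z) (at z) \<and>
        ((\<lambda>t. f\<^sub>t t z) has_real_derivative f\<^sub>t\<^sub>t t z) (at t within S) \<and>
        (f\<^sub>t t has_real_derivative f\<^sub>t\<^sub>z t z) (at z) \<and>
        ((\<lambda>t. f\<^sub>z t z) has_real_derivative f\<^sub>z\<^sub>t t z) (at t within S) \<and>
        (f\<^sub>z t has_real_derivative f\<^sub>z\<^sub>z t z) (at z)) \<and>
     (\<forall>g\<in>{f, f\<^sub>t, f\<^sub>z, f\<^sub>t\<^sub>t, f\<^sub>t\<^sub>z, f\<^sub>z\<^sub>t, f\<^sub>z\<^sub>z}. continuous_on (S \<times> UNIV) (\<lambda>(t, z). g t z)))"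


section \<open>Filtered probability spaces and Brownian motion on the unit time interval\<close>

text \<open>A filtration is a family of measures of which only the \<open>\<sigma>\<close>-algebras matter, as in
  \<^const>\<open>real_cond_exp\<close>.  Its values outside the unit interval are irrelevant.\<close>

definition usual_filtered_space :: "'a measure \<Rightarrow> (real \<Rightarrow> 'a measure) \<Rightarrow> bool" where
  "usual_filtered_space M F \<longleftrightarrow>
     prob_space M \<and> complete_measure M \<and>
     (\<forall>t\<in>{0..1}. subalgebra M (F t)) \<and>
     (\<forall>s\<in>{0..1}. \<forall>t\<in>{s..1}. sets (F s) \<subseteq> sets (F t)) \<and>
     null_sets M \<subseteq> sets (F 0) \<and>
     (\<forall>t\<in>{0..<1}. sets (F t) = (\<Inter>s\<in>{t<..1}. sets (F s)))"

definition natural_filtration :: "'a set \<Rightarrow> real set \<Rightarrow> (real \<Rightarrow> 'a \<Rightarrow> real) \<Rightarrow> real \<Rightarrow> 'a measure" where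
  "natural_filtration \<Omega> I Y t = sigma \<Omega> {Y s -` A \<inter> \<Omega> | s A. s \<in> I \<and> s \<le> t \<and> A \<in> sets borel}"

definition augmented_filtration :: "'a measure \<Rightarrow> real set \<Rightarrow> (real \<Rightarrow> 'a \<Rightarrow> real) \<Rightarrow> real \<Rightarrow> 'a measure" where
  "augmented_filtration M I Y t =
     sigma (space M) (sets (natural_filtration (space M) I Y t) \<union> null_sets M)"

definition adapted :: "(real \<Rightarrow> 'a measure) \<Rightarrow> real set \<Rightarrow> (real \<Rightarrow> 'a \<Rightarrow> real) \<Rightarrow> bool" where
  "adapted F I Y \<longleftrightarrow> (\<forall>t\<in>I. Y t \<in> borel_measurable (F t))"

definition brownian_motion ::
    "'a measure \<Rightarrow> (real \<Rightarrow> 'a measure) \<Rightarrow> (real \<Rightarrow> 'a \<Rightarrow> real) \<Rightarrow> bool" where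
  "brownian_motion M F B \<longleftrightarrow>
     adapted F {0..1} B \<and>
     (AE \<omega> in M. B 0 \<omega> = 0) \<and>
     (AE \<omega> in M. continuous_on {0..1} (\<lambda>t. B t \<omega>)) \<and>
     (\<forall>s\<in>{0..1}. \<forall>t\<in>{s<..1}.
        distributed M lborel (\<lambda>\<omega>. B t \<omega> - B s \<omega>) (normal_density 0 (sqrt (t - s))) \<and>
        prob_space.indep_set M (sets (F s))
          (sets (vimage_algebra (space M) (\<lambda>\<omega>. B t \<omega> - B s \<omega>) borel)))"


section \<open>Stochastic differential equations\<close>

text \<open>\<open>\<pi> 0 \<le> \<dots> \<le> \<pi> n\<close> subdivides \<open>[0, t]\<close> with mesh less than \<open>\<delta>\<close>.\<close>

definition fine_subdivision :: "real \<Rightarrow> real \<Rightarrow> nat \<Rightarrow> (nat \<Rightarrow> real) \<Rightarrow> bool" where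
  "fine_subdivision t \<delta> n \<pi> \<longleftrightarrow>
     \<pi> 0 = 0 \<and> \<pi> n = t \<and> (\<forall>i<n. \<pi> i \<le> \<pi> (Suc i) \<and> \<pi> (Suc i) - \<pi> i < \<delta>)"

text \<open>The It\^o integral \<open>J t = \<integral>\<^sub>0\<^sup>t H dB\<close>, for \<open>t \<in> T\<close>, of an adapted integrand with continuous paths:
  the limit in probability of the left-point sums as the mesh of the subdivision tends to zero.
  For adapted integrands with continuous paths, the only ones used below, this limit always exists
  and is the It\^o integral.\<close>

definition is_ito_integral :: "'a measure \<Rightarrow> (real \<Rightarrow> 'a \<Rightarrow> real) \<Rightarrow> real set \<Rightarrow>
    (real \<Rightarrow> 'a \<Rightarrow> real) \<Rightarrow> (real \<Rightarrow> 'a \<Rightarrow> real) \<Rightarrow> bool" where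
  "is_ito_integral M B T H J \<longleftrightarrow>
     (\<forall>t\<in>T. \<forall>\<epsilon>>0. \<exists>\<delta>>0. \<forall>n \<pi>. fine_subdivision t \<delta> n \<pi> \<longrightarrow>
        measure M {\<omega>\<in>space M.
          \<bar>(\<Sum>i<n. H (\<pi> i) \<omega> * (B (\<pi> (Suc i)) \<omega> - B (\<pi> i) \<omega>)) - J t \<omega>\<bar> > \<epsilon>} < \<epsilon>)"

text \<open>\<open>Y\<close> solves \<open>dY = b(t, Y) dt + \<rho>(t, Y) dB\<close> on the time set \<open>T\<close>, an interval starting at \<open>0\<close>.
  It is used for continuous coefficients only, so that the drift integral exists.\<close>

definition sde_solution :: "'a measure \<Rightarrow> (real \<Rightarrow> 'a measure) \<Rightarrow> (real \<Rightarrow> 'a \<Rightarrow> real) \<Rightarrow> real set \<Rightarrow>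
    (real \<Rightarrow> real \<Rightarrow> real) \<Rightarrow> (real \<Rightarrow> real \<Rightarrow> real) \<Rightarrow> (real \<Rightarrow> 'a \<Rightarrow> real) \<Rightarrow> bool" where
  "sde_solution M F B T b \<rho> Y \<longleftrightarrow>
     adapted F T Y \<and>
     (AE \<omega> in M. continuous_on T (\<lambda>t. Y t \<omega>)) \<and>
     is_ito_integral M B T (\<lambda>t \<omega>. \<rho> t (Y t \<omega>))
       (\<lambda>t \<omega>. Y t \<omega> - Y 0 \<omega> - integral {0..t} (\<lambda>r. b r (Y r \<omega>)))"

text \<open>A strong solution started in \<open>x\<close> is adapted to the augmented filtration of \<open>B\<close>.\<close>

definition strong_solution :: "'a measure \<Rightarrow> (real \<Rightarrow> 'a \<Rightarrow> real) \<Rightarrow> real set \<Rightarrow>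
    (real \<Rightarrow> real \<Rightarrow> real) \<Rightarrow> (real \<Rightarrow> real \<Rightarrow> real) \<Rightarrow> real \<Rightarrow> (real \<Rightarrow> 'a \<Rightarrow> real) \<Rightarrow> bool" where
  "strong_solution M B T b \<rho> x Y \<longleftrightarrow>
     sde_solution M (augmented_filtration M {0..1} B) B T b \<rho> Y \<and> (AE \<omega> in M. Y 0 \<omega> = x)"


section \<open>Markov processes with a transition density\<close>

definition transition_density :: "real set \<Rightarrow> (real \<Rightarrow> real \<Rightarrow> real \<Rightarrow> real \<Rightarrow> real) \<Rightarrow> bool" where
  "transition_density I p \<longleftrightarrow>
     (\<forall>s\<in>I. \<forall>t\<in>I. s < t \<longrightarrow>
        (\<lambda>(u, v). p s u t v) \<in> borel_measurable (borel \<Otimes>\<^sub>M borel) \<and>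
        (\<forall>u v. 0 \<le> p s u t v) \<and>
        (\<forall>u. (\<integral>\<^sup>+ v. ennreal (p s u t v) \<partial>lborel) = 1)) \<and>
     (\<forall>r\<in>I. \<forall>s\<in>I. \<forall>t\<in>I. r < s \<longrightarrow> s < t \<longrightarrow>
        (\<forall>u w. (\<integral>\<^sup>+ v. ennreal (p r u s v * p s v t w) \<partial>lborel) = ennreal (p r u t w)))"

definition markov_process :: "'a measure \<Rightarrow> (real \<Rightarrow> 'a measure) \<Rightarrow> real set \<Rightarrow>
    (real \<Rightarrow> real \<Rightarrow> real \<Rightarrow> real \<Rightarrow> real) \<Rightarrow> (real \<Rightarrow> 'a \<Rightarrow> real) \<Rightarrow> bool" where
  "markov_process M F I p Y \<longleftrightarrow>
     transition_density I p \<and> adapted F I Y \<and>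
     (\<forall>s\<in>I. \<forall>t\<in>I. s < t \<longrightarrow> (\<forall>A\<in>sets borel.
        AE \<omega> in M. real_cond_exp M (F s) (\<lambda>\<omega>. indicator A (Y t \<omega>)) \<omega>
                 = (LINT v:A|lborel. p s (Y s \<omega>) t v)))"

definition bridge_density :: "(real \<Rightarrow> real \<Rightarrow> real \<Rightarrow> real \<Rightarrow> real) \<Rightarrow> real \<Rightarrow>
    (real \<Rightarrow> real \<Rightarrow> real \<Rightarrow> real \<Rightarrow> real)" where
  "bridge_density p y s u t v = p s u t v * p t v 1 y / p s u 1 y"

text \<open>\<open>L\<close> is the law, on the product space of paths over \<open>[0, 1)\<close>, of the bridge between \<open>x\<close> and \<open>y\<close>:
  under \<open>L\<close> the coordinate process is Markov, starts in \<open>x\<close> and has the bridge transition density.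
  These properties determine \<open>L\<close>.\<close>

definition is_bridge_law :: "(real \<Rightarrow> real \<Rightarrow> real \<Rightarrow> real \<Rightarrow> real) \<Rightarrow> real \<Rightarrow> real \<Rightarrow>
    (real \<Rightarrow> real) measure \<Rightarrow> bool" where
  "is_bridge_law p x y L \<longleftrightarrow>
     prob_space L \<and> sets L = sets (PiM {0..<1} (\<lambda>_. borel)) \<and>
     (AE w in L. w 0 = x) \<and>
     markov_process L (natural_filtration (space L) {0..<1} (\<lambda>t w. w t)) {0..<1}
       (bridge_density p y) (\<lambda>t w. w t)"

definition path_law :: "'a measure \<Rightarrow> (real \<Rightarrow> 'a \<Rightarrow> real) \<Rightarrow> (real \<Rightarrow> real) measure" where
  "path_law M Y = distr M (PiM {0..<1} (\<lambda>_. borel)) (\<lambda>\<omega>. \<lambda>t\<in>{0..<1}. Y t \<omega>)"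

definition corresponds_to_bridges :: "'a measure \<Rightarrow> (real \<Rightarrow> real \<Rightarrow> real \<Rightarrow> 'a \<Rightarrow> real) \<Rightarrow>
    (real \<Rightarrow> real \<Rightarrow> real \<Rightarrow> real \<Rightarrow> real) \<Rightarrow> bool" where
  "corresponds_to_bridges M X p \<longleftrightarrow> (\<forall>x y. is_bridge_law p x y (path_law M (X x y)))"


section \<open>Regular It\^o diffusions\<close>

text \<open>\<open>Z\<close> is always a continuous process on \<open>[0, 1]\<close> with a strictly positive transition density
  on \<open>[0, 1]\<close>.  The parameter \<open>T\<close>, either \<open>[0, 1]\<close> or \<open>[0, 1)\<close>, is the time set on which the
  coefficients are \<open>C\<^sup>1\<^sup>,\<^sup>2\<close> with positive \<open>\<rho>\<close>, on which the equation holds, and over which the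
  forward time variable of the density is differentiated.

  With \<open>T = [0, 1]\<close> the diffusion coefficient has a positive \<open>C\<^sup>1\<close> limit at time \<open>1\<close>, which the
  equation \<open>dZ = \<sigma>(t) dB\<close> need not satisfy when \<open>\<sigma>\<close> is \<open>C\<^sup>1\<close> and positive on \<open>[0, 1)\<close> only: take
  \<open>\<sigma>(t) = 1 - t\<close> or \<open>\<sigma>(t) = (1 - t) powr (-1/4)\<close>.  For such \<open>\<sigma>\<close> one needs \<open>T = [0, 1)\<close>, and the
  value of \<open>Z\<close> at time \<open>1\<close> is then given by continuity of the paths.
  Regularity with \<open>T = [0, 1]\<close> implies regularity with \<open>T = [0, 1)\<close>, see
  \<open>regular_ito_diffusion_half_open\<close> below.\<close>

definition regular_ito_diffusion :: "real set \<Rightarrow> 'a measure \<Rightarrow> (real \<Rightarrow> 'a measure) \<Rightarrow>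
    (real \<Rightarrow> 'a \<Rightarrow> real) \<Rightarrow> (real \<Rightarrow> real \<Rightarrow> real) \<Rightarrow> (real \<Rightarrow> real \<Rightarrow> real) \<Rightarrow>
    (real \<Rightarrow> real \<Rightarrow> real \<Rightarrow> real \<Rightarrow> real) \<Rightarrow> (real \<Rightarrow> 'a \<Rightarrow> real) \<Rightarrow> bool" where
  "regular_ito_diffusion T M F B b \<rho> p Z \<longleftrightarrow>
     usual_filtered_space M F \<and> brownian_motion M F B \<and>
     (AE \<omega> in M. continuous_on {0..1} (\<lambda>t. Z t \<omega>)) \<and>
     sde_solution M F B T b \<rho> Z \<and>
     C12_on T b \<and> C12_on T \<rho> \<and> (\<forall>t\<in>T. \<forall>z. 0 < \<rho> t z) \<and>
     markov_process M F {0..1} p Z \<and>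
     (\<forall>t\<^sub>1\<in>{0..<1}. \<forall>t\<^sub>2\<in>{t\<^sub>1<..1}. \<forall>z\<^sub>1 z\<^sub>2.
        0 < p t\<^sub>1 z\<^sub>1 t\<^sub>2 z\<^sub>2 \<and>
        (\<lambda>t. p t z\<^sub>1 t\<^sub>2 z\<^sub>2) differentiable (at t\<^sub>1 within {0..<t\<^sub>2}) \<and>
        (\<lambda>z. p t\<^sub>1 z t\<^sub>2 z\<^sub>2) differentiable (at z\<^sub>1) \<and>
        (t\<^sub>2 \<in> T \<longrightarrow> (\<lambda>t. p t\<^sub>1 z\<^sub>1 t z\<^sub>2) differentiable (at t\<^sub>2 within T \<inter> {t\<^sub>1<..})) \<and>
        (\<lambda>z. p t\<^sub>1 z\<^sub>1 t\<^sub>2 z) differentiable (at z\<^sub>2)) \<and>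
     (\<forall>t\<^sub>1\<in>{0..<1}. \<forall>z\<^sub>1. C2_on (T \<inter> {t\<^sub>1<..}) (p t\<^sub>1 z\<^sub>1))"


lemma continuous_on_times_subset:
  "continuous_on (S \<times> UNIV) f \<Longrightarrow> S' \<subseteq> S \<Longrightarrow> continuous_on (S' \<times> UNIV) f"
  by (rule continuous_on_subset) auto

lemma C12_on_subset: "C12_on S f \<Longrightarrow> S' \<subseteq> S \<Longrightarrow> C12_on S' f"
  unfolding C12_on_def
  by (elim ex_forward conj_forward) (blast intro: DERIV_subset continuous_on_times_subset)+

lemma C2_on_subset: "C2_on S f \<Longrightarrow> S' \<subseteq> S \<Longrightarrow> C2_on S' f"
  unfolding C2_on_def
  by (elim ex_forward conj_forward) (blast intro: DERIV_subset continuous_on_times_subset)+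

lemma regular_ito_diffusion_half_open:
  assumes "regular_ito_diffusion {0..1} M F B b \<rho> p Z"
  shows "regular_ito_diffusion {0..<1} M F B b \<rho> p Z"
proof -
  have sub: "{0..<1} \<subseteq> {0..1::real}" by auto
  have "sde_solution M F B {0..<1} b \<rho> Z"
    using assms unfolding regular_ito_diffusion_def sde_solution_def adapted_def is_ito_integral_def
    by (auto elim!: eventually_mono intro: continuous_on_subset[OF _ sub])
  moreover have "f differentiable (at t within {0..<1} \<inter> {s<..})"
    if "f differentiable (at t within {0..1} \<inter> {s<..})" for f :: "real \<Rightarrow> real" and s t
    using that by (rule differentiable_within_subset) auto
  moreover have "C2_on ({0..<1} \<inter> {s<..}) f" if "C2_on ({0..1} \<inter> {s<..}) f" for s f
    using that by (rule C2_on_subset) auto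
  ultimately show ?thesis
    using assms C12_on_subset[OF _ sub] unfolding regular_ito_diffusion_def by auto
qed


section \<open>Gaussian processes\<close>

definition gaussian_process :: "'a measure \<Rightarrow> real set \<Rightarrow> (real \<Rightarrow> 'a \<Rightarrow> real) \<Rightarrow> bool" where
  "gaussian_process M I Y \<longleftrightarrow>
     (\<forall>t\<in>I. Y t \<in> borel_measurable M) \<and>
     (\<forall>J c. finite J \<and> J \<subseteq> I \<longrightarrow>
        (\<exists>m s. distr M borel (\<lambda>\<omega>. \<Sum>t\<in>J. c t * Y t \<omega>) = return borel m \<or>
               0 < s \<and> distributed M lborel (\<lambda>\<omega>. \<Sum>t\<in>J. c t * Y t \<omega>) (normal_density m s)))"

end

theory Submission
  imports Defs
begin

text \<open>Put \<open>e t = exp (\<integral>\<^sub>0\<^sup>t h)\<close>, \<open>J t = \<integral>\<^sub>0\<^sup>t e \<sigma> dB\<close> and \<open>v t = \<integral>\<^sub>0\<^sup>t (e \<sigma>)\<^sup>2 dr\<close>.  Variation of constants gives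
  \<open>X x y t = y + (x - y + J t) / e t\<close>, so that \<open>X x y t\<close> is Gaussian with variance \<open>v t / (e t)\<^sup>2\<close>.

  If the \<open>X x y\<close> are the bridges of a process with positive transition density \<open>p\<close>, then
  \<open>p 0 x t z * p t z 1 y / p 0 x 1 y\<close> is the density of \<open>X x y t\<close>.  In the cross ratio of these
  densities over \<open>x, y \<in> {0, 1}\<close> all factors that depend on \<open>t\<close> cancel, whereas for the Gaussian
  densities its logarithm is, up to sign, \<open>(e t - 1) / v t\<close>.  Hence \<open>e t - 1 = \<kappa> v t\<close> for a constant \<open>\<kappa>\<close>.
  Differentiating, \<open>h = \<kappa> e \<sigma>\<^sup>2\<close>, so \<open>1 / e t = 1 - \<kappa> \<integral>\<^sub>0\<^sup>t \<sigma>\<^sup>2\<close>.  Pinning forces \<open>1 / e t \<rightarrow> 0\<close>, since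
  \<open>X 1 0 t - X 0 0 t = 1 / e t\<close>; this yields \<open>\<Sigma> = 1 / \<kappa>\<close> and the formula for \<open>h\<close>.

  Conversely, that formula makes \<open>X x y\<close> a Gaussian Markov process whose transition density is
  the bridge density of the Gaussian kernel with variance \<open>\<integral>\<^sub>s\<^sup>t \<sigma>\<^sup>2\<close>, the transition density of
  \<open>Z t = \<integral>\<^sub>0\<^sup>t \<sigma> dB\<close>.  When \<open>\<sigma>\<close> is only given on \<open>[0, 1)\<close>, convergence of \<open>Z\<close> at time \<open>1\<close> follows
  from pinning through an integration by parts.

  As the integrands are \<open>C\<^sup>1\<close> functions of time, all stochastic integrals are defined path by path
  through integration by parts, and no It\^o calculus is needed.\<close>

text \<open>The equation gives information only on left-point sums, in probability and at one fixed
  time, whereas the formula for \<open>X x y\<close> is needed for all times at once. For a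
  \<open>C\<^sup>1\<close> integrand, integration by parts makes the same sums converge along every
  continuous path. Both limits therefore agree almost surely at each rational time, and continuity
  of the paths does the rest.

  Independence is carried through limits as an identity of characteristic functions tested against
  bounded variables. Laws, independence in the usual sense and the freezing of variables are
  recovered from that identity afterwards.

  In the necessity part the densities of \<open>X x y t\<close> are known only almost everywhere.
  The cross ratio tolerates this, since it is the same for every \<open>z\<close> and one common
  good point suffices. It measures how strongly \<open>p\<close> couples its end points; for a
  Gaussian kernel of variance \<Sigma> its logarithm is \<open>1 / \<Sigma>\<close>, which is why
  \<kappa> turns out to be the inverse of \<Sigma>.\<close>

section \<open>Wiener integrals of continuously differentiable functions, path by path\<close>

text \<open>Nothing bounds the variation of \<beta>, so the sums cannot be compared with an integral
  against \<beta>. Abel summation moves the increments to \<open>g\<close>; the oscillation of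
  \<beta> over a cell then controls the error, uniformly over all subdivisions of small
  mesh.\<close>

lemma riemann_stieltjes_by_parts:
  fixes \<beta> g g' :: "real \<Rightarrow> real"
  assumes "s \<le> t" and \<beta>: "continuous_on {s..t} \<beta>"
    and g: "\<And>r. r \<in> {s..t} \<Longrightarrow> (g has_real_derivative g' r) (at r within {s..t})"
    and g': "continuous_on {s..t} g'" and "0 < \<epsilon>"
  shows "\<exists>\<delta>>0. \<forall>n \<pi>. \<pi> 0 = s \<and> \<pi> n = t \<and> (\<forall>i<n. \<pi> i \<le> \<pi> (Suc i) \<and> \<pi> (Suc i) - \<pi> i < \<delta>) \<longrightarrow>
    \<bar>(\<Sum>i<n. g (\<pi> i) * (\<beta> (\<pi> (Suc i)) - \<beta> (\<pi> i)))
      - (g t * \<beta> t - g s * \<beta> s - integral {s..t} (\<lambda>r. \<beta> r * g' r))\<bar> < \<epsilon>"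
proof -
  obtain C where C: "C > 0" "\<And>r. r \<in> {s..t} \<Longrightarrow> \<bar>g' r\<bar> \<le> C"
    using compact_imp_bounded[OF compact_continuous_image[OF g' compact_Icc]]
    by (auto simp: bounded_pos)
  \<comment> \<open>The errors add up to at most \<open>\<eta> * C * (t - s)\<close>. The summand 1
    keeps the denominator positive when \<open>s = t\<close>.\<close>
  define \<eta> where "\<eta> = \<epsilon> / (2 * C * (t - s + 1))"
  have \<eta>: "\<eta> > 0" using \<open>s \<le> t\<close> \<open>0 < \<epsilon>\<close> C by (auto simp: \<eta>_def)
  have "uniformly_continuous_on {s..t} \<beta>"
    using \<beta> by (intro compact_uniformly_continuous) auto
  then obtain \<delta> where \<delta>: "\<delta> > 0"
    "\<And>r r'. r \<in> {s..t} \<Longrightarrow> r' \<in> {s..t} \<Longrightarrow> dist r' r < \<delta> \<Longrightarrow> dist (\<beta> r') (\<beta> r) < \<eta>"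
    using \<eta> unfolding uniformly_continuous_on_def by metis
  show ?thesis
  proof (intro exI[of _ \<delta>] conjI allI impI \<open>\<delta> > 0\<close>)
    fix n \<pi> assume A: "\<pi> 0 = s \<and> \<pi> n = t \<and> (\<forall>i<n. \<pi> i \<le> \<pi> (Suc i) \<and> \<pi> (Suc i) - \<pi> i < \<delta>)"
    have mono: "\<pi> i \<le> \<pi> j" if "i \<le> j" "j \<le> n" for i j
      using that
    proof (induction j)
      case (Suc j) then show ?case using A by (cases "i = Suc j") (auto intro: order_trans[of _ "\<pi> j"])
    qed simp
    have rng: "\<pi> i \<in> {s..t}" if "i \<le> n" for i using mono[of 0 i] mono[of i n] that A by auto
    have int: "(\<lambda>r. \<beta> r * g' r) integrable_on {a..b}" if "s \<le> a" "b \<le> t" for a b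
      using that by (intro integrable_continuous_real continuous_intros continuous_on_subset[OF \<beta>] continuous_on_subset[OF g']) auto
    have intg: "(g' has_integral (g b - g a)) {a..b}" if "s \<le> a" "a \<le> b" "b \<le> t" for a b
      using that by (intro fundamental_theorem_of_calculus)
        (auto simp flip: has_real_derivative_iff_has_vector_derivative intro!: DERIV_subset[OF g])
    \<comment> \<open>As the integral of \<open>g'\<close> over a cell is the increment of
      \<open>g\<close>, the difference is the integral of \<open>g'\<close> times the deviation of
      \<beta> from its value at the right end.\<close>
    have step: "\<bar>integral {\<pi> i..\<pi> (Suc i)} (\<lambda>r. \<beta> r * g' r) - \<beta> (\<pi> (Suc i)) * (g (\<pi> (Suc i)) - g (\<pi> i))\<bar>
        \<le> \<eta> * C * (\<pi> (Suc i) - \<pi> i)" if "i < n" for i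
    proof -
      have r: "\<pi> i \<in> {s..t}" "\<pi> (Suc i) \<in> {s..t}" "\<pi> i \<le> \<pi> (Suc i)"
        using rng[of i] rng[of "Suc i"] that A by auto
      have "((\<lambda>r. \<beta> r * g' r - \<beta> (\<pi> (Suc i)) * g' r) has_integral
          (integral {\<pi> i..\<pi> (Suc i)} (\<lambda>r. \<beta> r * g' r) - \<beta> (\<pi> (Suc i)) * (g (\<pi> (Suc i)) - g (\<pi> i))))
          {\<pi> i..\<pi> (Suc i)}"
        using r by (intro has_integral_diff has_integral_mult_right intg integrable_integral int) auto
      then have "norm (integral {\<pi> i..\<pi> (Suc i)} (\<lambda>r. \<beta> r * g' r) - \<beta> (\<pi> (Suc i)) * (g (\<pi> (Suc i)) - g (\<pi> i)))
          \<le> \<eta> * C * measure lborel {\<pi> i..\<pi> (Suc i)}"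
      proof (rule has_integral_bound_real[of _ "{}", rotated 2])
        fix x assume x: "x \<in> {\<pi> i..\<pi> (Suc i)} - {}"
        have "\<bar>\<beta> x - \<beta> (\<pi> (Suc i))\<bar> \<le> \<eta>"
          using \<delta>(2)[of "\<pi> (Suc i)" x] x r A \<open>i < n\<close> by (force simp: dist_real_def)
        then have "\<bar>\<beta> x - \<beta> (\<pi> (Suc i))\<bar> * \<bar>g' x\<bar> \<le> \<eta> * C"
          using C(2)[of x] x r \<eta> by (intro mult_mono) auto
        then show "norm (\<beta> x * g' x - \<beta> (\<pi> (Suc i)) * g' x) \<le> \<eta> * C"
          by (simp add: left_diff_distrib[symmetric] abs_mult)
      qed (use \<eta> C in auto)
      then show ?thesis using r by simp
    qed
    have ind: "\<bar>integral {s..\<pi> k} (\<lambda>r. \<beta> r * g' r) - (\<Sum>i<k. \<beta> (\<pi> (Suc i)) * (g (\<pi> (Suc i)) - g (\<pi> i)))\<bar>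
        \<le> \<eta> * C * (\<pi> k - s)" if "k \<le> n" for k
      using that
    proof (induction k)
      case 0 then show ?case using A by simp
    next
      case (Suc k)
      have "integral {s..\<pi> k} (\<lambda>r. \<beta> r * g' r) + integral {\<pi> k..\<pi> (Suc k)} (\<lambda>r. \<beta> r * g' r)
          = integral {s..\<pi> (Suc k)} (\<lambda>r. \<beta> r * g' r)"
        using Suc.prems rng[of k] rng[of "Suc k"] mono[of k "Suc k"] by (intro Henstock_Kurzweil_Integration.integral_combine int) auto
      moreover have "\<eta> * C * (\<pi> (Suc k) - s) = \<eta> * C * (\<pi> k - s) + \<eta> * C * (\<pi> (Suc k) - \<pi> k)"
        by (simp add: algebra_simps)
      ultimately show ?case using Suc step[of k] by (simp add: abs_le_iff)
    qed
    \<comment> \<open>Abel summation: left end points for \<open>g\<close> turn into right end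
      points for \<beta>.\<close>
    have parts: "(\<Sum>i<k. g (\<pi> i) * (\<beta> (\<pi> (Suc i)) - \<beta> (\<pi> i)))
        = g (\<pi> k) * \<beta> (\<pi> k) - g s * \<beta> s - (\<Sum>i<k. \<beta> (\<pi> (Suc i)) * (g (\<pi> (Suc i)) - g (\<pi> i)))" for k
      using A by (induction k) (auto simp: algebra_simps)
    have "\<eta> * C * (t - s) < \<epsilon>"
    proof -
      have "\<eta> * C * (t - s) = \<epsilon> * ((t - s) / (2 * (t - s + 1)))"
        using C \<open>s \<le> t\<close> by (simp add: \<eta>_def)
      also have "\<dots> < \<epsilon> * 1" using \<open>0 < \<epsilon>\<close> \<open>s \<le> t\<close> by (intro mult_strict_left_mono) (auto simp: field_simps)
      finally show ?thesis by simp
    qed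
    then show "\<bar>(\<Sum>i<n. g (\<pi> i) * (\<beta> (\<pi> (Suc i)) - \<beta> (\<pi> i)))
      - (g t * \<beta> t - g s * \<beta> s - integral {s..t} (\<lambda>r. \<beta> r * g' r))\<bar> < \<epsilon>"
      using ind[of n] parts[of n] A by (simp add: abs_if split: if_splits)
  qed
qed

text \<open>With \<open>Suc n\<close> cells nothing is divided by zero at \<open>n = 0\<close>. The
  last but one point of the subdivision of \<open>{0..1}\<close>, namely \<open>n / (n + 1)\<close>,
  later serves as a sequence tending to 1 from below.\<close>

definition uniform_subdivision :: "real \<Rightarrow> real \<Rightarrow> nat \<Rightarrow> nat \<Rightarrow> real" where
  "uniform_subdivision s t n i = s + real i * (t - s) / real (Suc n)"

lemma uniform_subdivision:
  assumes "s \<le> t"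
  shows "uniform_subdivision s t n 0 = s" "uniform_subdivision s t n (Suc n) = t"
    "uniform_subdivision s t n i \<le> uniform_subdivision s t n (Suc i)"
    "i \<le> Suc n \<Longrightarrow> uniform_subdivision s t n i \<in> {s..t}"
    "uniform_subdivision s t n (Suc i) - uniform_subdivision s t n i = (t - s) / real (Suc n)"
proof -
  show "i \<le> Suc n \<Longrightarrow> uniform_subdivision s t n i \<in> {s..t}"
  proof -
    assume "i \<le> Suc n"
    then have "real i * (t - s) \<le> (t - s) * real (Suc n)"
      using assms by (subst mult.commute) (intro mult_left_mono, auto)
    then show ?thesis using assms
      by (auto simp: uniform_subdivision_def pos_divide_le_eq simp del: of_nat_Suc dest: add_left_mono[of _ _ s])
        (smt (verit) of_nat_0_less_iff pos_divide_le_eq zero_less_Suc)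
  qed
  show "uniform_subdivision s t n 0 = s" "uniform_subdivision s t n (Suc n) = t"
    by (auto simp: uniform_subdivision_def simp del: of_nat_Suc)
  show *: "uniform_subdivision s t n (Suc i) - uniform_subdivision s t n i = (t - s) / real (Suc n)"
    unfolding uniform_subdivision_def of_nat_Suc[of i] by (simp add: add_divide_distrib distrib_right)
  have "0 \<le> (t - s) / real (Suc n)" using assms by simp
  with * show "uniform_subdivision s t n i \<le> uniform_subdivision s t n (Suc i)" by linarith
qed

lemma uniform_subdivision_mesh:
  assumes "s \<le> t" "0 < \<delta>"
  shows "\<forall>\<^sub>F n in sequentially. \<forall>i. uniform_subdivision s t n (Suc i) - uniform_subdivision s t n i < \<delta>"
proof -
  have "(\<lambda>n. (t - s) * inverse (real (Suc n))) \<longlonglongrightarrow> (t - s) * 0"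
    by (intro tendsto_intros LIMSEQ_inverse_real_of_nat)
  then have "\<forall>\<^sub>F n in sequentially. (t - s) * inverse (real (Suc n)) < \<delta>"
    using assms by (intro order_tendstoD) auto
  then show ?thesis unfolding uniform_subdivision(5)[OF assms(1)] by (simp add: divide_inverse)
qed

lemma riemann_stieltjes_by_parts_seq:
  fixes \<beta> g g' :: "real \<Rightarrow> real"
  assumes "s \<le> t" and \<beta>: "continuous_on {s..t} \<beta>"
    and g: "\<And>r. r \<in> {s..t} \<Longrightarrow> (g has_real_derivative g' r) (at r within {s..t})"
    and g': "continuous_on {s..t} g'"
  shows "(\<lambda>n. \<Sum>i<Suc n. g (uniform_subdivision s t n i) *
      (\<beta> (uniform_subdivision s t n (Suc i)) - \<beta> (uniform_subdivision s t n i)))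
    \<longlonglongrightarrow> g t * \<beta> t - g s * \<beta> s - integral {s..t} (\<lambda>r. \<beta> r * g' r)"
proof (rule tendstoI)
  fix \<epsilon> :: real assume "0 < \<epsilon>"
  from riemann_stieltjes_by_parts[OF assms this] obtain \<delta> where "\<delta> > 0" and \<delta>:
    "\<And>n \<pi>. \<pi> 0 = s \<and> \<pi> n = t \<and> (\<forall>i<n. \<pi> i \<le> \<pi> (Suc i) \<and> \<pi> (Suc i) - \<pi> i < \<delta>) \<Longrightarrow>
    \<bar>(\<Sum>i<n. g (\<pi> i) * (\<beta> (\<pi> (Suc i)) - \<beta> (\<pi> i)))
      - (g t * \<beta> t - g s * \<beta> s - integral {s..t} (\<lambda>r. \<beta> r * g' r))\<bar> < \<epsilon>" by blast
  from uniform_subdivision_mesh[OF \<open>s \<le> t\<close> \<open>\<delta> > 0\<close>]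
  show "\<forall>\<^sub>F n in sequentially. dist (\<Sum>i<Suc n. g (uniform_subdivision s t n i) *
      (\<beta> (uniform_subdivision s t n (Suc i)) - \<beta> (uniform_subdivision s t n i)))
     (g t * \<beta> t - g s * \<beta> s - integral {s..t} (\<lambda>r. \<beta> r * g' r)) < \<epsilon>"
    unfolding dist_real_def
    by (rule eventually_mono, intro \<delta>) (auto simp only: uniform_subdivision[OF \<open>s \<le> t\<close>])
qed

text \<open>The two possible domains of the coefficients.\<close>

definition time_set :: "real set \<Rightarrow> bool" where
  "time_set T \<longleftrightarrow> T = {0..<1} \<or> T = {0..1}"

lemma time_set:
  assumes "time_set T"
  shows "0 \<in> T" "t \<in> T \<Longrightarrow> 0 \<le> t" "t \<in> T \<Longrightarrow> t \<le> 1" "t \<in> T \<Longrightarrow> 0 \<le> s \<Longrightarrow> s \<le> t \<Longrightarrow> s \<in> T"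
    "t \<in> T \<Longrightarrow> 0 \<le> s \<Longrightarrow> {s..t} \<subseteq> T" "convex T" "{0..<1} \<subseteq> T" "T \<subseteq> {0..1}"
  using assms by (auto simp: time_set_def)

lemma has_derivative_integral_time_set:
  fixes f :: "real \<Rightarrow> real"
  assumes "time_set T" "continuous_on T f" "t \<in> T"
  shows "((\<lambda>t. integral {0..t} f) has_real_derivative f t) (at t within T)"
proof (cases "T = {0..1}")
  case True
  then show ?thesis using integral_has_real_derivative[of 0 1 f t] assms by auto
next
  case False
  then have T: "T = {0..<1}" using assms by (auto simp: time_set_def)
  \<comment> \<open>Integrals are differentiated on compact intervals; close to \<open>t\<close> the
    sets \<open>{0..c}\<close> and \<open>{0..<1}\<close> agree.\<close>
  define c where "c = (t + 1) / 2"
  have c: "t < c" "c < 1" "0 \<le> t" using assms T by (auto simp: c_def)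
  have "((\<lambda>t. integral {0..t} f) has_real_derivative f t) (at t within {0..c})"
    using c assms T by (intro integral_has_real_derivative continuous_on_subset[OF assms(2)]) auto
  moreover have "at t within {0..c} = at t within T"
    by (rule at_within_nhd[of _ "{..<c}"]) (use c T in auto)
  ultimately show ?thesis by simp
qed

lemma zero_derivative_time_set:
  fixes f :: "real \<Rightarrow> real"
  assumes "time_set T" "\<And>t. t \<in> T \<Longrightarrow> (f has_real_derivative 0) (at t within T)" "t \<in> T"
  shows "f t = f 0"
  using has_field_derivative_zero_constant[OF time_set(6)[OF assms(1)] assms(2)] assms(3) time_set(1)[OF assms(1)]
  by metis

lemma integral_time_set_strict_mono:
  fixes f :: "real \<Rightarrow> real"
  assumes T: "time_set T" and f: "continuous_on T f" and pos: "\<And>r. r \<in> T \<Longrightarrow> 0 < f r"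
    and "0 \<le> s" "s < t" "t \<in> T"
  shows "integral {0..s} f < integral {0..t} f"
proof (rule DERIV_pos_imp_increasing_open[OF \<open>s < t\<close>])
  fix x assume x: "s < x" "x < t"
  then have xT: "x \<in> T" using time_set(4)[OF T \<open>t \<in> T\<close>, of x] assms by auto
  have "((\<lambda>t. integral {0..t} f) has_real_derivative f x) (at x)"
    using has_derivative_integral_time_set[OF T f xT]
      at_within_nhd[of x "{s<..<t}" T UNIV] x
      Int_absorb1[of "{s<..<t}" T] time_set(5)[OF T \<open>t \<in> T\<close> \<open>0 \<le> s\<close>]
    by (fastforce simp: subset_iff)
  then show "\<exists>y. ((\<lambda>t. integral {0..t} f) has_real_derivative y) (at x) \<and> 0 < y"
    using pos[OF xT] by blast
next
  show "continuous_on {s..t} (\<lambda>t. integral {0..t} f)"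
    using time_set(5)[OF T \<open>t \<in> T\<close> \<open>0 \<le> s\<close>]
    by (intro continuous_on_subset[OF DERIV_continuous_on, of T _ f]
      has_derivative_integral_time_set[OF T f])
qed

text \<open>The Wiener integral \<open>\<integral>\<^sub>0\<^sup>t g d\<beta>\<close>, defined path by path through integration by parts; \<open>g'\<close> is
  the derivative of \<open>g\<close>.\<close>

definition wiener_integral ::
    "(real \<Rightarrow> real) \<Rightarrow> (real \<Rightarrow> real) \<Rightarrow> (real \<Rightarrow> real) \<Rightarrow> real \<Rightarrow> real" where
  "wiener_integral g g' \<beta> t = g t * \<beta> t - integral {0..t} (\<lambda>r. \<beta> r * g' r)"

definition C1_deriv :: "real set \<Rightarrow> (real \<Rightarrow> real) \<Rightarrow> (real \<Rightarrow> real) \<Rightarrow> bool" where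
  "C1_deriv T g g' \<longleftrightarrow> (\<forall>t\<in>T. (g has_real_derivative g' t) (at t within T)) \<and> continuous_on T g'"

lemma C1_on_iff_deriv: "C1_on T g \<longleftrightarrow> (\<exists>g'. C1_deriv T g g')"
  by (simp add: C1_on_def C1_deriv_def)

lemma C1_derivD:
  assumes "C1_deriv T g g'"
  shows "t \<in> T \<Longrightarrow> (g has_real_derivative g' t) (at t within T)" "continuous_on T g'" "continuous_on T g"
  using assms by (auto simp: C1_deriv_def intro: DERIV_continuous_on)

lemma C1_deriv_subset: "C1_deriv T g g' \<Longrightarrow> S \<subseteq> T \<Longrightarrow> C1_deriv S g g'"
  unfolding C1_deriv_def by (meson DERIV_subset continuous_on_subset subsetD)

lemma C1_deriv_mult:
  assumes "C1_deriv T f f'" "C1_deriv T g g'"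
  shows "C1_deriv T (\<lambda>t. f t * g t) (\<lambda>t. f' t * g t + g' t * f t)"
  using assms C1_derivD(3)[OF assms(1)] C1_derivD(3)[OF assms(2)]
  unfolding C1_deriv_def by (auto intro!: DERIV_mult continuous_intros)

lemma has_derivative_wiener_compensator:
  assumes "time_set T" "C1_deriv T g g'" "continuous_on T \<beta>" "t \<in> T"
  shows "((\<lambda>t. integral {0..t} (\<lambda>r. \<beta> r * g' r)) has_real_derivative \<beta> t * g' t) (at t within T)"
  using assms by (intro has_derivative_integral_time_set continuous_intros) (auto simp: C1_deriv_def)

lemma continuous_on_wiener_integral:
  assumes "time_set T" "C1_deriv T g g'" "continuous_on T \<beta>"
  shows "continuous_on T (wiener_integral g g' \<beta>)"
  unfolding wiener_integral_def
  using DERIV_continuous_on[OF has_derivative_wiener_compensator[OF assms]]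
  by (intro continuous_intros C1_derivD(3)[OF assms(2)] assms(3))

lemma wiener_integral_diff:
  assumes "time_set T" "C1_deriv T g g'" "continuous_on T \<beta>" "t \<in> T" "0 \<le> s" "s \<le> t"
  shows "wiener_integral g g' \<beta> t - wiener_integral g g' \<beta> s =
    g t * \<beta> t - g s * \<beta> s - integral {s..t} (\<lambda>r. \<beta> r * g' r)"
proof -
  have "(\<lambda>r. \<beta> r * g' r) integrable_on {0..t}"
    using assms(2) time_set(5)[OF assms(1,4), of 0]
    by (intro integrable_continuous_real continuous_intros continuous_on_subset[OF assms(3)])
      (auto simp: C1_deriv_def intro: continuous_on_subset)
  from Henstock_Kurzweil_Integration.integral_combine[OF assms(5,6) this] show ?thesis by (simp add: wiener_integral_def)
qed

text \<open>Measurability and the Gaussian law of the pathwise integral are both inherited from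
  these sums.\<close>

lemma wiener_integral_seq:
  assumes "time_set T" "C1_deriv T g g'" "continuous_on T \<beta>" "t \<in> T" "0 \<le> s" "s \<le> t"
  shows "(\<lambda>n. \<Sum>i<Suc n. g (uniform_subdivision s t n i) *
      (\<beta> (uniform_subdivision s t n (Suc i)) - \<beta> (uniform_subdivision s t n i)))
    \<longlonglongrightarrow> wiener_integral g g' \<beta> t - wiener_integral g g' \<beta> s"
proof -
  have st: "{s..t} \<subseteq> T" using time_set(5)[OF assms(1,4,5)] .
  note C = C1_deriv_subset[OF assms(2) st]
  show ?thesis unfolding wiener_integral_diff[OF assms]
    by (intro riemann_stieltjes_by_parts_seq assms(6) continuous_on_subset[OF assms(3) st] C1_derivD[OF C])
qed

text \<open>Associativity of the stochastic integral, with the outer integral again read by parts.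
  It holds path by path: in the difference of the two sides the terms
  \<open>f t * g t * \<beta> t\<close>, which have no time derivative, cancel, and the rest,
  \<open>D\<close>, has derivative zero.\<close>

lemma wiener_integral_mult:
  assumes "time_set T" "C1_deriv T f f'" "C1_deriv T g g'" "continuous_on T \<beta>" "t \<in> T"
  shows "wiener_integral (\<lambda>t. f t * g t) (\<lambda>t. f' t * g t + g' t * f t) \<beta> t =
    f t * wiener_integral g g' \<beta> t - integral {0..t} (\<lambda>r. wiener_integral g g' \<beta> r * f' r)"
proof -
  let ?h = "\<lambda>t. f' t * g t + g' t * f t"
  let ?I = "\<lambda>g t. integral {0..t} (\<lambda>r. \<beta> r * g r)"
  let ?W = "wiener_integral g g' \<beta>"
  define D where "D t = f t * ?I g' t + integral {0..t} (\<lambda>r. ?W r * f' r) - ?I ?h t" for t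
  have d: "(D has_real_derivative 0) (at t within T)" if t: "t \<in> T" for t
  proof -
    have "(D has_real_derivative (f' t * ?I g' t + \<beta> t * g' t * f t + ?W t * f' t - \<beta> t * ?h t)) (at t within T)"
      unfolding D_def
      by (intro DERIV_add DERIV_diff DERIV_mult C1_derivD(1)[OF assms(2) t]
          has_derivative_wiener_compensator[OF assms(1,3,4) t]
          has_derivative_wiener_compensator[OF assms(1,2) continuous_on_wiener_integral[OF assms(1,3,4)] t]
          has_derivative_wiener_compensator[OF assms(1) C1_deriv_mult[OF assms(2,3)] assms(4) t])
    then show ?thesis by (simp add: wiener_integral_def algebra_simps)
  qed
  have "D t = D 0" using zero_derivative_time_set[OF assms(1) d assms(5)] .
  then show ?thesis by (simp add: D_def wiener_integral_def algebra_simps)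
qed

text \<open>Variation of constants: with the integrating factor \<open>e\<close>, the equation
  \<open>dD = - h D dt + \<sigma> d\<beta>\<close> becomes \<open>d(e D) = e \<sigma> d\<beta>\<close>.\<close>

lemma linear_equation_solution:
  assumes T: "time_set T" and e: "C1_deriv T e (\<lambda>t. h t * e t)" and h: "continuous_on T h"
    and \<sigma>: "C1_deriv T \<sigma> \<sigma>'" and \<beta>: "continuous_on T \<beta>" and D: "continuous_on T D" and "e 0 = 1"
    and eq: "\<And>t. t \<in> T \<Longrightarrow> D t = D0 - integral {0..t} (\<lambda>r. h r * D r) + wiener_integral \<sigma> \<sigma>' \<beta> t"
    and t: "t \<in> T"
  shows "e t * D t = D0 + wiener_integral (\<lambda>t. e t * \<sigma> t) (\<lambda>t. h t * e t * \<sigma> t + \<sigma>' t * e t) \<beta> t"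
proof -
  let ?K = "\<lambda>t. integral {0..t} (\<lambda>r. h r * D r)"
  let ?P = "\<lambda>t. integral {0..t} (\<lambda>r. \<beta> r * \<sigma>' r)"
  let ?g = "\<lambda>t. h t * e t * \<sigma> t + \<sigma>' t * e t"
  \<comment> \<open>\<open>G\<close> is \<open>e * D\<close> minus the Wiener integral of
    \<open>e * \<sigma>\<close>, after cancelling \<open>e * \<sigma> * \<beta>\<close>, the only
    part without a time derivative.\<close>
  define G where "G t = e t * (D0 - ?K t - ?P t) + integral {0..t} (\<lambda>r. \<beta> r * ?g r)" for t
  have d: "(G has_real_derivative 0) (at t within T)" if t: "t \<in> T" for t
  proof -
    have "(G has_real_derivative (h t * e t * (D0 - ?K t - ?P t) + (0 - h t * D t - \<beta> t * \<sigma>' t) * e t + \<beta> t * ?g t)) (at t within T)"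
      unfolding G_def
      by (intro DERIV_add DERIV_diff DERIV_mult DERIV_const C1_derivD(1)[OF e t]
          has_derivative_wiener_compensator[OF T \<sigma> \<beta> t] has_derivative_integral_time_set[OF T _ t]
          has_derivative_wiener_compensator[OF T C1_deriv_mult[OF e \<sigma>] \<beta> t] continuous_intros h D)
    moreover have "h t * e t * (D0 - ?K t - ?P t) + (0 - h t * D t - \<beta> t * \<sigma>' t) * e t + \<beta> t * ?g t = 0"
    proof -
      have "D0 - ?K t - ?P t = D t - \<sigma> t * \<beta> t" using eq[OF t] by (simp add: wiener_integral_def)
      then show ?thesis by (simp only:) (simp add: algebra_simps)
    qed
    ultimately show ?thesis by simp
  qed
  have "G t = G 0" using zero_derivative_time_set[OF T d t] .
  moreover have "G 0 = D0" using \<open>e 0 = 1\<close> by (simp add: G_def)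
  ultimately show ?thesis by (subst eq[OF t]) (simp add: G_def wiener_integral_def algebra_simps)
qed

section \<open>Centred Gaussian variables independent of a \<open>\<sigma>\<close>-algebra\<close>

lemma char_normal_density:
  assumes "0 < s"
  shows "char (density lborel (normal_density 0 s)) u = complex_of_real (exp (- (s\<^sup>2 * u\<^sup>2) / 2))"
proof -
  interpret S: real_distribution std_normal_distribution by (rule real_dist_normal_dist)
  have "distributed std_normal_distribution lborel (\<lambda>x. x) std_normal_density"
    by (simp add: distributed_def distr_id2)
  from S.normal_density_affine[OF this, of s 0] assms
  have "distr std_normal_distribution lborel (\<lambda>x. s * x) = density lborel (normal_density 0 s)"
    by (simp add: distributed_def)
  then have "density lborel (normal_density 0 s) = distr std_normal_distribution borel (\<lambda>x. s * x)"
    by (metis distr_cong sets_lborel)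
  then have "char (density lborel (normal_density 0 s)) u = char std_normal_distribution (u * s)"
    unfolding char_def by (simp add: integral_distr mult.assoc)
  then show ?thesis by (simp add: char_std_normal_distribution power_mult_distrib mult.commute)
qed

lemma real_distribution_normal: "0 < s \<Longrightarrow> real_distribution (density lborel (normal_density \<mu> s))"
  by (auto simp: real_distribution_def real_distribution_axioms_def prob_space_normal_density)

text \<open>\<open>G\<close> is centred Gaussian with variance \<open>v\<close> and independent of \<open>\<F>\<close>; in contrast to
  independence itself, this form passes to limits.\<close>

definition gauss_indep :: "'a measure \<Rightarrow> 'a measure \<Rightarrow> ('a \<Rightarrow> real) \<Rightarrow> real \<Rightarrow> bool" where
  "gauss_indep M \<F> G v \<longleftrightarrow> G \<in> borel_measurable M \<and>
     (\<forall>X :: 'a \<Rightarrow> complex. X \<in> borel_measurable \<F> \<longrightarrow> (\<forall>\<omega>\<in>space M. norm (X \<omega>) \<le> 1) \<longrightarrow>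
        (\<forall>u. (LINT \<omega>|M. X \<omega> * iexp (u * G \<omega>)) = (LINT \<omega>|M. X \<omega>) * complex_of_real (exp (- (v * u\<^sup>2) / 2))))"

lemma gauss_indepD:
  assumes "gauss_indep M \<F> G v" "X \<in> borel_measurable \<F>" "\<And>\<omega>. \<omega> \<in> space M \<Longrightarrow> norm (X \<omega>) \<le> 1"
  shows "(LINT \<omega>|M. X \<omega> * iexp (u * G \<omega>)) = (LINT \<omega>|M. X \<omega>) * complex_of_real (exp (- (v * u\<^sup>2) / 2))"
  using assms by (simp add: gauss_indep_def)

lemma gauss_indep_measurable: "gauss_indep M \<F> G v \<Longrightarrow> G \<in> borel_measurable M"
  by (simp add: gauss_indep_def)

lemma gauss_indep_scale:
  assumes "gauss_indep M \<F> G v"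
  shows "gauss_indep M \<F> (\<lambda>\<omega>. c * G \<omega>) (c\<^sup>2 * v)"
  unfolding gauss_indep_def
proof (intro conjI allI impI)
  show "(\<lambda>\<omega>. c * G \<omega>) \<in> borel_measurable M" using assms by (auto simp: gauss_indep_def)
  fix X :: "'a \<Rightarrow> complex" and u
  assume "X \<in> borel_measurable \<F>" "\<forall>\<omega>\<in>space M. norm (X \<omega>) \<le> 1"
  then show "(LINT \<omega>|M. X \<omega> * iexp (u * (c * G \<omega>))) = (LINT \<omega>|M. X \<omega>) * complex_of_real (exp (- (c\<^sup>2 * v * u\<^sup>2) / 2))"
    using gauss_indepD[OF assms, of X "u * c"] by (simp add: power_mult_distrib mult_ac)
qed

text \<open>The factor containing \<open>G\<close> is measurable for \<G> and has norm 1, so the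
  test variable for \<open>H\<close> can absorb it; what remains is the identity for
  \<open>G\<close>.\<close>

lemma gauss_indep_add:
  assumes G: "gauss_indep M \<F> G v" and H: "gauss_indep M \<G> H w"
    and sub: "subalgebra \<G> \<F>" and meas: "G \<in> borel_measurable \<G>"
  shows "gauss_indep M \<F> (\<lambda>\<omega>. G \<omega> + H \<omega>) (v + w)"
  unfolding gauss_indep_def
proof (intro conjI allI impI)
  show "(\<lambda>\<omega>. G \<omega> + H \<omega>) \<in> borel_measurable M" using G H by (auto simp: gauss_indep_def)
  fix X :: "'a \<Rightarrow> complex" and u
  assume X: "X \<in> borel_measurable \<F>" "\<forall>\<omega>\<in>space M. norm (X \<omega>) \<le> 1"
  have "(LINT \<omega>|M. (X \<omega> * iexp (u * G \<omega>)) * iexp (u * H \<omega>)) =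
      (LINT \<omega>|M. X \<omega> * iexp (u * G \<omega>)) * complex_of_real (exp (- (w * u\<^sup>2) / 2))"
    by (rule gauss_indepD[OF H])
      (use X(2) measurable_from_subalg[OF sub X(1)] meas in \<open>auto simp: norm_mult\<close>)
  also have "(LINT \<omega>|M. X \<omega> * iexp (u * G \<omega>)) = (LINT \<omega>|M. X \<omega>) * complex_of_real (exp (- (v * u\<^sup>2) / 2))"
    by (rule gauss_indepD[OF G]) (use X in auto)
  also have "(LINT \<omega>|M. X \<omega>) * complex_of_real (exp (- (v * u\<^sup>2) / 2)) * complex_of_real (exp (- (w * u\<^sup>2) / 2)) =
      (LINT \<omega>|M. X \<omega>) * complex_of_real (exp (- ((v + w) * u\<^sup>2) / 2))"
    unfolding mult.assoc of_real_mult[symmetric] exp_add[symmetric] by (simp add: field_simps)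
  also have "(LINT \<omega>|M. (X \<omega> * iexp (u * G \<omega>)) * iexp (u * H \<omega>)) = (LINT \<omega>|M. X \<omega> * iexp (u * (G \<omega> + H \<omega>)))"
    by (simp only: mult.assoc exp_add[symmetric] distrib_left of_real_add)
  finally show "(LINT \<omega>|M. X \<omega> * iexp (u * (G \<omega> + H \<omega>))) =
      (LINT \<omega>|M. X \<omega>) * complex_of_real (exp (- ((v + w) * u\<^sup>2) / 2))" .
qed

lemma gauss_indep_zero: "gauss_indep M \<F> (\<lambda>_. 0) 0"
  by (simp add: gauss_indep_def)

text \<open>Dominated convergence with bound 1 on one side, continuity in the variance on the other.
  This is how Riemann sums hand their law to their limit.\<close>

lemma gauss_indep_LIMSEQ:
  assumes "prob_space M" and sub: "subalgebra M \<F>"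
    and G: "\<And>n. gauss_indep M \<F> (G n) (v n)"
    and [measurable]: "H \<in> borel_measurable M" and lim: "AE \<omega> in M. (\<lambda>n. G n \<omega>) \<longlonglongrightarrow> H \<omega>" and v: "v \<longlonglongrightarrow> w"
  shows "gauss_indep M \<F> H w"
  unfolding gauss_indep_def
proof (intro conjI allI impI)
  interpret prob_space M by fact
  fix X :: "'a \<Rightarrow> complex" and u
  assume X: "X \<in> borel_measurable \<F>" "\<forall>\<omega>\<in>space M. norm (X \<omega>) \<le> 1"
  have [measurable]: "X \<in> borel_measurable M" using measurable_from_subalg[OF sub X(1)] .
  have [measurable]: "G n \<in> borel_measurable M" for n using G by (rule gauss_indep_measurable)
  have "(\<lambda>n. LINT \<omega>|M. X \<omega> * iexp (u * G n \<omega>)) \<longlonglongrightarrow> (LINT \<omega>|M. X \<omega> * iexp (u * H \<omega>))"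
  proof (rule integral_dominated_convergence[where w="\<lambda>_. 1"])
    show "AE \<omega> in M. (\<lambda>n. X \<omega> * iexp (u * G n \<omega>)) \<longlonglongrightarrow> X \<omega> * iexp (u * H \<omega>)"
      using lim by eventually_elim (intro tendsto_intros)
  qed (use X(2) in \<open>auto simp: norm_mult\<close>)
  moreover have "(\<lambda>n. LINT \<omega>|M. X \<omega> * iexp (u * G n \<omega>)) \<longlonglongrightarrow>
      (LINT \<omega>|M. X \<omega>) * complex_of_real (exp (- (w * u\<^sup>2) / 2))"
  proof -
    have "(LINT \<omega>|M. X \<omega> * iexp (u * G n \<omega>)) = (LINT \<omega>|M. X \<omega>) * complex_of_real (exp (- (v n * u\<^sup>2) / 2))" for n
      using X by (intro gauss_indepD[OF G]) auto
    then show ?thesis by (simp only:) (intro tendsto_intros v, simp)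
  qed
  ultimately show "(LINT \<omega>|M. X \<omega> * iexp (u * H \<omega>)) = (LINT \<omega>|M. X \<omega>) * complex_of_real (exp (- (w * u\<^sup>2) / 2))"
    by (rule LIMSEQ_unique)
qed fact

lemma gauss_indep_cong_AE:
  assumes "prob_space M" "subalgebra M \<F>" "gauss_indep M \<F> G v" "H \<in> borel_measurable M" "AE \<omega> in M. G \<omega> = H \<omega>"
  shows "gauss_indep M \<F> H v"
  by (rule gauss_indep_LIMSEQ[OF assms(1,2), of "\<lambda>_. G" "\<lambda>_. v"]) (use assms in auto)

section \<open>Characteristic functions versus laws and independence\<close>

context prob_space
begin

lemma gauss_indepI:
  assumes sub: "subalgebra M \<F>" and G: "distributed M lborel G (normal_density 0 (sqrt v))" and "0 < v"
    and ind: "indep_set (sets \<F>) (sets (vimage_algebra (space M) G borel))"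
  shows "gauss_indep M \<F> G v"
  unfolding gauss_indep_def
proof (intro conjI allI impI)
  have [measurable]: "G \<in> borel_measurable M" using G by (auto simp: distributed_def)
  then show "G \<in> borel_measurable M" .
  fix X :: "'a \<Rightarrow> complex" and u
  assume X: "X \<in> borel_measurable \<F>" "\<forall>\<omega>\<in>space M. norm (X \<omega>) \<le> 1"
  have [measurable]: "X \<in> borel_measurable M" using measurable_from_subalg[OF sub X(1)] .
  have "indep_set (sigma_sets (space M) {X -` A \<inter> space M |A. A \<in> sets borel})
      (sigma_sets (space M) {(\<lambda>\<omega>. iexp (u * G \<omega>)) -` A \<inter> space M |A. A \<in> sets borel})"
    unfolding indep_sets2_eq
  proof (intro conjI ballI)
    have 1: "sigma_sets (space M) {X -` A \<inter> space M |A. A \<in> sets borel} \<subseteq> sets \<F>"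
      using sub measurable_sets[OF X(1)] sets.top[of \<F>]
      by (intro sets.sigma_sets_subset') (auto simp: subalgebra_def)
    have 2: "sigma_sets (space M) {(\<lambda>\<omega>. iexp (u * G \<omega>)) -` A \<inter> space M |A. A \<in> sets borel}
        \<subseteq> sets (vimage_algebra (space M) G borel)"
    proof -
      have "(\<lambda>\<omega>. iexp (u * G \<omega>)) \<in> borel_measurable (vimage_algebra (space M) G borel)"
        by (intro measurable_compose[OF measurable_vimage_algebra1, of G _ borel "\<lambda>x. iexp (u * x)"]) auto
      from measurable_sets[OF this] show ?thesis
        using sets.top[of "vimage_algebra (space M) G borel"]
        by (intro sets.sigma_sets_subset') (auto simp: space_vimage_algebra)
    qed
    show "sigma_sets (space M) {X -` A \<inter> space M |A. A \<in> sets borel} \<subseteq> events"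
      using 1 sub by (auto simp: subalgebra_def)
    show "sigma_sets (space M) {(\<lambda>\<omega>. iexp (u * G \<omega>)) -` A \<inter> space M |A. A \<in> sets borel} \<subseteq> events"
      using 2 ind unfolding indep_sets2_eq by blast
    fix a b assume "a \<in> sigma_sets (space M) {X -` A \<inter> space M |A. A \<in> sets borel}"
      "b \<in> sigma_sets (space M) {(\<lambda>\<omega>. iexp (u * G \<omega>)) -` A \<inter> space M |A. A \<in> sets borel}"
    then show "prob (a \<inter> b) = prob a * prob b" using 1 2 ind indep_setD by blast
  qed
  then have "indep_var borel X borel (\<lambda>\<omega>. iexp (u * G \<omega>))" unfolding indep_var_eq by simp
  moreover have "integrable M X" using X(2) by (intro integrable_const_bound[where B=1]) auto
  moreover have "integrable M (\<lambda>\<omega>. iexp (u * G \<omega>))" by (intro integrable_const_bound[where B=1]) auto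
  ultimately have "(LINT \<omega>|M. X \<omega> * iexp (u * G \<omega>)) = (LINT \<omega>|M. X \<omega>) * (LINT \<omega>|M. iexp (u * G \<omega>))"
    by (rule indep_var_lebesgue_integral)
  also have "(LINT \<omega>|M. iexp (u * G \<omega>)) = char (distr M lborel G) u"
    unfolding char_def by (subst integral_distr) auto
  also have "\<dots> = complex_of_real (exp (- (v * u\<^sup>2) / 2))"
    using G \<open>0 < v\<close> by (simp add: distributed_def char_normal_density)
  finally show "(LINT \<omega>|M. X \<omega> * iexp (u * G \<omega>)) = (LINT \<omega>|M. X \<omega>) * complex_of_real (exp (- (v * u\<^sup>2) / 2))" .
qed

text \<open>\<open>Q\<close> is the probability \<open>M\<close> conditioned on \<open>C\<close>.
  The normalisation is there because Levy's uniqueness theorem compares probability laws.\<close>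

lemma real_distribution_distr_density:
  assumes [measurable]: "G \<in> borel_measurable M" "C \<in> events" and "0 < prob C"
  defines "Q \<equiv> density M (\<lambda>\<omega>. ennreal (indicator C \<omega> / prob C))"
  shows "real_distribution (distr Q borel G)"
    "char (distr Q borel G) u = (LINT \<omega>|M. indicator C \<omega> * iexp (u * G \<omega>)) / prob C"
    "A \<in> sets borel \<Longrightarrow> measure (distr Q borel G) A = prob (C \<inter> (G -` A \<inter> space M)) / prob C"
proof -
  have Q: "emeasure Q B = prob (C \<inter> B) / prob C" if [measurable]: "B \<in> events" for B
  proof -
    have "emeasure Q B = (\<integral>\<^sup>+ \<omega>. ennreal (1 / prob C) * indicator (C \<inter> B) \<omega> \<partial>M)"
      unfolding Q_def by (subst emeasure_density) (auto intro!: nn_integral_cong split: split_indicator)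
    also have "\<dots> = ennreal (1 / prob C) * ennreal (prob (C \<inter> B))"
      by (simp add: nn_integral_cmult emeasure_eq_measure)
    also have "\<dots> = prob (C \<inter> B) / prob C"
      using assms by (simp flip: ennreal_mult)
    finally show ?thesis .
  qed
  have "emeasure Q (space Q) = 1"
    using Q[of "space M"] sets.sets_into_space[OF assms(2)] \<open>0 < prob C\<close> by (simp add: Q_def Int_absorb2)
  then interpret Q: prob_space Q by (rule prob_spaceI)
  have [measurable_cong]: "sets Q = sets M" by (simp add: Q_def)
  have [simp]: "space Q = space M" by (simp add: Q_def)
  show "real_distribution (distr Q borel G)"
    using Q.prob_space_distr[of G borel] by (auto simp: real_distribution_def real_distribution_axioms_def)
  have "char (distr Q borel G) u = (LINT \<omega>|Q. iexp (u * G \<omega>))"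
    unfolding char_def by (subst integral_distr) auto
  also have "\<dots> = (LINT \<omega>|M. (indicator C \<omega> / prob C) *\<^sub>R iexp (u * G \<omega>))"
    unfolding Q_def by (subst integral_density) auto
  also have "\<dots> = (LINT \<omega>|M. indicator C \<omega> * iexp (u * G \<omega>) / prob C)"
    by (intro Bochner_Integration.integral_cong refl) (auto simp: scaleR_conv_of_real split: split_indicator)
  finally show "char (distr Q borel G) u = (LINT \<omega>|M. indicator C \<omega> * iexp (u * G \<omega>)) / prob C"
    by simp
  show "measure (distr Q borel G) A = prob (C \<inter> (G -` A \<inter> space M)) / prob C" if [measurable]: "A \<in> sets borel"
    using Q[of "G -` A \<inter> space M"] \<open>0 < prob C\<close> by (simp add: measure_distr measure_def[of Q])
qed

lemma gauss_indep_distr_char: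
  assumes "gauss_indep M \<F> G v"
  shows "char (distr M borel G) u = complex_of_real (exp (- (v * u\<^sup>2) / 2))"
proof -
  have "char (distr M borel G) u = (LINT \<omega>|M. iexp (u * G \<omega>))"
    using gauss_indep_measurable[OF assms] unfolding char_def by (subst integral_distr) auto
  also have "\<dots> = complex_of_real (exp (- (v * u\<^sup>2) / 2))"
    using gauss_indepD[OF assms, of "\<lambda>_. 1" u] by (simp add: prob_space)
  finally show ?thesis .
qed

lemma gauss_indep_distributed:
  assumes G: "gauss_indep M \<F> G v" and "0 < v"
  shows "distributed M lborel G (normal_density 0 (sqrt v))"
proof -
  have [measurable]: "G \<in> borel_measurable M" using gauss_indep_measurable[OF G] .
  have "distr M borel G = density lborel (normal_density 0 (sqrt v))"
  proof (rule Levy_uniqueness)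
    show "real_distribution (distr M borel G)" by (rule real_distribution_distr) simp
    show "char (distr M borel G) = char (density lborel (normal_density 0 (sqrt v)))"
      using gauss_indep_distr_char[OF G] \<open>0 < v\<close> by (intro ext) (simp add: char_normal_density)
  qed (use \<open>0 < v\<close> in \<open>simp add: real_distribution_normal\<close>)
  moreover have "distr M lborel G = distr M borel G" by (intro distr_cong) auto
  ultimately show ?thesis by (simp add: distributed_def)
qed

text \<open>Testing with \<open>indicator C\<close> shows that the characteristic function of
  \<open>G\<close> given \<open>C\<close> is the unconditional one, so the two laws agree. A null
  set \<open>C\<close> cannot be conditioned on and is treated directly.\<close>

lemma gauss_indep_prob:
  assumes G: "gauss_indep M \<F> G v" and sub: "subalgebra M \<F>"
    and C: "C \<in> sets \<F>" and A: "A \<in> sets borel"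
  shows "prob (C \<inter> (G -` A \<inter> space M)) = prob C * prob (G -` A \<inter> space M)"
proof (cases "prob C = 0")
  case True
  have [measurable]: "G \<in> borel_measurable M" "C \<in> events" "A \<in> sets borel"
    using gauss_indep_measurable[OF G] C A sub by (auto simp: subalgebra_def)
  have "prob (C \<inter> (G -` A \<inter> space M)) \<le> prob C" by (intro finite_measure_mono) auto
  then show ?thesis using True by (simp add: measure_le_0_iff)
next
  case False
  have [measurable]: "G \<in> borel_measurable M" "C \<in> events" "A \<in> sets borel"
    using gauss_indep_measurable[OF G] C A sub by (auto simp: subalgebra_def)
  have "0 < prob C" using False by (simp add: zero_less_measure_iff)
  note Q = real_distribution_distr_density[OF gauss_indep_measurable[OF G] \<open>C \<in> events\<close> this]
  have "(LINT \<omega>|M. indicator C \<omega> * iexp (u * G \<omega>)) = prob C * complex_of_real (exp (- (v * u\<^sup>2) / 2))" for u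
  proof -
    have "(LINT \<omega>|M. (indicator C \<omega> :: complex)) = (LINT \<omega>|M. complex_of_real (indicator C \<omega>))"
      by (simp add: of_real_indicator)
    then have "(LINT \<omega>|M. (indicator C \<omega> :: complex)) = prob C"
      using sets.sets_into_space[OF \<open>C \<in> events\<close>] by (simp add: integral_complex_of_real Int_absorb2)
    moreover have "norm (indicator C \<omega> :: complex) \<le> 1" for \<omega> by (simp add: indicator_def)
    ultimately show ?thesis using gauss_indepD[OF G, of "indicator C" u] C by simp
  qed
  then have "char (distr (density M (\<lambda>\<omega>. ennreal (indicator C \<omega> / prob C))) borel G) = char (distr M borel G)"
    using False by (intro ext) (simp add: Q(2) gauss_indep_distr_char[OF G])
  from Levy_uniqueness[OF Q(1) real_distribution_distr this] Q(3)[OF A]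
  show ?thesis using False by (simp add: measure_distr field_simps)
qed

text \<open>Freezing: \<open>G\<close> is integrated out while everything known to \<F> is held
  fixed. The identity map, read as a random element of \<open>M\<close> restricted to \<F>, is
  independent of \<open>G\<close>, so their joint law is a product and Tonelli applies.\<close>

lemma gauss_indep_nn_integral:
  assumes G: "gauss_indep M \<F> G v" and sub: "subalgebra M \<F>" and v: "0 < v"
    and f: "f \<in> borel_measurable (\<F> \<Otimes>\<^sub>M borel)"
  shows "(\<integral>\<^sup>+\<omega>. f (\<omega>, G \<omega>) \<partial>M) = (\<integral>\<^sup>+\<omega>. (\<integral>\<^sup>+x. f (\<omega>, x) * ennreal (normal_density 0 (sqrt v) x) \<partial>lborel) \<partial>M)"
proof -
  let ?F = "restr_to_subalg M \<F>" and ?N = "distr M borel G"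
  have [measurable]: "G \<in> borel_measurable M" using gauss_indep_measurable[OF G] .
  have setsF[measurable_cong]: "sets ?F = sets \<F>" using sub by (rule sets_restr_to_subalg)
  interpret F: prob_space ?F by (rule prob_space_restr_to_subalg[OF sub prob_space_axioms])
  interpret N: prob_space ?N by (rule prob_space_distr) simp
  have id[measurable]: "(\<lambda>\<omega>. \<omega>) \<in> measurable M ?F"
    using sub by (auto simp: measurable_def space_restr_to_subalg setsF subalgebra_def)
  have "?F \<Otimes>\<^sub>M ?N = distr M (?F \<Otimes>\<^sub>M borel) (\<lambda>\<omega>. (\<omega>, G \<omega>))"
  proof (rule pair_measure_eqI)
    fix C A assume C: "C \<in> sets ?F" and A: "A \<in> sets ?N"
    then have [measurable]: "C \<in> sets ?F" "A \<in> sets borel" by auto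
    have "C \<in> events" using C sub setsF by (auto simp: subalgebra_def)
    have "emeasure (distr M (?F \<Otimes>\<^sub>M borel) (\<lambda>\<omega>. (\<omega>, G \<omega>))) (C \<times> A) =
        emeasure M ((\<lambda>\<omega>. (\<omega>, G \<omega>)) -` (C \<times> A) \<inter> space M)"
      by (subst emeasure_distr) auto
    also have "(\<lambda>\<omega>. (\<omega>, G \<omega>)) -` (C \<times> A) \<inter> space M = C \<inter> (G -` A \<inter> space M)" by auto
    also have "emeasure M \<dots> = ennreal (prob C) * ennreal (prob (G -` A \<inter> space M))"
      using gauss_indep_prob[OF G sub, of C A] C A setsF by (simp add: emeasure_eq_measure ennreal_mult)
    also have "\<dots> = emeasure ?F C * emeasure ?N A"
      using C A setsF by (simp add: emeasure_restr_to_subalg[OF sub] emeasure_distr emeasure_eq_measure)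
    finally show "emeasure ?F C * emeasure ?N A = emeasure (distr M (?F \<Otimes>\<^sub>M borel) (\<lambda>\<omega>. (\<omega>, G \<omega>))) (C \<times> A)" ..
  qed (use F.sigma_finite_measure_axioms N.sigma_finite_measure_axioms in \<open>auto intro!: sets_pair_measure_cong\<close>)
  note eq = this
  have f1[measurable]: "f \<in> borel_measurable (?F \<Otimes>\<^sub>M borel)" 
    using f by (subst measurable_cong_sets[OF sets_pair_measure_cong[OF setsF refl] refl])
  have fN: "f \<in> borel_measurable (?F \<Otimes>\<^sub>M ?N)"
    using f1 by (simp cong: measurable_cong_sets sets_pair_measure_cong)
  have "(\<integral>\<^sup>+\<omega>. f (\<omega>, G \<omega>) \<partial>M) = (\<integral>\<^sup>+z. f z \<partial>distr M (?F \<Otimes>\<^sub>M borel) (\<lambda>\<omega>. (\<omega>, G \<omega>)))"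
    by (subst nn_integral_distr) auto
  also have "\<dots> = (\<integral>\<^sup>+\<omega>. (\<integral>\<^sup>+x. f (\<omega>, x) \<partial>?N) \<partial>?F)"
    unfolding eq[symmetric] by (rule N.nn_integral_fst[symmetric, OF fN])
  also have "?N = density lborel (normal_density 0 (sqrt v))"
    using gauss_indep_distributed[OF G v] by (simp add: distributed_def cong: distr_cong)
  also have "(\<integral>\<^sup>+\<omega>. (\<integral>\<^sup>+x. f (\<omega>, x) \<partial>density lborel (normal_density 0 (sqrt v))) \<partial>?F) =
      (\<integral>\<^sup>+\<omega>. (\<integral>\<^sup>+x. f (\<omega>, x) * ennreal (normal_density 0 (sqrt v) x) \<partial>lborel) \<partial>?F)"
    by (intro nn_integral_cong) (subst nn_integral_density, auto simp: mult.commute)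
  also have "\<dots> = (\<integral>\<^sup>+\<omega>. (\<integral>\<^sup>+x. f (\<omega>, x) * ennreal (normal_density 0 (sqrt v) x) \<partial>lborel) \<partial>M)"
    using f by (intro nn_integral_subalgebra2[OF sub]) measurable
  finally show ?thesis .
qed

end

section \<open>Wiener integrals with respect to a Brownian motion\<close>

text \<open>Every subset of a null set is available in \<open>G\<close>, so a change on a null set
  does no harm. This lets almost surely continuous processes be replaced by continuous ones without
  losing adaptedness.\<close>

lemma borel_measurable_null_modification:
  assumes "complete_measure M" and sub: "subalgebra M G" and null: "null_sets M \<subseteq> sets G"
    and g: "g \<in> borel_measurable G" and eq: "AE \<omega> in M. f \<omega> = g \<omega>"
  shows "f \<in> borel_measurable G"
proof (rule measurableI)
  interpret complete_measure M by fact
  from eq obtain N where N: "{\<omega> \<in> space M. f \<omega> \<noteq> g \<omega>} \<subseteq> N" "N \<in> null_sets M"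
    by (auto elim!: AE_E simp: null_sets_def)
  have sp: "space G = space M" using sub by (simp add: subalgebra_def)
  fix A :: "'b set" assume A: "A \<in> sets borel"
  have "f -` A \<inter> N \<inter> space M \<in> null_sets M" using N(2) by (rule null_sets_subset[of N]) (auto intro: complete[OF _ N(2)])
  then have "f -` A \<inter> N \<inter> space M \<in> sets G" "N \<in> sets G" using null N(2) by auto
  moreover have "f -` A \<inter> space G = (g -` A \<inter> space G - N) \<union> (f -` A \<inter> N \<inter> space M)"
    using N(1) sp by auto
  ultimately show "f -` A \<inter> space G \<in> sets G" using measurable_sets[OF g A] by auto
qed simp

section \<open>Subdivision limits, from single paths to convergence in probability\<close>

lemma fine_subdivision_exists:
  assumes "0 \<le> t" "0 < \<delta>"
  shows "\<exists>n \<pi>. fine_subdivision t \<delta> n \<pi>"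
proof -
  obtain n where "\<forall>i. uniform_subdivision 0 t n (Suc i) - uniform_subdivision 0 t n i < \<delta>"
    using uniform_subdivision_mesh[OF assms] by (auto simp: eventually_sequentially)
  then have "fine_subdivision t \<delta> (Suc n) (uniform_subdivision 0 t n)"
    unfolding fine_subdivision_def by (metis uniform_subdivision(1-3)[OF assms(1)])
  then show ?thesis by blast
qed

lemma fine_subdivision_range:
  assumes "fine_subdivision t \<delta> n \<pi>" "i \<le> n"
  shows "0 \<le> \<pi> i" "\<pi> i \<le> t"
proof -
  have mono: "\<pi> i \<le> \<pi> j" if "i \<le> j" "j \<le> n" for i j
    using that
  proof (induction j)
    case (Suc j) then show ?case
      using assms(1) by (cases "i = Suc j") (auto simp: fine_subdivision_def intro: order_trans[of _ "\<pi> j"])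
  qed simp
  show "0 \<le> \<pi> i" "\<pi> i \<le> t" using mono[of 0 i] mono[of i n] assms by (auto simp: fine_subdivision_def)
qed

text \<open>The pathwise threshold \<delta> depends on \<omega>, and a supremum over all
  subdivisions need not be measurable. If no common \<delta> worked, choosing one bad subdivision of
  mesh below \<open>1 / (k + 1)\<close> for each \<open>k\<close> would give a sequence that
  converges almost surely but not in probability.\<close>

lemma (in prob_space) subdivision_limit_in_probability:
  fixes S :: "nat \<Rightarrow> (nat \<Rightarrow> real) \<Rightarrow> 'a \<Rightarrow> real"
  assumes S: "\<And>\<delta> n \<pi>. fine_subdivision t \<delta> n \<pi> \<Longrightarrow> S n \<pi> \<in> borel_measurable M"
    and [measurable]: "J \<in> borel_measurable M"
    and lim: "AE \<omega> in M. \<forall>\<epsilon>>0. \<exists>\<delta>>0. \<forall>n \<pi>. fine_subdivision t \<delta> n \<pi> \<longrightarrow> \<bar>S n \<pi> \<omega> - J \<omega>\<bar> < \<epsilon>"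
    and "0 < \<epsilon>"
  shows "\<exists>\<delta>>0. \<forall>n \<pi>. fine_subdivision t \<delta> n \<pi> \<longrightarrow> prob {\<omega>\<in>space M. \<bar>S n \<pi> \<omega> - J \<omega>\<bar> > \<epsilon>} < \<epsilon>"
proof (rule ccontr)
  assume "\<not> ?thesis"
  then have "\<exists>n \<pi>. fine_subdivision t (inverse (real (Suc k))) n \<pi> \<and>
      \<not> prob {\<omega>\<in>space M. \<bar>S n \<pi> \<omega> - J \<omega>\<bar> > \<epsilon>} < \<epsilon>" for k
    by (meson inverse_positive_iff_positive of_nat_0_less_iff zero_less_Suc)
  then obtain n \<pi> where fine: "\<And>k. fine_subdivision t (inverse (real (Suc k))) (n k) (\<pi> k)"
    and big: "\<And>k. \<epsilon> \<le> prob {\<omega>\<in>space M. \<bar>S (n k) (\<pi> k) \<omega> - J \<omega>\<bar> > \<epsilon>}"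
    by (metis not_less)
  have [measurable]: "S (n k) (\<pi> k) \<in> borel_measurable M" for k using S[OF fine] .
  let ?A = "\<lambda>k. {\<omega>\<in>space M. \<bar>S (n k) (\<pi> k) \<omega> - J \<omega>\<bar> > \<epsilon>}"
  have "(\<lambda>k. LINT \<omega>|M. indicator (?A k) \<omega>) \<longlonglongrightarrow> (LINT \<omega>|M. (0::real))"
  proof (rule integral_dominated_convergence[where w="\<lambda>_. 1"])
    show "AE \<omega> in M. (\<lambda>k. indicator (?A k) \<omega>) \<longlonglongrightarrow> (0::real)"
      using lim
    proof eventually_elim
      fix \<omega> assume "\<forall>\<epsilon>>0. \<exists>\<delta>>0. \<forall>n \<pi>. fine_subdivision t \<delta> n \<pi> \<longrightarrow> \<bar>S n \<pi> \<omega> - J \<omega>\<bar> < \<epsilon>"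
      then obtain \<delta> where \<delta>: "\<delta> > 0" "\<And>n \<pi>. fine_subdivision t \<delta> n \<pi> \<Longrightarrow> \<bar>S n \<pi> \<omega> - J \<omega>\<bar> < \<epsilon>"
        using \<open>0 < \<epsilon>\<close> by blast
      have "\<forall>\<^sub>F k in sequentially. inverse (real (Suc k)) < \<delta>"
        using order_tendstoD(2)[OF LIMSEQ_inverse_real_of_nat \<delta>(1)] .
      then have "\<forall>\<^sub>F k in sequentially. indicator (?A k) \<omega> = (0::real)"
      proof eventually_elim
        fix k assume "inverse (real (Suc k)) < \<delta>"
        then have "fine_subdivision t \<delta> (n k) (\<pi> k)" using fine[of k] by (force simp: fine_subdivision_def)
        from \<delta>(2)[OF this] show "indicator (?A k) \<omega> = (0::real)" by (simp add: indicator_def)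
      qed
      then show "(\<lambda>k. indicator (?A k) \<omega>) \<longlonglongrightarrow> (0::real)" by (rule tendsto_eventually)
    qed
  qed (auto simp: indicator_def)
  then have "(\<lambda>k. prob (?A k)) \<longlonglongrightarrow> 0" by simp
  then have "\<epsilon> \<le> 0" by (rule LIMSEQ_le_const) (use big in auto)
  then show False using \<open>0 < \<epsilon>\<close> by simp
qed

text \<open>Both limits are compared with the sum over a single subdivision that is fine enough for
  either of them.\<close>

lemma (in prob_space) ito_integral_unique:
  assumes J: "is_ito_integral M B T H J" and K: "is_ito_integral M B T H K"
    and t: "t \<in> T" "0 \<le> t"
    and H: "\<And>s. 0 \<le> s \<Longrightarrow> s \<le> t \<Longrightarrow> H s \<in> borel_measurable M"
    and B: "\<And>s. 0 \<le> s \<Longrightarrow> s \<le> t \<Longrightarrow> B s \<in> borel_measurable M"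
    and [measurable]: "J t \<in> borel_measurable M" "K t \<in> borel_measurable M"
  shows "AE \<omega> in M. J t \<omega> = K t \<omega>"
proof -
  have small: "prob {\<omega>\<in>space M. \<bar>J t \<omega> - K t \<omega>\<bar> > 2 * \<epsilon>} < 2 * \<epsilon>" if "0 < \<epsilon>" for \<epsilon>
  proof -
    let ?S = "\<lambda>n \<pi> \<omega>. \<Sum>i<n. H (\<pi> i) \<omega> * (B (\<pi> (Suc i)) \<omega> - B (\<pi> i) \<omega>)"
    obtain \<delta> where \<delta>: "\<delta> > 0" "\<And>n \<pi>. fine_subdivision t \<delta> n \<pi> \<Longrightarrow> prob {\<omega>\<in>space M. \<bar>?S n \<pi> \<omega> - J t \<omega>\<bar> > \<epsilon>} < \<epsilon>"
      using J t(1) \<open>0 < \<epsilon>\<close> unfolding is_ito_integral_def by meson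
    obtain \<delta>' where \<delta>': "\<delta>' > 0" "\<And>n \<pi>. fine_subdivision t \<delta>' n \<pi> \<Longrightarrow> prob {\<omega>\<in>space M. \<bar>?S n \<pi> \<omega> - K t \<omega>\<bar> > \<epsilon>} < \<epsilon>"
      using K t(1) \<open>0 < \<epsilon>\<close> unfolding is_ito_integral_def by meson
    obtain n \<pi> where fine: "fine_subdivision t (min \<delta> \<delta>') n \<pi>"
      using fine_subdivision_exists[of t "min \<delta> \<delta>'"] \<delta> \<delta>' t by auto
    have "H (\<pi> i) \<in> borel_measurable M" "B (\<pi> i) \<in> borel_measurable M" if "i \<le> n" for i
      using H B fine_subdivision_range[OF fine that] by auto
    then have [measurable]: "?S n \<pi> \<in> borel_measurable M"
      by (intro borel_measurable_sum borel_measurable_times borel_measurable_diff) auto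
    have "prob {\<omega>\<in>space M. \<bar>J t \<omega> - K t \<omega>\<bar> > 2 * \<epsilon>} \<le>
        prob ({\<omega>\<in>space M. \<bar>?S n \<pi> \<omega> - J t \<omega>\<bar> > \<epsilon>} \<union> {\<omega>\<in>space M. \<bar>?S n \<pi> \<omega> - K t \<omega>\<bar> > \<epsilon>})"
      by (rule finite_measure_mono) auto
    also have "\<dots> \<le> prob {\<omega>\<in>space M. \<bar>?S n \<pi> \<omega> - J t \<omega>\<bar> > \<epsilon>} + prob {\<omega>\<in>space M. \<bar>?S n \<pi> \<omega> - K t \<omega>\<bar> > \<epsilon>}"
      by (rule measure_Un_le) auto
    also have "\<dots> < \<epsilon> + \<epsilon>"
      using fine by (intro add_strict_mono \<delta>(2) \<delta>'(2)) (auto simp: fine_subdivision_def)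
    finally show ?thesis by simp
  qed
  have "AE \<omega> in M. \<not> \<bar>J t \<omega> - K t \<omega>\<bar> > 1 / real (Suc k)" for k
  proof -
    have "prob {\<omega>\<in>space M. \<bar>J t \<omega> - K t \<omega>\<bar> > 1 / real (Suc k)} \<le> \<eta>" if "0 < \<eta>" for \<eta>
    proof -
      \<comment> \<open>In \<open>is_ito_integral\<close> one number bounds both the deviation and
        the probability, so it has to be small compared with \<open>\<eta>\<close> and with
        \<open>1 / (k + 1)\<close> at once.\<close>
      define \<epsilon> where "\<epsilon> = min \<eta> (1 / real (Suc k)) / 2"
      have "0 < \<epsilon>" "2 * \<epsilon> \<le> \<eta>" "2 * \<epsilon> \<le> 1 / real (Suc k)" using that by (auto simp: \<epsilon>_def)
      then have "prob {\<omega>\<in>space M. \<bar>J t \<omega> - K t \<omega>\<bar> > 1 / real (Suc k)} \<le> prob {\<omega>\<in>space M. \<bar>J t \<omega> - K t \<omega>\<bar> > 2 * \<epsilon>}"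
        by (intro finite_measure_mono) auto
      with small[OF \<open>0 < \<epsilon>\<close>] \<open>2 * \<epsilon> \<le> \<eta>\<close> show ?thesis by linarith
    qed
    then have "prob {\<omega>\<in>space M. \<bar>J t \<omega> - K t \<omega>\<bar> > 1 / real (Suc k)} = 0"
      by (intro antisym field_le_epsilon[where y=0]) auto
    then show ?thesis by (subst AE_iff_measurable[OF _ refl]) (auto simp: emeasure_eq_measure)
  qed
  then have "AE \<omega> in M. \<forall>k. \<not> \<bar>J t \<omega> - K t \<omega>\<bar> > 1 / real (Suc k)" by (simp only: AE_all_countable) blast
  then show ?thesis
  proof eventually_elim
    fix \<omega> assume A: "\<forall>k. \<not> \<bar>J t \<omega> - K t \<omega>\<bar> > 1 / real (Suc k)"
    show "J t \<omega> = K t \<omega>"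
    proof (rule ccontr)
      assume "J t \<omega> \<noteq> K t \<omega>"
      then have "0 < \<bar>J t \<omega> - K t \<omega>\<bar>" by simp
      from reals_Archimedean[OF this] A show False by (auto simp: inverse_eq_divide simp del: of_nat_Suc)
    qed
  qed
qed

text \<open>The variances of the Riemann sums are sums of \<open>g\<^sup>2\<close> against
  increments of time, that is, Wiener sums along the path \<open>\<lambda>r. r\<close>. Thus
  \<open>wiener_integral_seq\<close> computes their limit as well.\<close>

lemma wiener_integral_square_id:
  assumes "time_set T" "C1_deriv T g g'" "t \<in> T"
  shows "wiener_integral (\<lambda>t. g t * g t) (\<lambda>t. g' t * g t + g' t * g t) (\<lambda>r. r) t = integral {0..t} (\<lambda>r. (g r)\<^sup>2)"
proof -
  note C = C1_deriv_mult[OF assms(2,2)]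
  define D where "D t = wiener_integral (\<lambda>t. g t * g t) (\<lambda>t. g' t * g t + g' t * g t) (\<lambda>r. r) t - integral {0..t} (\<lambda>r. (g r)\<^sup>2)" for t
  have "(D has_real_derivative (g' t * g t + g' t * g t) * t + 1 * (g t * g t)
      - t * (g' t * g t + g' t * g t) - (g t)\<^sup>2) (at t within T)" if "t \<in> T" for t
    unfolding D_def wiener_integral_def
    by (intro DERIV_diff DERIV_mult C1_derivD(1)[OF C that] DERIV_ident has_derivative_wiener_compensator[OF assms(1) C _ that]
        has_derivative_integral_time_set[OF assms(1) _ that] continuous_intros C1_derivD(3)[OF assms(2)])
  then have "(D has_real_derivative 0) (at t within T)" if "t \<in> T" for t
    using that by (simp add: power2_eq_square algebra_simps)
  from zero_derivative_time_set[OF assms(1) this assms(3)] show ?thesis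
    by (simp add: D_def wiener_integral_def)
qed

lemma usual_filtered_spaceD:
  assumes "usual_filtered_space M F"
  shows "prob_space M" "complete_measure M" "0 \<le> t \<Longrightarrow> t \<le> 1 \<Longrightarrow> subalgebra M (F t)"
    "0 \<le> s \<Longrightarrow> s \<le> t \<Longrightarrow> t \<le> 1 \<Longrightarrow> sets (F s) \<subseteq> sets (F t)" "null_sets M \<subseteq> sets (F 0)"
proof -
  note D = assms[unfolded usual_filtered_space_def]
  from D show "prob_space M" by (rule conjunct1)
  from D show "complete_measure M" by (elim conjE)
  from D have "\<forall>t\<in>{0..1}. subalgebra M (F t)" by (elim conjE)
  then show "0 \<le> t \<Longrightarrow> t \<le> 1 \<Longrightarrow> subalgebra M (F t)" by simp
  from D have "\<forall>s\<in>{0..1}. \<forall>t\<in>{s..1}. sets (F s) \<subseteq> sets (F t)" by (elim conjE)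
  then show "0 \<le> s \<Longrightarrow> s \<le> t \<Longrightarrow> t \<le> 1 \<Longrightarrow> sets (F s) \<subseteq> sets (F t)" by fastforce
  from D show "null_sets M \<subseteq> sets (F 0)" by (elim conjE)
qed

text \<open>Every Brownian motion is almost surely equal to such a \<open>\<beta>\<close>, see \<open>gaussian_driver_exists\<close>.\<close>

locale gaussian_driver =
  fixes M :: "'a measure" and F :: "real \<Rightarrow> 'a measure" and \<beta> :: "real \<Rightarrow> 'a \<Rightarrow> real"
  assumes usual: "usual_filtered_space M F"
    and adapted_driver: "\<And>t. 0 \<le> t \<Longrightarrow> t \<le> 1 \<Longrightarrow> \<beta> t \<in> borel_measurable (F t)"
    and continuous_driver: "\<And>\<omega>. continuous_on {0..1} (\<lambda>t. \<beta> t \<omega>)"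
    and driver_zero: "\<And>\<omega>. \<beta> 0 \<omega> = 0"
    and increment: "\<And>s t. 0 \<le> s \<Longrightarrow> s \<le> t \<Longrightarrow> t \<le> 1 \<Longrightarrow>
      gauss_indep M (F s) (\<lambda>\<omega>. \<beta> t \<omega> - \<beta> s \<omega>) (t - s)"
begin

sublocale prob_space M using usual by (rule usual_filtered_spaceD)

lemmas complete_M = usual_filtered_spaceD(2)[OF usual]
  and subalgebra_F = usual_filtered_spaceD(3)[OF usual]

lemma F_mono: "0 \<le> s \<Longrightarrow> s \<le> t \<Longrightarrow> t \<le> 1 \<Longrightarrow> subalgebra (F t) (F s)"
  using usual_filtered_spaceD(4)[OF usual, of s t] subalgebra_F[of s] subalgebra_F[of t]
  by (simp add: subalgebra_def)

lemma null_sets_F: "0 \<le> t \<Longrightarrow> t \<le> 1 \<Longrightarrow> null_sets M \<subseteq> sets (F t)"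
  using usual_filtered_spaceD(5)[OF usual] usual_filtered_spaceD(4)[OF usual, of 0 t] by simp

lemma continuous_driver_time_set: "time_set T \<Longrightarrow> continuous_on T (\<lambda>t. \<beta> t \<omega>)"
  by (rule continuous_on_subset[OF continuous_driver]) (rule time_set(8))

abbreviation W :: "(real \<Rightarrow> real) \<Rightarrow> (real \<Rightarrow> real) \<Rightarrow> real \<Rightarrow> 'a \<Rightarrow> real" where
  "W g g' t \<omega> \<equiv> wiener_integral g g' (\<lambda>r. \<beta> r \<omega>) t"

lemma W_zero: "W g g' 0 \<omega> = 0"
  by (simp add: wiener_integral_def driver_zero)

text \<open>Measurability of the partial sums is proved along with their law, since
  \<open>gauss_indep_add\<close> asks for it whenever the next increment is appended.\<close>

lemma riemann_sum_gauss:
  assumes "\<And>i. i < n \<Longrightarrow> \<pi> i \<le> \<pi> (Suc i)" "\<And>i. i \<le> n \<Longrightarrow> 0 \<le> \<pi> i \<and> \<pi> i \<le> 1"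
  shows "(\<lambda>\<omega>. \<Sum>i<n. c i * (\<beta> (\<pi> (Suc i)) \<omega> - \<beta> (\<pi> i) \<omega>)) \<in> borel_measurable (F (\<pi> n)) \<and>
    gauss_indep M (F (\<pi> 0)) (\<lambda>\<omega>. \<Sum>i<n. c i * (\<beta> (\<pi> (Suc i)) \<omega> - \<beta> (\<pi> i) \<omega>))
      (\<Sum>i<n. (c i)\<^sup>2 * (\<pi> (Suc i) - \<pi> i)) \<and> \<pi> 0 \<le> \<pi> n"
  using assms
proof (induction n)
  case 0
  then show ?case by (simp add: gauss_indep_zero)
next
  case (Suc n)
  let ?S = "\<lambda>\<omega>. \<Sum>i<n. c i * (\<beta> (\<pi> (Suc i)) \<omega> - \<beta> (\<pi> i) \<omega>)"
  have IH: "?S \<in> borel_measurable (F (\<pi> n))" "gauss_indep M (F (\<pi> 0)) ?S (\<Sum>i<n. (c i)\<^sup>2 * (\<pi> (Suc i) - \<pi> i))"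
    "\<pi> 0 \<le> \<pi> n" using Suc by auto
  have p: "0 \<le> \<pi> 0" "0 \<le> \<pi> n" "\<pi> n \<le> \<pi> (Suc n)" "\<pi> (Suc n) \<le> 1" "\<pi> n \<le> 1" using Suc.prems by auto
  have [measurable]: "?S \<in> borel_measurable (F (\<pi> (Suc n)))" "\<beta> (\<pi> n) \<in> borel_measurable (F (\<pi> (Suc n)))"
    "\<beta> (\<pi> (Suc n)) \<in> borel_measurable (F (\<pi> (Suc n)))"
    using measurable_from_subalg[OF F_mono[OF p(2-4)] IH(1)]
      measurable_from_subalg[OF F_mono[OF p(2-4)] adapted_driver[OF p(2,5)]] adapted_driver[of "\<pi> (Suc n)"] p by auto
  have "(\<lambda>\<omega>. ?S \<omega> + c n * (\<beta> (\<pi> (Suc n)) \<omega> - \<beta> (\<pi> n) \<omega>)) \<in> borel_measurable (F (\<pi> (Suc n)))" by measurable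
  moreover have "gauss_indep M (F (\<pi> 0)) (\<lambda>\<omega>. ?S \<omega> + c n * (\<beta> (\<pi> (Suc n)) \<omega> - \<beta> (\<pi> n) \<omega>))
      ((\<Sum>i<n. (c i)\<^sup>2 * (\<pi> (Suc i) - \<pi> i)) + (c n)\<^sup>2 * (\<pi> (Suc n) - \<pi> n))"
    using p IH by (intro gauss_indep_add[OF _ gauss_indep_scale[OF increment]] F_mono) auto
  ultimately show ?case using IH(3) p by simp
qed

lemma W_measurable:
  assumes "time_set T" "C1_deriv T g g'" "t \<in> T"
  shows "W g g' t \<in> borel_measurable (F t)"
proof -
  have t: "0 \<le> t" "t \<le> 1" using time_set(2,3)[OF assms(1,3)] by auto
  have "uniform_subdivision 0 t n i \<in> {0..1}" if "i \<le> Suc n" for n i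
    using uniform_subdivision(4)[OF t(1) that] t by auto
  then have S: "(\<lambda>\<omega>. \<Sum>i<Suc n. g (uniform_subdivision 0 t n i) * (\<beta> (uniform_subdivision 0 t n (Suc i)) \<omega> -
      \<beta> (uniform_subdivision 0 t n i) \<omega>)) \<in> borel_measurable (F t)" for n
    using riemann_sum_gauss[of "Suc n" "uniform_subdivision 0 t n" "\<lambda>i. g (uniform_subdivision 0 t n i)"]
      uniform_subdivision(2,3)[OF t(1)] by (simp del: sum.lessThan_Suc)
  show ?thesis
  proof (rule borel_measurable_LIMSEQ_real[OF _ S])
    show "(\<lambda>n. \<Sum>i<Suc n. g (uniform_subdivision 0 t n i) * (\<beta> (uniform_subdivision 0 t n (Suc i)) \<omega> -
      \<beta> (uniform_subdivision 0 t n i) \<omega>)) \<longlonglongrightarrow> W g g' t \<omega>" for \<omega>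
      using wiener_integral_seq[OF assms(1,2) continuous_driver_time_set[OF assms(1)] assms(3) order.refl t(1), of \<omega>]
      by (simp only: W_zero diff_0_right)
  qed
qed

lemma W_measurable_M:
  assumes "time_set T" "C1_deriv T g g'" "t \<in> T"
  shows "W g g' t \<in> borel_measurable M"
  using measurable_from_subalg[OF subalgebra_F W_measurable[OF assms]] time_set(2,3)[OF assms(1,3)] by auto

lemma W_gauss:
  assumes "time_set T" "C1_deriv T g g'" "t \<in> T" "0 \<le> s" "s \<le> t"
  shows "gauss_indep M (F s) (\<lambda>\<omega>. W g g' t \<omega> - W g g' s \<omega>)
    (integral {0..t} (\<lambda>r. (g r)\<^sup>2) - integral {0..s} (\<lambda>r. (g r)\<^sup>2))"
proof (rule gauss_indep_LIMSEQ[OF prob_space_axioms])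
  let ?u = "uniform_subdivision s t"
  have t: "0 \<le> t" "t \<le> 1" "s \<le> 1" "s \<in> T"
    using time_set(2,3)[OF assms(1,3)] time_set(4)[OF assms(1,3-5)] assms(4,5) by auto
  show "subalgebra M (F s)" using subalgebra_F assms t by auto
  have "?u n i \<in> {0..1}" if "i \<le> Suc n" for n i
    using uniform_subdivision(4)[OF assms(5) that] t assms by auto
  then show "gauss_indep M (F s) (\<lambda>\<omega>. \<Sum>i<Suc n. g (?u n i) * (\<beta> (?u n (Suc i)) \<omega> - \<beta> (?u n i) \<omega>))
      (\<Sum>i<Suc n. (g (?u n i) * g (?u n i)) * (?u n (Suc i) - ?u n i))" for n
    using riemann_sum_gauss[of "Suc n" "?u n" "\<lambda>i. g (?u n i)"]
      uniform_subdivision(1,3)[OF assms(5)] by (simp del: sum.lessThan_Suc add: power2_eq_square)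
  show "(\<lambda>\<omega>. W g g' t \<omega> - W g g' s \<omega>) \<in> borel_measurable M"
    using W_measurable_M assms t by (intro borel_measurable_diff) auto
  show "AE \<omega> in M. (\<lambda>n. \<Sum>i<Suc n. g (?u n i) * (\<beta> (?u n (Suc i)) \<omega> - \<beta> (?u n i) \<omega>)) \<longlonglongrightarrow> W g g' t \<omega> - W g g' s \<omega>"
    by (intro AE_I2 wiener_integral_seq[OF assms(1,2) continuous_driver_time_set[OF assms(1)] assms(3-5)])
  show "(\<lambda>n. \<Sum>i<Suc n. (g (?u n i) * g (?u n i)) * (?u n (Suc i) - ?u n i)) \<longlonglongrightarrow>
      integral {0..t} (\<lambda>r. (g r)\<^sup>2) - integral {0..s} (\<lambda>r. (g r)\<^sup>2)"
    unfolding wiener_integral_square_id[OF assms(1-3), symmetric]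
      wiener_integral_square_id[OF assms(1,2) t(4), symmetric]
    by (rule wiener_integral_seq[OF assms(1) C1_deriv_mult[OF assms(2,2)] _ assms(3-5)]) (rule continuous_on_id)
qed

text \<open>\<open>J\<close> has to match the Wiener integral only up to null sets, so that the
  lemma also applies to the diffusion built later, whose value at time 1 is obtained as a
  limit.\<close>

lemma W_ito_integral:
  assumes "time_set T" "C1_deriv T g g'"
    and eq: "AE \<omega> in M. \<forall>t\<in>{0..1}. B t \<omega> = \<beta> t \<omega>"
    and B: "\<And>t. 0 \<le> t \<Longrightarrow> t \<le> 1 \<Longrightarrow> B t \<in> borel_measurable M"
    and J: "\<And>t. t \<in> T \<Longrightarrow> J t \<in> borel_measurable M" "\<And>t. t \<in> T \<Longrightarrow> AE \<omega> in M. J t \<omega> = W g g' t \<omega>"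
  shows "is_ito_integral M B T (\<lambda>t \<omega>. g t) J"
  unfolding is_ito_integral_def
proof (intro ballI allI impI)
  fix t and \<epsilon> :: real assume t: "t \<in> T" and "0 < \<epsilon>"
  have t01: "0 \<le> t" "t \<le> 1" using time_set(2,3)[OF assms(1)] t by auto
  let ?S = "\<lambda>n \<pi> \<omega>. \<Sum>i<n. g (\<pi> i) * (B (\<pi> (Suc i)) \<omega> - B (\<pi> i) \<omega>)"
  show "\<exists>\<delta>>0. \<forall>n \<pi>. fine_subdivision t \<delta> n \<pi> \<longrightarrow> prob {\<omega>\<in>space M. \<bar>?S n \<pi> \<omega> - J t \<omega>\<bar> > \<epsilon>} < \<epsilon>"
  proof (rule subdivision_limit_in_probability[OF _ J(1)[OF t] _ \<open>0 < \<epsilon>\<close>])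
    show "?S n \<pi> \<in> borel_measurable M" if "fine_subdivision t \<delta> n \<pi>" for \<delta> n \<pi>
    proof -
      have "0 \<le> \<pi> i \<and> \<pi> i \<le> 1" if "i \<le> n" for i
        using fine_subdivision_range[OF \<open>fine_subdivision t \<delta> n \<pi>\<close> that] t01 by linarith
      then show ?thesis
        by (intro borel_measurable_sum borel_measurable_times borel_measurable_diff B) auto
    qed
    show "AE \<omega> in M. \<forall>\<epsilon>>0. \<exists>\<delta>>0. \<forall>n \<pi>. fine_subdivision t \<delta> n \<pi> \<longrightarrow> \<bar>?S n \<pi> \<omega> - J t \<omega>\<bar> < \<epsilon>"
      using eq J(2)[OF t]
    proof eventually_elim
      fix \<omega> assume \<omega>: "\<forall>t\<in>{0..1}. B t \<omega> = \<beta> t \<omega>" "J t \<omega> = W g g' t \<omega>"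
      show "\<forall>\<epsilon>>0. \<exists>\<delta>>0. \<forall>n \<pi>. fine_subdivision t \<delta> n \<pi> \<longrightarrow> \<bar>?S n \<pi> \<omega> - J t \<omega>\<bar> < \<epsilon>"
      proof (intro allI impI)
        fix \<epsilon> :: real assume "0 < \<epsilon>"
        have sub: "{0..t} \<subseteq> T" using time_set(5)[OF assms(1) t] by simp
        note C = C1_deriv_subset[OF assms(2) sub]
        from riemann_stieltjes_by_parts[OF t01(1) continuous_on_subset[OF continuous_driver_time_set[OF assms(1)] sub]
            C1_derivD(1,2)[OF C] \<open>0 < \<epsilon>\<close>, of \<omega>]
        obtain \<delta> where \<delta>: "\<delta> > 0" "\<And>n \<pi>. \<pi> 0 = 0 \<and> \<pi> n = t \<and> (\<forall>i<n. \<pi> i \<le> \<pi> (Suc i) \<and> \<pi> (Suc i) - \<pi> i < \<delta>) \<Longrightarrow>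
          \<bar>(\<Sum>i<n. g (\<pi> i) * (\<beta> (\<pi> (Suc i)) \<omega> - \<beta> (\<pi> i) \<omega>))
            - (g t * \<beta> t \<omega> - g 0 * \<beta> 0 \<omega> - integral {0..t} (\<lambda>r. \<beta> r \<omega> * g' r))\<bar> < \<epsilon>" by blast
        have "\<bar>?S n \<pi> \<omega> - J t \<omega>\<bar> < \<epsilon>" if fine: "fine_subdivision t \<delta> n \<pi>" for n \<pi>
        proof -
          have "B (\<pi> i) \<omega> = \<beta> (\<pi> i) \<omega>" if "i \<le> n" for i
            using \<omega>(1) fine_subdivision_range[OF fine that] t01 by simp
          then have "?S n \<pi> \<omega> = (\<Sum>i<n. g (\<pi> i) * (\<beta> (\<pi> (Suc i)) \<omega> - \<beta> (\<pi> i) \<omega>))"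
            by (intro sum.cong) auto
          then show ?thesis
            using \<delta>(2)[of \<pi> n] fine \<omega>(2) by (simp add: wiener_integral_def driver_zero fine_subdivision_def)
        qed
        with \<delta>(1) show "\<exists>\<delta>>0. \<forall>n \<pi>. fine_subdivision t \<delta> n \<pi> \<longrightarrow> \<bar>?S n \<pi> \<omega> - J t \<omega>\<bar> < \<epsilon>" by blast
      qed
    qed
  qed
qed

end

lemma gaussian_driver_exists:
  assumes usual: "usual_filtered_space M F" and B: "brownian_motion M F B"
  shows "\<exists>\<beta>. gaussian_driver M F \<beta> \<and> (AE \<omega> in M. \<forall>t. B t \<omega> = \<beta> t \<omega>)"
proof -
  interpret prob_space M using usual by (rule usual_filtered_spaceD)
  note cM = usual_filtered_spaceD(2)[OF usual] and sub = usual_filtered_spaceD(3)[OF usual]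
  have null: "null_sets M \<subseteq> sets (F t)" if "0 \<le> t" "t \<le> 1" for t
    using usual_filtered_spaceD(5)[OF usual] usual_filtered_spaceD(4)[OF usual, of 0 t] that by simp
  \<comment> \<open>The event of bad paths is contained in a null set, so by the usual conditions
    setting \<beta> to zero there keeps it adapted.\<close>
  define \<beta> where "\<beta> t \<omega> = (if B 0 \<omega> = 0 \<and> continuous_on {0..1} (\<lambda>t. B t \<omega>) then B t \<omega> else 0)" for t \<omega>
  have "AE \<omega> in M. B 0 \<omega> = 0" "AE \<omega> in M. continuous_on {0..1} (\<lambda>t. B t \<omega>)"
    using B by (auto simp: brownian_motion_def)
  then have eq: "AE \<omega> in M. \<forall>t. B t \<omega> = \<beta> t \<omega>" by eventually_elim (simp add: \<beta>_def)
  have adB: "B t \<in> borel_measurable (F t)" if "0 \<le> t" "t \<le> 1" for t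
    using B that by (simp add: brownian_motion_def adapted_def)
  have ad: "\<beta> t \<in> borel_measurable (F t)" if "0 \<le> t" "t \<le> 1" for t
    by (rule borel_measurable_null_modification[OF cM sub[OF that] null[OF that] adB[OF that]])
      (use eq in eventually_elim, simp)
  have [measurable]: "\<beta> t \<in> borel_measurable M" "B t \<in> borel_measurable M" if "0 \<le> t" "t \<le> 1" for t
    using measurable_from_subalg[OF sub ad] measurable_from_subalg[OF sub adB] that by auto
  have "gaussian_driver M F \<beta>"
  proof
    show "usual_filtered_space M F" by fact
    show "\<beta> t \<in> borel_measurable (F t)" if "0 \<le> t" "t \<le> 1" for t using ad that .
    show "continuous_on {0..1} (\<lambda>t. \<beta> t \<omega>)" for \<omega>
      by (cases "B 0 \<omega> = 0 \<and> continuous_on {0..1} (\<lambda>t. B t \<omega>)") (auto simp: \<beta>_def[abs_def])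
    show "\<beta> 0 \<omega> = 0" for \<omega> by (simp add: \<beta>_def)
    show "gauss_indep M (F s) (\<lambda>\<omega>. \<beta> t \<omega> - \<beta> s \<omega>) (t - s)" if st: "0 \<le> s" "s \<le> t" "t \<le> 1" for s t
    proof (cases "s = t")
      case True then show ?thesis by (simp add: gauss_indep_zero)
    next
      case False
      then have "gauss_indep M (F s) (\<lambda>\<omega>. B t \<omega> - B s \<omega>) (t - s)"
        using B st by (intro gauss_indepI sub) (auto simp: brownian_motion_def)
      then show ?thesis
        by (rule gauss_indep_cong_AE[OF prob_space_axioms sub[of s], rotated 2]) (use st eq in \<open>auto elim: eventually_mono\<close>)
    qed
  qed
  with eq show ?thesis by blast
qed

text \<open>Tonelli's theorem will need joint measurability. Rounding time down to multiples of
  \<open>1 / (n + 1)\<close> stays inside \<open>{0..<1}\<close>, takes countably many values and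
  converges along continuous paths.\<close>

lemma borel_measurable_continuous_process:
  fixes X :: "real \<Rightarrow> 'a \<Rightarrow> real"
  assumes X: "\<And>t. 0 \<le> t \<Longrightarrow> t < 1 \<Longrightarrow> X t \<in> borel_measurable M"
    and cont: "\<And>\<omega>. \<omega> \<in> space M \<Longrightarrow> continuous_on {0..<1} (\<lambda>t. X t \<omega>)"
  shows "(\<lambda>(\<omega>, r). indicator {0..<1} r * X r \<omega>) \<in> borel_measurable (M \<Otimes>\<^sub>M borel)"
proof (rule borel_measurable_LIMSEQ_real)
  let ?r = "\<lambda>n k. real_of_int k / real (Suc n)"
  let ?Y = "\<lambda>n k \<omega>. if 0 \<le> ?r n k \<and> ?r n k < 1 then X (?r n k) \<omega> else 0"
  let ?k = "\<lambda>n r. \<lfloor>r * real (Suc n)\<rfloor>"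
  show "(\<lambda>z. indicator {0..<1} (snd z) * ?Y n (?k n (snd z)) (fst z)) \<in> borel_measurable (M \<Otimes>\<^sub>M borel)" for n
  proof (rule borel_measurable_times)
    show "(\<lambda>z. ?Y n (?k n (snd z)) (fst z)) \<in> borel_measurable (M \<Otimes>\<^sub>M borel)"
    proof (rule measurable_compose_countable[where f="\<lambda>k z. ?Y n k (fst z)"])
      show "(\<lambda>z. ?Y n k (fst z)) \<in> borel_measurable (M \<Otimes>\<^sub>M borel)" for k
        using X[of "?r n k"] by (cases "0 \<le> ?r n k \<and> ?r n k < 1") auto
    qed measurable
  qed measurable
  show "(\<lambda>n. indicator {0..<1} (snd z) * ?Y n (?k n (snd z)) (fst z)) \<longlonglongrightarrow> (\<lambda>(\<omega>, r). indicator {0..<1} r * X r \<omega>) z"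
    if z: "z \<in> space (M \<Otimes>\<^sub>M borel)" for z
  proof (cases "snd z \<in> {0..<1}")
    case True
    obtain \<omega> r where [simp]: "z = (\<omega>, r)" by (cases z)
    have r: "0 \<le> r" "r < 1" using True by auto
    have \<omega>: "\<omega> \<in> space M" using z by (simp add: space_pair_measure)
    have le: "?r n (?k n r) \<le> r" for n
      using of_int_floor_le[of "r * real (Suc n)"] by (simp add: divide_le_eq del: of_nat_Suc)
    have ge: "r - inverse (real (Suc n)) \<le> ?r n (?k n r)" for n
    proof -
      have "r * real (Suc n) - 1 \<le> real_of_int (?k n r)" by linarith
      then have "(r * real (Suc n) - 1) / real (Suc n) \<le> ?r n (?k n r)" by (rule divide_right_mono) simp
      then show ?thesis by (simp add: diff_divide_distrib inverse_eq_divide del: of_nat_Suc)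
    qed
    have pos: "0 \<le> ?r n (?k n r)" for n using r by simp
    have less: "?r n (?k n r) < 1" for n using le[of n] r by linarith
    have lim: "(\<lambda>n. ?r n (?k n r)) \<longlonglongrightarrow> r"
    proof (rule tendsto_sandwich)
      show "(\<lambda>n. r - inverse (real (Suc n))) \<longlonglongrightarrow> r"
        using tendsto_diff[OF tendsto_const LIMSEQ_inverse_real_of_nat, of r] by simp
      show "(\<lambda>_::nat. r) \<longlonglongrightarrow> r" by simp
    qed (use le ge in auto)
    have "(\<lambda>n. X (?r n (?k n r)) \<omega>) \<longlonglongrightarrow> X r \<omega>"
      by (rule continuous_on_tendsto_compose[OF cont[OF \<omega>] lim])
        (use r less pos in \<open>simp_all only: atLeastLessThan_iff eventually_True simp_thms\<close>)
    moreover have "(\<lambda>n. indicator {0..<1} (snd z) * ?Y n (?k n (snd z)) (fst z)) = (\<lambda>n. X (?r n (?k n r)) \<omega>)"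
      using pos less True by (intro ext) (simp del: of_nat_Suc)
    ultimately show ?thesis using True by (simp del: of_nat_Suc)
  qed (simp add: case_prod_beta)
qed

section \<open>Gaussian transition densities and their bridges\<close>

text \<open>The normal density of variance \<tau>, with the normalising factor kept in the exponent:
  in this form it is positive for every real \<tau>, has a plain logarithm for the cross ratio and
  is differentiated by one chain rule.\<close>

definition gauss_kernel :: "real \<Rightarrow> real \<Rightarrow> real" where
  "gauss_kernel \<tau> x = exp (- (x\<^sup>2 / (2 * \<tau>)) - ln (2 * pi * \<tau>) / 2)"

lemma gauss_kernel_pos: "0 < gauss_kernel \<tau> x"
  by (simp add: gauss_kernel_def)

lemma normal_density_eq_gauss_kernel:
  assumes "0 < \<tau>"
  shows "normal_density \<mu> (sqrt \<tau>) x = gauss_kernel \<tau> (x - \<mu>)"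
proof -
  have "exp (- (ln (2 * pi * \<tau>) / 2)) = inverse (sqrt (2 * pi * \<tau>))"
    using assms by (subst ln_sqrt[symmetric]) (auto simp: exp_minus)
  then have "gauss_kernel \<tau> (x - \<mu>) = exp (- ((x - \<mu>)\<^sup>2 / (2 * \<tau>))) * inverse (sqrt (2 * pi * \<tau>))"
    unfolding gauss_kernel_def diff_conv_add_uminus exp_add by simp
  then show ?thesis using assms by (simp add: normal_density_def inverse_eq_divide)
qed

lemma gauss_kernel_measurable [measurable (raw)]:
  assumes [measurable]: "f \<in> borel_measurable M" "g \<in> borel_measurable M"
  shows "(\<lambda>x. gauss_kernel (f x) (g x)) \<in> borel_measurable M"
  unfolding gauss_kernel_def by measurable

lemma nn_integral_gauss_kernel:
  assumes "0 < \<tau>"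
  shows "(\<integral>\<^sup>+ v. ennreal (gauss_kernel \<tau> (v - u)) \<partial>lborel) = 1"
proof -
  interpret prob_space "density lborel (normal_density u (sqrt \<tau>))"
    using assms by (simp add: prob_space_normal_density)
  show ?thesis
    using emeasure_space_1 by (simp add: emeasure_density normal_density_eq_gauss_kernel[OF assms])
qed

lemma gauss_kernel_convolution:
  assumes "0 < a" "0 < b"
  shows "(\<integral>\<^sup>+ v. ennreal (gauss_kernel a (v - u) * gauss_kernel b (w - v)) \<partial>lborel) = ennreal (gauss_kernel (a + b) (w - u))"
proof -
  have "(\<integral>\<^sup>+ v. ennreal (gauss_kernel a (v - u) * gauss_kernel b (w - v)) \<partial>lborel) =
      (\<integral>\<^sup>+ y. ennreal (gauss_kernel a y * gauss_kernel b (w - (u + y))) \<partial>lborel)"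
    by (subst nn_integral_real_affine[of _ 1 u]) auto
  also have "\<dots> = (\<integral>\<^sup>+ y. ennreal (normal_density 0 (sqrt b) ((w - u) - y) * normal_density 0 (sqrt a) y) \<partial>lborel)"
    using assms by (intro nn_integral_cong) (simp add: normal_density_eq_gauss_kernel mult.commute diff_diff_eq)
  also have "\<dots> = normal_density 0 (sqrt ((sqrt b)\<^sup>2 + (sqrt a)\<^sup>2)) (w - u)"
    using fun_cong[OF conv_normal_density_zero_mean, of "sqrt b" "sqrt a" "w - u"] assms by simp
  finally show ?thesis using assms by (simp add: normal_density_eq_gauss_kernel add.commute)
qed

text \<open>The transition density of Brownian motion run with the clock \<open>V\<close>.\<close>

definition gauss_transition :: "(real \<Rightarrow> real) \<Rightarrow> real \<Rightarrow> real \<Rightarrow> real \<Rightarrow> real \<Rightarrow> real" where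
  "gauss_transition V s u t v = gauss_kernel (V t - V s) (v - u)"

lemma transition_density_gauss:
  assumes "strict_mono_on I V"
  shows "transition_density I (gauss_transition V)"
  unfolding transition_density_def gauss_transition_def
proof (intro conjI ballI allI impI)
  fix r s t u w assume I: "r \<in> I" "s \<in> I" "t \<in> I" "r < s" "s < t"
  then have "0 < V s - V r" "0 < V t - V s" using assms by (auto simp: strict_mono_on_def)
  from gauss_kernel_convolution[OF this, of u w]
  show "(\<integral>\<^sup>+ v. ennreal (gauss_kernel (V s - V r) (v - u) * gauss_kernel (V t - V s) (w - v)) \<partial>lborel) =
      ennreal (gauss_kernel (V t - V r) (w - u))" by simp
qed (use assms in \<open>auto simp: strict_mono_on_def gauss_kernel_pos less_imp_le intro!: nn_integral_gauss_kernel\<close>)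

text \<open>Completing the square in \<open>v\<close>: the precisions \<open>1 / a\<close> and
  \<open>1 / b\<close> add up, and the centre is the mean of \<open>u\<close> and \<open>y\<close>
  with weights \<open>b / (a + b)\<close> and \<open>a / (a + b)\<close>. The square left over is
  the exponent of the denominator.\<close>

lemma gauss_kernel_bridge:
  assumes "0 < a" "0 < b"
  shows "gauss_kernel a (v - u) * gauss_kernel b (y - v) / gauss_kernel (a + b) (y - u) =
    gauss_kernel (a * b / (a + b)) (v - (y + b / (a + b) * (u - y)))"
proof -
  have "ln (2 * pi * (a * b / (a + b))) = ln (2 * pi * a) + ln (2 * pi * b) - ln (2 * pi * (a + b))"
    using assms by (simp add: ln_mult ln_div)
  moreover have "(v - (y + b / (a + b) * (u - y)))\<^sup>2 / (2 * (a * b / (a + b))) =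
      (v - u)\<^sup>2 / (2 * a) + (y - v)\<^sup>2 / (2 * b) - (y - u)\<^sup>2 / (2 * (a + b))"
  proof -
    have ab: "a + b \<noteq> 0" "a \<noteq> 0" "b \<noteq> 0" using assms by auto
    have m: "v - (y + b / (a + b) * (u - y)) = (a * (v - y) + b * (v - u)) / (a + b)"
      using ab by (simp add: field_simps)
    show ?thesis unfolding m using ab
      by (simp add: power_divide divide_simps) algebra
  qed
  ultimately show ?thesis
    by (simp add: gauss_kernel_def exp_add[symmetric] exp_diff[symmetric] diff_divide_distrib add_divide_distrib)
qed

lemma bridge_density_gauss:
  assumes "strict_mono_on {0..1} V" "0 \<le> s" "s < t" "t < 1"
  shows "bridge_density (gauss_transition V) y s u t v =
    gauss_kernel ((V t - V s) * (V 1 - V t) / (V 1 - V s)) (v - (y + (V 1 - V t) / (V 1 - V s) * (u - y)))"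
proof -
  have "0 < V t - V s" "0 < V 1 - V t" using assms by (auto simp: strict_mono_on_def)
  from gauss_kernel_bridge[OF this, of v u y] show ?thesis
    by (simp add: bridge_density_def gauss_transition_def)
qed

lemma transition_density_bridge_gauss:
  assumes V: "strict_mono_on {0..1} V"
  shows "transition_density {0..<1} (bridge_density (gauss_transition V) y)"
  unfolding transition_density_def
proof (intro conjI ballI impI)
  fix s t :: real assume st: "s \<in> {0..<1}" "t \<in> {0..<1}" "s < t"
  have pos: "0 < V t - V s" "0 < V 1 - V t" "0 < V 1 - V s" using V st by (auto simp: strict_mono_on_def)
  have eq: "bridge_density (gauss_transition V) y s u t v =
    gauss_kernel ((V t - V s) * (V 1 - V t) / (V 1 - V s)) (v - (y + (V 1 - V t) / (V 1 - V s) * (u - y)))" for u v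
    using bridge_density_gauss[OF V, of s t y u v] st by simp
  show "(\<lambda>(u, v). bridge_density (gauss_transition V) y s u t v) \<in> borel_measurable (borel \<Otimes>\<^sub>M borel)"
    unfolding eq by measurable
  show "\<forall>u v. 0 \<le> bridge_density (gauss_transition V) y s u t v"
    unfolding eq by (simp add: gauss_kernel_pos less_imp_le)
  show "\<forall>u. (\<integral>\<^sup>+ v. ennreal (bridge_density (gauss_transition V) y s u t v) \<partial>lborel) = 1"
    unfolding eq using pos by (intro allI nn_integral_gauss_kernel) simp
next
  let ?p = "gauss_transition V"
  fix r s t :: real assume rst: "r \<in> {0..<1}" "s \<in> {0..<1}" "t \<in> {0..<1}" "r < s" "s < t"
  show "\<forall>u w. (\<integral>\<^sup>+ v. ennreal (bridge_density ?p y r u s v * bridge_density ?p y s v t w) \<partial>lborel) =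
      ennreal (bridge_density ?p y r u t w)"
  proof (intro allI)
    fix u w
    have pos: "0 < ?p s v t w" for s v t w by (simp add: gauss_transition_def gauss_kernel_pos)
    \<comment> \<open>Doob's transform telescopes: the factor \<open>?p s v 1 y\<close> of the
      intermediate state cancels, which leaves Chapman-Kolmogorov for \<open>?p\<close>
      itself.\<close>
    have "bridge_density ?p y r u s v * bridge_density ?p y s v t w =
        (?p t w 1 y / ?p r u 1 y) * (?p r u s v * ?p s v t w)" for v
      using pos[of s v 1 y] by (simp add: bridge_density_def)
    then have "(\<integral>\<^sup>+ v. ennreal (bridge_density ?p y r u s v * bridge_density ?p y s v t w) \<partial>lborel) =
        (\<integral>\<^sup>+ v. ennreal (?p t w 1 y / ?p r u 1 y) * ennreal (?p r u s v * ?p s v t w) \<partial>lborel)"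
      using pos by (intro nn_integral_cong) (simp only: ennreal_mult[symmetric] less_imp_le divide_nonneg_nonneg mult_nonneg_nonneg)
    also have "\<dots> = ennreal (?p t w 1 y / ?p r u 1 y) * (\<integral>\<^sup>+ v. ennreal (?p r u s v * ?p s v t w) \<partial>lborel)"
      unfolding gauss_transition_def by (intro nn_integral_cmult) measurable
    also have "(\<integral>\<^sup>+ v. ennreal (?p r u s v * ?p s v t w) \<partial>lborel) = ennreal (?p r u t w)"
      using transition_density_gauss[OF V] rst by (auto simp: transition_density_def)
    finally show "(\<integral>\<^sup>+ v. ennreal (bridge_density ?p y r u s v * bridge_density ?p y s v t w) \<partial>lborel) =
      ennreal (bridge_density ?p y r u t w)"
      using pos by (simp add: bridge_density_def ennreal_mult[symmetric] less_imp_le mult.commute)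
  qed
qed

section \<open>Derivatives of the Gaussian kernel in time and space\<close>

lemma gauss_kernel_deriv_x:
  "\<tau> \<noteq> 0 \<Longrightarrow> ((\<lambda>x. gauss_kernel \<tau> (x - u)) has_real_derivative - ((x - u) / \<tau>) * gauss_kernel \<tau> (x - u)) (at x within S)"
  unfolding gauss_kernel_def by (auto intro!: derivative_eq_intros simp: field_simps)

lemma gauss_kernel_deriv_t:
  assumes "0 < \<tau> t" "(\<tau> has_real_derivative q) (at t within S)"
  shows "((\<lambda>t. gauss_kernel (\<tau> t) x) has_real_derivative
    q * ((x\<^sup>2 / (\<tau> t)\<^sup>2 - 1 / \<tau> t) / 2) * gauss_kernel (\<tau> t) x) (at t within S)"
  unfolding gauss_kernel_def using assms(1)
  by (auto intro!: derivative_eq_intros assms(2) simp: field_simps power2_eq_square)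

lemma C2_on_gauss_kernel:
  assumes \<tau>: "\<And>t. t \<in> S \<Longrightarrow> (\<tau> has_real_derivative q t) (at t within S)" "\<And>t. t \<in> S \<Longrightarrow> 0 < \<tau> t"
    and q: "C1_deriv S q q'"
  shows "C2_on S (\<lambda>t z. gauss_kernel (\<tau> t) (z - u))"
  unfolding C2_on_def
proof (intro exI conjI ballI allI)
  let ?n = "\<lambda>t z. gauss_kernel (\<tau> t) (z - u)"
  \<comment> \<open>\<open>?A\<close> is the logarithmic derivative in the variance. By the heat
    equation the second space derivative is \<open>2 * ?A\<close> times the kernel, and
    \<open>?B\<close> is the common value of the two mixed derivatives.\<close>
  let ?A = "\<lambda>t z. ((z - u)\<^sup>2 / (\<tau> t)\<^sup>2 - 1 / \<tau> t) / 2"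
  let ?B = "\<lambda>t z. q t * ((z - u) / (\<tau> t)\<^sup>2 - (z - u) / \<tau> t * ?A t z) * ?n t z"
  fix t z assume t: "t \<in> S"
  note n_t = gauss_kernel_deriv_t[OF \<tau>(2)[OF t] \<tau>(1)[OF t]]
  have pos: "\<tau> t \<noteq> 0" using \<tau>(2)[OF t] by simp
  show "((\<lambda>t. ?n t z) has_real_derivative q t * ?A t z * ?n t z) (at t within S)" by (rule n_t)
  show "(?n t has_real_derivative - ((z - u) / \<tau> t) * ?n t z) (at z)" using pos by (rule gauss_kernel_deriv_x)
  have n_z: "(?n t has_real_derivative - ((z - u) / \<tau> t) * ?n t z) (at z)" using pos by (rule gauss_kernel_deriv_x)
  have A_t: "((\<lambda>t. ?A t z) has_real_derivative q t * (1 / (2 * (\<tau> t)\<^sup>2) - (z - u)\<^sup>2 / (\<tau> t) ^ 3)) (at t within S)"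
    using pos by (auto intro!: derivative_eq_intros \<tau>(1)[OF t] simp: field_simps power2_eq_square power3_eq_cube)
  have A_z: "((\<lambda>z. ?A t z) has_real_derivative (z - u) / (\<tau> t)\<^sup>2) (at z)"
    using pos by (auto intro!: derivative_eq_intros simp: field_simps power2_eq_square)
  have B_t: "((\<lambda>t. - ((z - u) / \<tau> t)) has_real_derivative q t * ((z - u) / (\<tau> t)\<^sup>2)) (at t within S)"
    using pos by (auto intro!: derivative_eq_intros \<tau>(1)[OF t] simp: field_simps power2_eq_square)
  have B_z: "((\<lambda>z. - ((z - u) / \<tau> t)) has_real_derivative - (1 / \<tau> t)) (at z)"
    using pos by (auto intro!: derivative_eq_intros simp: field_simps)
  have alg: "(a' * b + a * c * a) * n + a * b * n * (a * b) = (a' * b + a\<^sup>2 * c + a\<^sup>2 * b\<^sup>2) * n"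
      "(0 * b + c * a) * n + - a' * n * (a * b) = a * (c - a' * b) * n"
      "a * c * n + a * b * n * - a' = a * (c - a' * b) * n" for a a' b c n :: real
    by (simp_all add: algebra_simps power2_eq_square)
  show "((\<lambda>t. q t * ?A t z * ?n t z) has_real_derivative
      (q' t * ?A t z + (q t)\<^sup>2 * (1 / (2 * (\<tau> t)\<^sup>2) - (z - u)\<^sup>2 / (\<tau> t) ^ 3) + (q t)\<^sup>2 * (?A t z)\<^sup>2) * ?n t z) (at t within S)"
    by (rule DERIV_cong[OF DERIV_mult[OF DERIV_mult[OF C1_derivD(1)[OF q t] A_t] n_t]]) (rule alg)
  show "((\<lambda>z. q t * ?A t z * ?n t z) has_real_derivative ?B t z) (at z)"
    by (rule DERIV_cong[OF DERIV_mult[OF DERIV_mult[OF DERIV_const A_z] n_z]]) (rule alg)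
  show "((\<lambda>t. - ((z - u) / \<tau> t) * ?n t z) has_real_derivative ?B t z) (at t within S)"
    by (rule DERIV_cong[OF DERIV_mult[OF B_t n_t]]) (rule alg)
  show "((\<lambda>z. - ((z - u) / \<tau> t) * ?n t z) has_real_derivative 2 * ?A t z * ?n t z) (at z)"
    by (rule DERIV_cong[OF DERIV_mult[OF B_z n_z]]) (use pos in \<open>simp add: field_simps power2_eq_square\<close>)
next
  let ?n = "\<lambda>t z. gauss_kernel (\<tau> t) (z - u)"
  let ?A = "\<lambda>t z. ((z - u)\<^sup>2 / (\<tau> t)\<^sup>2 - 1 / \<tau> t) / 2"
  let ?B = "\<lambda>t z. q t * ((z - u) / (\<tau> t)\<^sup>2 - (z - u) / \<tau> t * ?A t z) * ?n t z"
  let ?C = "\<lambda>t z. (q' t * ?A t z + (q t)\<^sup>2 * (1 / (2 * (\<tau> t)\<^sup>2) - (z - u)\<^sup>2 / (\<tau> t) ^ 3) + (q t)\<^sup>2 * (?A t z)\<^sup>2) * ?n t z"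
  have lift: "continuous_on (S \<times> UNIV) (\<lambda>x::real \<times> real. f (fst x))" if "continuous_on S f" for f :: "real \<Rightarrow> real"
    by (rule continuous_on_compose2[OF that]) (auto intro: continuous_intros)
  note c = lift[OF DERIV_continuous_on[OF \<tau>(1)]] lift[OF C1_derivD(2)[OF q]] lift[OF C1_derivD(3)[OF q]]
  have pos: "\<tau> (fst x) \<noteq> 0" "0 < \<tau> (fst x)" if "x \<in> S \<times> UNIV" for x :: "real \<times> real"
    using \<tau>(2)[of "fst x"] that by auto
  have n: "continuous_on (S \<times> UNIV) (\<lambda>x. ?n (fst x) (snd x))"
    unfolding gauss_kernel_def using pos by (intro continuous_intros c) auto
  have A: "continuous_on (S \<times> UNIV) (\<lambda>x. ?A (fst x) (snd x))"
    using pos by (intro continuous_intros c) auto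
  have D: "continuous_on (S \<times> UNIV) (\<lambda>x. - ((snd x - u) / \<tau> (fst x)))"
    using pos by (intro continuous_intros c) auto
  have E: "continuous_on (S \<times> UNIV) (\<lambda>x. (snd x - u) / (\<tau> (fst x))\<^sup>2 - (snd x - u) / \<tau> (fst x) * ?A (fst x) (snd x))"
    using pos by (intro continuous_intros c) auto
  have K: "continuous_on (S \<times> UNIV) (\<lambda>x. 1 / (2 * (\<tau> (fst x))\<^sup>2) - (snd x - u)\<^sup>2 / (\<tau> (fst x)) ^ 3)"
    using pos by (intro continuous_intros c) auto
  note qA = continuous_on_mult[OF continuous_on_mult[OF c(3) A] n]
    and Dn = continuous_on_mult[OF D n]
    and qE = continuous_on_mult[OF continuous_on_mult[OF c(3) E] n]
    and A2 = continuous_on_mult[OF continuous_on_mult[OF continuous_on_const A] n]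
    and C = continuous_on_mult[OF continuous_on_add[OF continuous_on_add[OF continuous_on_mult[OF c(2) A]
      continuous_on_mult[OF continuous_on_power[OF c(3)] K]]
      continuous_on_mult[OF continuous_on_power[OF c(3)] continuous_on_power[OF A]]] n]
  fix g assume "g \<in> {?n, \<lambda>t z. q t * ?A t z * ?n t z, \<lambda>t z. - ((z - u) / \<tau> t) * ?n t z, ?C, ?B, ?B,
    \<lambda>t z. 2 * ?A t z * ?n t z}"
  then show "continuous_on (S \<times> UNIV) (\<lambda>(t, z). g t z)"
  proof (elim insertE emptyE)
    show "continuous_on (S \<times> UNIV) (\<lambda>(t, z). g t z)" if "g = ?n" using n unfolding that case_prod_beta .
    show "continuous_on (S \<times> UNIV) (\<lambda>(t, z). g t z)" if "g = (\<lambda>t z. q t * ?A t z * ?n t z)" using qA unfolding that case_prod_beta .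
    show "continuous_on (S \<times> UNIV) (\<lambda>(t, z). g t z)" if "g = (\<lambda>t z. - ((z - u) / \<tau> t) * ?n t z)" using Dn unfolding that case_prod_beta .
    show "continuous_on (S \<times> UNIV) (\<lambda>(t, z). g t z)" if "g = ?C" using C unfolding that case_prod_beta .
    show "continuous_on (S \<times> UNIV) (\<lambda>(t, z). g t z)" if "g = ?B" using qE unfolding that case_prod_beta .
    show "continuous_on (S \<times> UNIV) (\<lambda>(t, z). g t z)" if "g = ?B" using qE unfolding that case_prod_beta .
    show "continuous_on (S \<times> UNIV) (\<lambda>(t, z). g t z)" if "g = (\<lambda>t z. 2 * ?A t z * ?n t z)" using A2 unfolding that case_prod_beta .
  qed
qed

lemma gauss_transition_regular:
  assumes T: "time_set T" and V: "strict_mono_on {0..1} V"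
    and dV: "\<And>t. t \<in> T \<Longrightarrow> (V has_real_derivative q t) (at t within T)" and q: "C1_deriv T q q'"
  shows "\<forall>t\<^sub>1\<in>{0..<1}. \<forall>t\<^sub>2\<in>{t\<^sub>1<..1}. \<forall>z\<^sub>1 z\<^sub>2.
        0 < gauss_transition V t\<^sub>1 z\<^sub>1 t\<^sub>2 z\<^sub>2 \<and>
        (\<lambda>t. gauss_transition V t z\<^sub>1 t\<^sub>2 z\<^sub>2) differentiable (at t\<^sub>1 within {0..<t\<^sub>2}) \<and>
        (\<lambda>z. gauss_transition V t\<^sub>1 z t\<^sub>2 z\<^sub>2) differentiable (at z\<^sub>1) \<and>
        (t\<^sub>2 \<in> T \<longrightarrow> (\<lambda>t. gauss_transition V t\<^sub>1 z\<^sub>1 t z\<^sub>2) differentiable (at t\<^sub>2 within T \<inter> {t\<^sub>1<..})) \<and>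
        (\<lambda>z. gauss_transition V t\<^sub>1 z\<^sub>1 t\<^sub>2 z) differentiable (at z\<^sub>2)"
    "\<forall>t\<^sub>1\<in>{0..<1}. \<forall>z\<^sub>1. C2_on (T \<inter> {t\<^sub>1<..}) (gauss_transition V t\<^sub>1 z\<^sub>1)"
proof -
  have pos: "0 < V t - V s" if "0 \<le> s" "s < t" "t \<le> 1" for s t
    using V that by (auto simp: strict_mono_on_def)
  have T01: "0 \<le> t" "t \<le> 1" if "t \<in> T" for t using time_set(2,3)[OF T that] .
  have dV': "((\<lambda>t. V t - c) has_real_derivative q t) (at t within S)" "((\<lambda>t. c - V t) has_real_derivative - q t) (at t within S)"
    if "t \<in> T" "S \<subseteq> T" for t S c
    using DERIV_subset[OF dV[OF that(1)] that(2)] by (auto intro!: derivative_eq_intros)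
  show "\<forall>t\<^sub>1\<in>{0..<1}. \<forall>t\<^sub>2\<in>{t\<^sub>1<..1}. \<forall>z\<^sub>1 z\<^sub>2.
        0 < gauss_transition V t\<^sub>1 z\<^sub>1 t\<^sub>2 z\<^sub>2 \<and>
        (\<lambda>t. gauss_transition V t z\<^sub>1 t\<^sub>2 z\<^sub>2) differentiable (at t\<^sub>1 within {0..<t\<^sub>2}) \<and>
        (\<lambda>z. gauss_transition V t\<^sub>1 z t\<^sub>2 z\<^sub>2) differentiable (at z\<^sub>1) \<and>
        (t\<^sub>2 \<in> T \<longrightarrow> (\<lambda>t. gauss_transition V t\<^sub>1 z\<^sub>1 t z\<^sub>2) differentiable (at t\<^sub>2 within T \<inter> {t\<^sub>1<..})) \<and>
        (\<lambda>z. gauss_transition V t\<^sub>1 z\<^sub>1 t\<^sub>2 z) differentiable (at z\<^sub>2)"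
  proof (intro ballI allI conjI impI)
    fix t1 t2 z1 z2 :: real assume t: "t1 \<in> {0..<1}" "t2 \<in> {t1<..1}"
    then have t': "0 \<le> t1" "t1 < t2" "t2 \<le> 1" by auto
    have t1: "t1 \<in> T" "{0..<t2} \<subseteq> T" using t time_set(7)[OF T] by auto
    show "0 < gauss_transition V t1 z1 t2 z2" by (simp add: gauss_transition_def gauss_kernel_pos)
    show "(\<lambda>t. gauss_transition V t z1 t2 z2) differentiable (at t1 within {0..<t2})"
      unfolding gauss_transition_def real_differentiable_def
      by (rule exI, rule gauss_kernel_deriv_t[OF pos[OF t'] dV'(2)[OF t1]])
    show "(\<lambda>z. gauss_transition V t1 z t2 z2) differentiable (at z1)"
    proof -
      \<comment> \<open>The kernel is even in space, so the initial point may take the part of the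
        terminal one.\<close>
      have "gauss_transition V t1 z t2 z2 = gauss_kernel (V t2 - V t1) (z - z2)" for z
        by (simp add: gauss_transition_def gauss_kernel_def power2_commute)
      then show ?thesis unfolding real_differentiable_def
        using pos[OF t'] by (simp only:) (rule exI, rule gauss_kernel_deriv_x, simp)
    qed
    show "(\<lambda>z. gauss_transition V t1 z1 t2 z) differentiable (at z2)"
      unfolding gauss_transition_def real_differentiable_def
      by (rule exI, rule gauss_kernel_deriv_x) (use pos[OF t'] in simp)
    show "(\<lambda>t. gauss_transition V t1 z1 t z2) differentiable (at t2 within T \<inter> {t1<..})" if "t2 \<in> T"
      unfolding gauss_transition_def real_differentiable_def
      by (rule exI, rule gauss_kernel_deriv_t[OF pos[OF t'] dV'(1)[OF that]]) auto
  qed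
  show "\<forall>t\<^sub>1\<in>{0..<1}. \<forall>z\<^sub>1. C2_on (T \<inter> {t\<^sub>1<..}) (gauss_transition V t\<^sub>1 z\<^sub>1)"
  proof (intro ballI allI)
    fix t1 z1 :: real assume "t1 \<in> {0..<1}"
    then show "C2_on (T \<inter> {t1<..}) (gauss_transition V t1 z1)"
      unfolding gauss_transition_def[abs_def] using T01
      by (intro C2_on_gauss_kernel[of _ _ q q'] dV'(1) pos C1_deriv_subset[OF q]) auto
  qed
qed

lemma C12_on_time_function:
  assumes "C1_deriv T f f'"
  shows "C12_on T (\<lambda>t z. f t)"
  unfolding C12_on_def
proof (intro exI conjI ballI allI)
  have lift: "continuous_on (T \<times> UNIV) (\<lambda>x::real \<times> real. f (fst x))" if "continuous_on T f" for f :: "real \<Rightarrow> real"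
    by (rule continuous_on_compose2[OF that]) (auto intro: continuous_intros)
  fix g assume "g \<in> {\<lambda>t (z::real). f t, \<lambda>t z. f' t, \<lambda>t z. 0, \<lambda>t z. 0}"
  then show "continuous_on (T \<times> UNIV) (\<lambda>(t, z). g t z)"
    using lift[OF C1_derivD(2)[OF assms]] lift[OF C1_derivD(3)[OF assms]] by (auto simp: case_prod_beta)
qed (use C1_derivD(1)[OF assms] in auto)

section \<open>The linear equation and Gaussian conditional expectations\<close>

text \<open>By parts with the identity as integrand, the time integral is \<open>t * Y t\<close>
  minus a limit of measurable sums, all evaluated at times in \<open>{0..t}\<close>.\<close>

lemma borel_measurable_integral_continuous_process:
  fixes Y :: "real \<Rightarrow> 'a \<Rightarrow> real"
  assumes "0 \<le> t" and Y: "\<And>s. 0 \<le> s \<Longrightarrow> s \<le> t \<Longrightarrow> Y s \<in> borel_measurable N"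
    and cont: "\<And>\<omega>. continuous_on {0..t} (\<lambda>s. Y s \<omega>)"
  shows "(\<lambda>\<omega>. integral {0..t} (\<lambda>s. Y s \<omega>)) \<in> borel_measurable N"
proof -
  let ?u = "uniform_subdivision 0 t"
  let ?S = "\<lambda>n \<omega>. \<Sum>i<Suc n. ?u n i * (Y (?u n (Suc i)) \<omega> - Y (?u n i) \<omega>)"
  have "(\<lambda>n. ?S n \<omega>) \<longlonglongrightarrow> t * Y t \<omega> - 0 * Y 0 \<omega> - integral {0..t} (\<lambda>r. Y r \<omega> * 1)" for \<omega>
    using \<open>0 \<le> t\<close> cont by (intro riemann_stieltjes_by_parts_seq) (auto intro!: derivative_eq_intros)
  then have lim: "(\<lambda>n. t * Y t \<omega> - ?S n \<omega>) \<longlonglongrightarrow> t * Y t \<omega> - (t * Y t \<omega> - 0 * Y 0 \<omega> - integral {0..t} (\<lambda>r. Y r \<omega> * 1))" for \<omega>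
    by (intro tendsto_diff tendsto_const)
  have "?S n \<in> borel_measurable N" for n
    using uniform_subdivision(4)[OF \<open>0 \<le> t\<close>] by (intro borel_measurable_sum borel_measurable_times borel_measurable_diff borel_measurable_const Y) auto
  then have "(\<lambda>\<omega>. t * Y t \<omega> - ?S n \<omega>) \<in> borel_measurable N" for n
    using Y[of t] \<open>0 \<le> t\<close> by (intro borel_measurable_diff borel_measurable_times borel_measurable_const) auto
  from borel_measurable_LIMSEQ_real[OF lim this] show ?thesis by simp
qed

lemma continuous_eq_on_rationals:
  fixes f g :: "real \<Rightarrow> real"
  assumes f: "continuous_on {0..<1} f" and g: "continuous_on {0..<1} g"
    and eq: "\<And>q. q \<in> \<rat> \<Longrightarrow> q \<in> {0..<1} \<Longrightarrow> f q = g q" and t: "t \<in> {0..<1}"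
  shows "f t = g t"
proof (rule ccontr)
  assume "f t \<noteq> g t"
  then have "0 < \<bar>f t - g t\<bar>" by simp
  moreover have "continuous_on {0..<1} (\<lambda>t. f t - g t)" using f g by (rule continuous_on_diff)
  ultimately obtain d where d: "d > 0" "\<And>s. s \<in> {0..<1} \<Longrightarrow> dist s t < d \<Longrightarrow> dist (f s - g s) (f t - g t) < \<bar>f t - g t\<bar>"
    using t unfolding continuous_on_iff by metis
  have "t < min 1 (t + d)" using t d(1) by auto
  from Rats_dense_in_real[OF this] obtain q where q: "q \<in> \<rat>" "t < q" "q < min 1 (t + d)" by blast
  then have "dist (f q - g q) (f t - g t) < \<bar>f t - g t\<bar>"
    using t by (intro d(2)) (auto simp: dist_real_def)
  moreover have "f q - g q = 0" using eq[OF q(1)] q t by auto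
  ultimately show False by (simp add: dist_real_def)
qed

lemma subalgebra_natural_filtration:
  assumes "space G = \<Omega>" and Y: "\<And>s. s \<in> I \<Longrightarrow> s \<le> t \<Longrightarrow> Y s \<in> borel_measurable G"
  shows "subalgebra G (natural_filtration \<Omega> I Y t)"
proof -
  let ?E = "{Y s -` A \<inter> \<Omega> |s A. s \<in> I \<and> s \<le> t \<and> A \<in> sets borel}"
  have "?E \<subseteq> sets G" using measurable_sets[OF Y] assms(1) by auto
  moreover have "?E \<subseteq> Pow \<Omega>" by auto
  ultimately show ?thesis using assms(1) sets.sigma_sets_subset[of ?E G]
    by (simp add: subalgebra_def natural_filtration_def space_measure_of_conv)
qed

lemma subalgebra_augmented_filtration:
  assumes sp: "space G = space M" and null: "null_sets M \<subseteq> sets G"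
    and Y: "\<And>s. s \<in> I \<Longrightarrow> s \<le> t \<Longrightarrow> Y s \<in> borel_measurable G"
  shows "subalgebra G (augmented_filtration M I Y t)"
proof -
  let ?E = "sets (natural_filtration (space M) I Y t) \<union> null_sets M"
  have "?E \<subseteq> sets G"
    using subalgebra_natural_filtration[where Y=Y, OF sp Y] null by (simp add: subalgebra_def)
  moreover from this have "?E \<subseteq> Pow (space M)" using sets.space_closed[of G] sp by auto
  ultimately show ?thesis using sp sets.sigma_sets_subset[of ?E G]
    by (simp add: subalgebra_def augmented_filtration_def space_measure_of_conv)
qed

section \<open>The linear equation and its integrating factor\<close>

lemma time_set_half_open: "time_set {0..<1}"
  by (simp add: time_set_def)

definition integrating_factor :: "(real \<Rightarrow> real) \<Rightarrow> real \<Rightarrow> real" where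
  "integrating_factor h t = exp (integral {0..t} h)"

lemma integrating_factor_pos: "0 < integrating_factor h t"
  by (simp add: integrating_factor_def)

lemma integrating_factor_zero: "integrating_factor h 0 = 1"
  by (simp add: integrating_factor_def)

lemma C1_deriv_integrating_factor:
  assumes "time_set T" "continuous_on T h"
  shows "C1_deriv T (integrating_factor h) (\<lambda>t. h t * integrating_factor h t)"
proof -
  have d: "(integrating_factor h has_real_derivative h t * integrating_factor h t) (at t within T)" if "t \<in> T" for t
    unfolding integrating_factor_def
    by (rule DERIV_cong[OF DERIV_chain2[OF DERIV_exp has_derivative_integral_time_set[OF assms that]]]) simp
  then show ?thesis unfolding C1_deriv_def
    using DERIV_continuous_on[OF d] assms(2) by (auto intro!: continuous_intros)
qed

context gaussian_driver
begin

text \<open>The increments of \<beta> are controlled relative to \<open>F\<close>, so solutions are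
  moved there from the smaller filtration generated by \<open>B\<close> and the null sets.\<close>

lemma strong_solution_adapted:
  assumes B: "adapted F {0..1} B" and sol: "strong_solution M B {0..<1} b \<rho> x Y"
  shows "t \<in> {0..<1} \<Longrightarrow> Y t \<in> borel_measurable (F t)"
proof -
  assume t: "t \<in> {0..<1}"
  then have "Y t \<in> borel_measurable (augmented_filtration M {0..1} B t)"
    using sol by (simp add: strong_solution_def sde_solution_def adapted_def)
  moreover have "subalgebra (F t) (augmented_filtration M {0..1} B t)"
  proof (rule subalgebra_augmented_filtration)
    show "space (F t) = space M" using subalgebra_F[of t] t by (auto simp: subalgebra_def)
    show "null_sets M \<subseteq> sets (F t)" using null_sets_F t by auto
    show "B s \<in> borel_measurable (F t)" if "s \<in> {0..1}" "s \<le> t" for s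
      using B that t measurable_from_subalg[OF F_mono[of s t], of "B s"] by (auto simp: adapted_def)
  qed
  ultimately show "Y t \<in> borel_measurable (F t)" by (metis measurable_from_subalg)
qed

text \<open>The martingale part of the solution and the pathwise integral are limits of the same
  sums, hence agree almost surely at each fixed time. The rational times share one null set, off
  which continuity reaches all times and the deterministic \<open>linear_equation_solution\<close>
  applies.\<close>

lemma linear_sde_solution:
  assumes B: "adapted F {0..1} B" and eq: "AE \<omega> in M. \<forall>t. B t \<omega> = \<beta> t \<omega>"
    and h: "continuous_on {0..<1} h" and \<sigma>: "C1_deriv {0..<1} \<sigma> \<sigma>'"
    and sol: "strong_solution M B {0..<1} (\<lambda>t z. h t * (y - z)) (\<lambda>t z. \<sigma> t) x Y"
  shows "AE \<omega> in M. \<forall>t\<in>{0..<1}. integrating_factor h t * (Y t \<omega> - y) =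
    x - y + W (\<lambda>t. integrating_factor h t * \<sigma> t) (\<lambda>t. h t * integrating_factor h t * \<sigma> t + \<sigma>' t * integrating_factor h t) t \<omega>"
proof -
  note T = time_set_half_open
  let ?J = "\<lambda>t \<omega>. Y t \<omega> - Y 0 \<omega> - integral {0..t} (\<lambda>r. h r * (y - Y r \<omega>))"
  have cont: "AE \<omega> in M. continuous_on {0..<1} (\<lambda>t. Y t \<omega>)" and Y0: "AE \<omega> in M. Y 0 \<omega> = x"
    and ito: "is_ito_integral M B {0..<1} (\<lambda>t \<omega>. \<sigma> t) ?J"
    using sol by (auto simp: strong_solution_def sde_solution_def)
  have BM: "B t \<in> borel_measurable M" if "0 \<le> t" "t \<le> 1" for t
    using B that measurable_from_subalg[OF subalgebra_F, of t "B t"] by (simp add: adapted_def)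
  have YM: "Y t \<in> borel_measurable M" if "t \<in> {0..<1}" for t
    using measurable_from_subalg[OF subalgebra_F strong_solution_adapted[OF B sol that]] that by auto
  have M_modification: "f \<in> borel_measurable M" if "g \<in> borel_measurable M" "AE \<omega> in M. f \<omega> = g \<omega>" for f g :: "'a \<Rightarrow> real"
    by (rule borel_measurable_null_modification[OF complete_M _ _ that]) (auto simp: subalgebra_def)
  have JM: "?J t \<in> borel_measurable M" if t: "t \<in> {0..<1}" for t
  proof -
    \<comment> \<open>The drift integral is shown to be measurable along paths that are all
      continuous; completeness of \<open>M\<close> then carries this over to
      \<open>Y\<close>.\<close>
    define Y' where "Y' t \<omega> = (if continuous_on {0..<1} (\<lambda>t. Y t \<omega>) then Y t \<omega> else 0)" for t \<omega>
    have Y': "AE \<omega> in M. \<forall>t. Y t \<omega> = Y' t \<omega>" using cont by eventually_elim (simp add: Y'_def)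
    have Y'M: "Y' t \<in> borel_measurable M" if "t \<in> {0..<1}" for t
      by (rule M_modification[OF YM[OF that]]) (use Y' in \<open>auto elim: eventually_mono\<close>)
    have contY': "continuous_on {0..<1} (\<lambda>t. Y' t \<omega>)" for \<omega>
      by (cases "continuous_on {0..<1} (\<lambda>t. Y t \<omega>)") (simp_all add: Y'_def)
    have "(\<lambda>\<omega>. integral {0..t} (\<lambda>r. h r * (y - Y' r \<omega>))) \<in> borel_measurable M"
      using t by (intro borel_measurable_integral_continuous_process borel_measurable_times
          borel_measurable_diff borel_measurable_const Y'M continuous_intros
          continuous_on_subset[OF h] continuous_on_subset[OF contY']) auto
    then have "(\<lambda>\<omega>. Y' t \<omega> - Y' 0 \<omega> - integral {0..t} (\<lambda>r. h r * (y - Y' r \<omega>))) \<in> borel_measurable M"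
      using t by (intro borel_measurable_diff Y'M) auto
    then show ?thesis by (rule M_modification) (use Y' in eventually_elim, simp)
  qed
  have WM: "W \<sigma> \<sigma>' t \<in> borel_measurable M" if "t \<in> {0..<1}" for t using W_measurable_M[OF T \<sigma> that] .
  have "is_ito_integral M B {0..<1} (\<lambda>t \<omega>. \<sigma> t) (W \<sigma> \<sigma>')"
    by (rule W_ito_integral[OF T \<sigma> _ BM WM]) (use eq in \<open>auto elim: eventually_mono\<close>)
  then have "AE \<omega> in M. ?J t \<omega> = W \<sigma> \<sigma>' t \<omega>" if "t \<in> {0..<1}" for t
    using that by (intro ito_integral_unique[OF ito] JM WM BM) auto
  then have "AE \<omega> in M. \<forall>q\<in>\<rat> \<inter> {0..<1}. ?J q \<omega> = W \<sigma> \<sigma>' q \<omega>"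
    using countable_rat by (intro AE_ball_countable[THEN iffD2]) (auto intro: countable_subset)
  then show ?thesis using cont Y0
  proof eventually_elim
    fix \<omega> assume q: "\<forall>q\<in>\<rat> \<inter> {0..<1}. ?J q \<omega> = W \<sigma> \<sigma>' q \<omega>"
      and c: "continuous_on {0..<1} (\<lambda>t. Y t \<omega>)" and "Y 0 \<omega> = x"
    have cI: "continuous_on {0..<1} (\<lambda>t. integral {0..t} (\<lambda>r. h r * (y - Y r \<omega>)))"
      by (rule DERIV_continuous_on[OF has_derivative_integral_time_set[OF T]]) (intro continuous_intros h c)
    have J: "?J t \<omega> = W \<sigma> \<sigma>' t \<omega>" if "t \<in> {0..<1}" for t
      by (rule continuous_eq_on_rationals[OF _ _ _ that])
        (use q in \<open>auto intro!: continuous_intros c cI continuous_on_wiener_integral[OF T \<sigma> continuous_driver_time_set[OF T]]\<close>)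
    show "\<forall>t\<in>{0..<1}. integrating_factor h t * (Y t \<omega> - y) =
      x - y + W (\<lambda>t. integrating_factor h t * \<sigma> t) (\<lambda>t. h t * integrating_factor h t * \<sigma> t + \<sigma>' t * integrating_factor h t) t \<omega>"
    proof
      fix t :: real assume t: "t \<in> {0..<1}"
      show "integrating_factor h t * (Y t \<omega> - y) =
        x - y + W (\<lambda>t. integrating_factor h t * \<sigma> t) (\<lambda>t. h t * integrating_factor h t * \<sigma> t + \<sigma>' t * integrating_factor h t) t \<omega>"
      proof (rule linear_equation_solution[OF T C1_deriv_integrating_factor[OF T h] h \<sigma> continuous_driver_time_set[OF T] _ integrating_factor_zero _ t])
        show "continuous_on {0..<1} (\<lambda>t. Y t \<omega> - y)" by (intro continuous_intros c)
        fix t :: real assume t: "t \<in> {0..<1}"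
        have "integral {0..t} (\<lambda>r. h r * (y - Y r \<omega>)) = integral {0..t} (\<lambda>r. - (h r * (Y r \<omega> - y)))"
          by (simp add: algebra_simps)
        then show "Y t \<omega> - y = x - y - integral {0..t} (\<lambda>r. h r * (Y r \<omega> - y)) + W \<sigma> \<sigma>' t \<omega>"
          using J[OF t] \<open>Y 0 \<omega> = x\<close> by (simp add: integral_neg)
      qed
    qed
  qed
qed

end

section \<open>Conditional laws after adding an independent Gaussian variable\<close>

lemma set_integral_gauss_kernel:
  assumes "0 < \<tau>" "A \<in> sets borel"
  shows "ennreal (LINT v:A|lborel. gauss_kernel \<tau> (v - u)) = (\<integral>\<^sup>+ v. indicator A v * ennreal (gauss_kernel \<tau> (v - u)) \<partial>lborel)"
    "0 \<le> (LINT v:A|lborel. gauss_kernel \<tau> (v - u))" "(LINT v:A|lborel. gauss_kernel \<tau> (v - u)) \<le> 1"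
proof -
  have [measurable]: "A \<in> sets borel" by fact
  have pos: "0 \<le> indicator A v * gauss_kernel \<tau> (v - u)" for v by (simp add: gauss_kernel_pos less_imp_le)
  have le: "(\<integral>\<^sup>+ v. ennreal (indicator A v * gauss_kernel \<tau> (v - u)) \<partial>lborel) \<le> 1"
    unfolding nn_integral_gauss_kernel[OF assms(1), of u, symmetric]
    by (intro nn_integral_mono) (auto simp: gauss_kernel_pos less_imp_le split: split_indicator)
  have int: "integrable lborel (\<lambda>v. indicator A v * gauss_kernel \<tau> (v - u))"
    by (rule integrableI_nonneg) (use pos le in \<open>auto intro: le_less_trans\<close>)
  have eq: "ennreal (LINT v:A|lborel. gauss_kernel \<tau> (v - u)) = (\<integral>\<^sup>+ v. ennreal (indicator A v * gauss_kernel \<tau> (v - u)) \<partial>lborel)"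
    unfolding set_lebesgue_integral_def using nn_integral_eq_integral[OF int] pos by simp
  then show "ennreal (LINT v:A|lborel. gauss_kernel \<tau> (v - u)) = (\<integral>\<^sup>+ v. indicator A v * ennreal (gauss_kernel \<tau> (v - u)) \<partial>lborel)"
    by (auto intro!: nn_integral_cong split: split_indicator)
  show "0 \<le> (LINT v:A|lborel. gauss_kernel \<tau> (v - u))"
    unfolding set_lebesgue_integral_def by (intro integral_nonneg_AE) (use pos in auto)
  then show "(LINT v:A|lborel. gauss_kernel \<tau> (v - u)) \<le> 1"
    using le unfolding eq[symmetric] by (simp add: ennreal_le_1)
qed

lemma set_integral_gauss_kernel_measurable [measurable]:
  assumes [measurable]: "A \<in> sets borel"
  shows "(\<lambda>u. LINT v:A|lborel. gauss_kernel \<tau> (v - u)) \<in> borel_measurable borel"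
  unfolding set_lebesgue_integral_def by measurable

context prob_space
begin

text \<open>Freezing, with the indicator of \<open>C\<close> as part of the integrand. This form,
  free of conditional expectations, is the one that can be carried to path space, where
  \<open>C\<close> is the preimage of a path event.\<close>

lemma gauss_indep_set_integral:
  assumes G: "gauss_indep M \<F> G \<tau>" and sub: "subalgebra M \<F>" and \<tau>: "0 < \<tau>"
    and Y[measurable]: "Y \<in> borel_measurable \<F>" and A[measurable]: "A \<in> sets borel" and C[measurable]: "C \<in> sets \<F>"
  shows "(LINT \<omega>:C|M. indicator A (Y \<omega> + G \<omega>)) = (LINT \<omega>:C|M. (LINT v:A|lborel. gauss_kernel \<tau> (v - Y \<omega>)))"
proof -
  let ?k = "\<lambda>u. LINT v:A|lborel. gauss_kernel \<tau> (v - u)"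
  note k = set_integral_gauss_kernel[OF \<tau> A]
  have [measurable]: "Y \<in> borel_measurable M" "C \<in> events" "G \<in> borel_measurable M"
    using measurable_from_subalg[OF sub Y] C sub gauss_indep_measurable[OF G] by (auto simp: subalgebra_def)
  have shift: "(\<integral>\<^sup>+x. indicator A (u + x) * ennreal (normal_density 0 (sqrt \<tau>) x) \<partial>lborel) = ennreal (?k u)" for u
  proof -
    have "(\<integral>\<^sup>+v. indicator A v * ennreal (gauss_kernel \<tau> (v - u)) \<partial>lborel) =
        (\<integral>\<^sup>+x. indicator A (u + x) * ennreal (gauss_kernel \<tau> x) \<partial>lborel)"
      by (subst nn_integral_real_affine[of _ 1 u]) auto
    then show ?thesis by (simp add: k(1) normal_density_eq_gauss_kernel[OF \<tau>])
  qed
  have "(\<integral>\<^sup>+\<omega>. indicator C \<omega> * indicator A (Y \<omega> + G \<omega>) \<partial>M) =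
      (\<integral>\<^sup>+\<omega>. (\<integral>\<^sup>+x. indicator C \<omega> * indicator A (Y \<omega> + x) * ennreal (normal_density 0 (sqrt \<tau>) x) \<partial>lborel) \<partial>M)"
    using gauss_indep_nn_integral[OF G sub \<tau>, of "\<lambda>(\<omega>, x). indicator C \<omega> * indicator A (Y \<omega> + x)"] by simp
  also have "\<dots> = (\<integral>\<^sup>+\<omega>. indicator C \<omega> * ennreal (?k (Y \<omega>)) \<partial>M)"
    by (simp add: mult.assoc nn_integral_cmult shift)
  finally have nn: "(\<integral>\<^sup>+\<omega>. indicator C \<omega> * indicator A (Y \<omega> + G \<omega>) \<partial>M) = (\<integral>\<^sup>+\<omega>. indicator C \<omega> * ennreal (?k (Y \<omega>)) \<partial>M)" .
  have "(LINT \<omega>:C|M. (indicator A (Y \<omega> + G \<omega>) :: real)) = enn2real (\<integral>\<^sup>+\<omega>. indicator C \<omega> * indicator A (Y \<omega> + G \<omega>) \<partial>M)"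
    unfolding set_lebesgue_integral_def
    by (subst integral_eq_nn_integral) (auto intro!: arg_cong[where f=enn2real] nn_integral_cong split: split_indicator)
  also have "\<dots> = (LINT \<omega>:C|M. ?k (Y \<omega>))"
    unfolding nn set_lebesgue_integral_def[of M]
    by (subst integral_eq_nn_integral)
      (use k(2) in \<open>auto intro!: arg_cong[where f=enn2real] nn_integral_cong split: split_indicator\<close>)
  finally show ?thesis .
qed

lemma sigma_finite_subalgebraI: "subalgebra M \<F> \<Longrightarrow> sigma_finite_subalgebra M \<F>"
  by (rule finite_measure_subalgebra_is_sigma_finite)
    (simp add: finite_measure_subalgebra_def finite_measure_subalgebra_axioms_def finite_measure_axioms)

lemma gauss_indep_cond_exp:
  assumes G: "gauss_indep M \<F> G \<tau>" and sub: "subalgebra M \<F>" and \<tau>: "0 < \<tau>"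
    and Y: "Y \<in> borel_measurable \<F>" and A[measurable]: "A \<in> sets borel"
    and X: "X \<in> borel_measurable M" "AE \<omega> in M. X \<omega> = Y \<omega> + G \<omega>"
  shows "AE \<omega> in M. real_cond_exp M \<F> (\<lambda>\<omega>. indicator A (X \<omega>)) \<omega> = (LINT v:A|lborel. gauss_kernel \<tau> (v - Y \<omega>))"
proof (rule sigma_finite_subalgebra.real_cond_exp_charact[OF sigma_finite_subalgebraI[OF sub]])
  have [measurable]: "Y \<in> borel_measurable M" "G \<in> borel_measurable M" "X \<in> borel_measurable M"
    using measurable_from_subalg[OF sub Y] gauss_indep_measurable[OF G] X by auto
  fix C assume C: "C \<in> sets \<F>"
  then have [measurable]: "C \<in> events" using sub by (auto simp: subalgebra_def)
  have "(LINT \<omega>:C|M. indicator A (X \<omega>)) = (LINT \<omega>:C|M. (indicator A (Y \<omega> + G \<omega>) :: real))"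
    unfolding set_lebesgue_integral_def by (rule integral_cong_AE) (use X(2) in \<open>auto elim: eventually_mono\<close>)
  with gauss_indep_set_integral[OF G sub \<tau> Y A C]
  show "(LINT \<omega>:C|M. indicator A (X \<omega>)) = (LINT \<omega>:C|M. (LINT v:A|lborel. gauss_kernel \<tau> (v - Y \<omega>)))" by simp
next
  have [measurable]: "Y \<in> borel_measurable M" "X \<in> borel_measurable M"
    using measurable_from_subalg[OF sub Y] X by auto
  note k = set_integral_gauss_kernel[OF \<tau> A]
  show "integrable M (\<lambda>\<omega>. indicator A (X \<omega>) :: real)" by (intro integrable_const_bound[where B=1]) auto
  show "integrable M (\<lambda>\<omega>. LINT v:A|lborel. gauss_kernel \<tau> (v - Y \<omega>))"
    using k(2,3) by (intro integrable_const_bound[where B=1]) auto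
  show "(\<lambda>\<omega>. LINT v:A|lborel. gauss_kernel \<tau> (v - Y \<omega>)) \<in> borel_measurable \<F>"
    using Y by measurable
qed

end

section \<open>Bridge laws on path space\<close>

lemma measurable_natural_filtration:
  assumes "f \<in> space N \<rightarrow> \<Omega>" "\<And>s. s \<in> I \<Longrightarrow> s \<le> t \<Longrightarrow> (\<lambda>\<omega>. Y s (f \<omega>)) \<in> borel_measurable N"
  shows "f \<in> measurable N (natural_filtration \<Omega> I Y t)"
  unfolding natural_filtration_def
proof (rule measurable_measure_of)
  fix E assume "E \<in> {Y s -` A \<inter> \<Omega> |s A. s \<in> I \<and> s \<le> t \<and> A \<in> sets borel}"
  then obtain s A where E: "E = Y s -` A \<inter> \<Omega>" "s \<in> I" "s \<le> t" "A \<in> sets borel" by blast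
  have "f -` E \<inter> space N = (\<lambda>\<omega>. Y s (f \<omega>)) -` A \<inter> space N" using assms(1) E(1) by auto
  then show "f -` E \<inter> space N \<in> sets N" using measurable_sets[OF assms(2)[OF E(2,3)] E(4)] by simp
qed (use assms(1) in auto)

lemma measurable_coordinate_natural_filtration:
  assumes "s \<in> I" "s \<le> t"
  shows "Y s \<in> borel_measurable (natural_filtration \<Omega> I Y t)"
proof (rule measurableI)
  fix A :: "real set" assume "A \<in> sets borel"
  then have "Y s -` A \<inter> \<Omega> \<in> {Y s -` A \<inter> \<Omega> |s A. s \<in> I \<and> s \<le> t \<and> A \<in> sets borel}" using assms by blast
  then show "Y s -` A \<inter> space (natural_filtration \<Omega> I Y t) \<in> sets (natural_filtration \<Omega> I Y t)"
    unfolding natural_filtration_def by (subst sets_measure_of) (auto simp: space_measure_of_conv)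
qed simp

abbreviation path_filtration :: "real \<Rightarrow> (real \<Rightarrow> real) measure" where
  "path_filtration \<equiv> natural_filtration (space (PiM {0..<1} (\<lambda>_. borel))) {0..<1} (\<lambda>t w. w t)"

context prob_space
begin

lemma path_map_measurable:
  assumes "\<And>t. t \<in> {0..<1} \<Longrightarrow> Y t \<in> borel_measurable M"
  shows "(\<lambda>\<omega>. \<lambda>t\<in>{0..<1}. Y t \<omega>) \<in> measurable M (PiM {0..<1::real} (\<lambda>_. borel :: real measure))"
  using assms by (intro measurable_restrict) auto

lemma path_law_facts:
  assumes "\<forall>t\<in>{0..<1}. Y t \<in> borel_measurable M"
  shows "prob_space (path_law M Y)" "sets (path_law M Y) = sets (PiM {0..<1} (\<lambda>_. borel))"
    "space (path_law M Y) = space (PiM {0..<1} (\<lambda>_. borel))"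
    "t \<in> {0..<1} \<Longrightarrow> (\<lambda>w. w t) \<in> borel_measurable (path_law M Y)"
    "subalgebra (path_law M Y) (path_filtration t)"
proof -
  have Y: "Y t \<in> borel_measurable M" if "t \<in> {0..<1}" for t using assms that by blast
  show "prob_space (path_law M Y)" unfolding path_law_def by (rule prob_space_distr[OF path_map_measurable[OF Y]])
  show s: "sets (path_law M Y) = sets (PiM {0..<1} (\<lambda>_. borel))"
    and sp: "space (path_law M Y) = space (PiM {0..<1} (\<lambda>_. borel))" by (simp_all add: path_law_def)
  show c: "(\<lambda>w. w t) \<in> borel_measurable (path_law M Y)" if "t \<in> {0..<1}" for t
    using measurable_component_singleton[OF that, of "\<lambda>_. borel"] by (simp add: measurable_cong_sets[OF s refl])
  show "subalgebra (path_law M Y) (path_filtration t)"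
    by (rule subalgebra_natural_filtration[OF sp c])
qed

text \<open>Only time \<open>0\<close> matters here: conditioning on the constant initial value is no conditioning.\<close>

lemma bridge_law_marginal:
  assumes Y: "\<And>t. t \<in> {0..<1} \<Longrightarrow> Y t \<in> borel_measurable M"
    and L: "is_bridge_law p x y (path_law M Y)" and t: "0 < t" "t < 1"
  shows "distributed M lborel (Y t) (\<lambda>v. ennreal (bridge_density p y 0 x t v))"
proof -
  let ?L = "path_law M Y" and ?b = "bridge_density p y 0 x t"
  have YB: "\<forall>t\<in>{0..<1}. Y t \<in> borel_measurable M" using Y by blast
  note PL = path_law_facts[OF YB]
  have t01: "0 \<in> {0..<1::real}" "t \<in> {0..<1}" using t by auto
  have [measurable]: "Y t \<in> borel_measurable M" "(\<lambda>w. w t) \<in> borel_measurable ?L" using Y PL(4) t01 by auto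
  interpret L: prob_space ?L by (rule PL(1))
  have mp: "markov_process ?L path_filtration {0..<1} (bridge_density p y) (\<lambda>t w. w t)"
    and w0: "AE w in ?L. w 0 = x" using L[unfolded is_bridge_law_def PL(3)] by blast+
  have "(\<lambda>(u, v). bridge_density p y 0 u t v) \<in> borel_measurable (borel \<Otimes>\<^sub>M borel)"
    and pos: "\<And>v. 0 \<le> ?b v" and one: "(\<integral>\<^sup>+ v. ennreal (?b v) \<partial>lborel) = 1"
    using mp t t01 by (auto simp: markov_process_def transition_density_def)
  from measurable_compose[OF measurable_Pair1' this(1), of x]
  have [measurable]: "?b \<in> borel_measurable borel" by simp
  have "distr M lborel (Y t) = density lborel (\<lambda>v. ennreal (?b v))"
  proof (rule measure_eqI)
    fix A assume "A \<in> sets (distr M lborel (Y t))"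
    then have [measurable]: "A \<in> sets borel" by simp
    have le: "(\<integral>\<^sup>+ v. ennreal (indicator A v * ?b v) \<partial>lborel) \<le> 1"
      unfolding one[symmetric] by (intro nn_integral_mono) (auto simp: pos split: split_indicator)
    have int: "integrable lborel (\<lambda>v. indicator A v * ?b v)"
      by (rule integrableI_nonneg) (use pos le in \<open>auto intro: le_less_trans\<close>)
    have "AE w in ?L. real_cond_exp ?L (path_filtration 0) (\<lambda>w. indicator A (w t)) w = (LINT v:A|lborel. bridge_density p y 0 (w 0) t v)"
      using mp t t01 by (auto simp: markov_process_def)
    with w0 have "AE w in ?L. real_cond_exp ?L (path_filtration 0) (\<lambda>w. indicator A (w t)) w = (LINT v:A|lborel. ?b v)"
      by eventually_elim simp
    then have "(LINT w|?L. real_cond_exp ?L (path_filtration 0) (\<lambda>w. indicator A (w t)) w) = (LINT w|?L. (LINT v:A|lborel. ?b v))"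
      by (intro integral_cong_AE) auto
    also have "\<dots> = (LINT v:A|lborel. ?b v)" by simp (use L.prob_space in simp)
    also have "(LINT w|?L. real_cond_exp ?L (path_filtration 0) (\<lambda>w. indicator A (w t)) w) = (LINT w|?L. indicator A (w t))"
      by (rule sigma_finite_subalgebra.real_cond_exp_int(2)[OF L.sigma_finite_subalgebraI[OF PL(5)]])
        (intro L.integrable_const_bound[where B=1], auto)
    also have "\<dots> = (LINT \<omega>|M. indicator A (Y t \<omega>))"
      unfolding path_law_def using t01
      by (subst integral_distr[OF path_map_measurable[OF Y]])
        (auto simp: PL(2)[symmetric] intro!: measurable_compose[OF measurable_component_singleton])
    also have "\<dots> = prob (Y t -` A \<inter> space M)"
    proof -
      have "(LINT \<omega>|M. (indicator A (Y t \<omega>) :: real)) = (LINT \<omega>|M. indicator (Y t -` A \<inter> space M) \<omega>)"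
        by (intro Bochner_Integration.integral_cong) (auto split: split_indicator)
      then show ?thesis by simp
    qed
    finally have "prob (Y t -` A \<inter> space M) = (LINT v:A|lborel. ?b v)" .
    then have "emeasure (distr M lborel (Y t)) A = ennreal (LINT v|lborel. indicator A v * ?b v)"
      by (simp add: emeasure_distr emeasure_eq_measure set_lebesgue_integral_def)
    also have "\<dots> = (\<integral>\<^sup>+ v. ennreal (indicator A v * ?b v) \<partial>lborel)"
      using nn_integral_eq_integral[OF int] pos by simp
    also have "\<dots> = emeasure (density lborel (\<lambda>v. ennreal (?b v))) A"
      by (subst emeasure_density) (auto intro!: nn_integral_cong split: split_indicator)
    finally show "emeasure (distr M lborel (Y t)) A = emeasure (density lborel (\<lambda>v. ennreal (?b v))) A" .
  qed simp
  then show ?thesis by (simp add: distributed_def)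
qed

end

context gaussian_driver
begin

text \<open>The Markov property is asserted under the path law and for the filtration of the
  coordinates. It follows from the Gaussian regression on \<open>F s\<close> under \<open>M\<close>,
  because adaptedness puts the preimages of path events up to time \<open>s\<close> into
  \<open>F s\<close>.\<close>

lemma gauss_bridge_law:
  assumes V: "strict_mono_on {0..1} V"
    and XF: "\<And>t. t \<in> {0..<1} \<Longrightarrow> X t \<in> borel_measurable (F t)" and X0: "AE \<omega> in M. X 0 \<omega> = x"
    and X: "\<And>s t. 0 \<le> s \<Longrightarrow> s < t \<Longrightarrow> t < 1 \<Longrightarrow>
      \<exists>G. gauss_indep M (F s) G ((V t - V s) * (V 1 - V t) / (V 1 - V s)) \<and>
        (AE \<omega> in M. X t \<omega> = y + (V 1 - V t) / (V 1 - V s) * (X s \<omega> - y) + G \<omega>)"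
  shows "is_bridge_law (gauss_transition V) x y (path_law M X)"
proof -
  let ?L = "path_law M X" and ?\<Phi> = "\<lambda>\<omega>. \<lambda>t\<in>{0..<1}. X t \<omega>"
  have XM: "X t \<in> borel_measurable M" if "t \<in> {0..<1}" for t
    using measurable_from_subalg[OF subalgebra_F XF[OF that]] that by auto
  have XB: "\<forall>t\<in>{0..<1}. X t \<in> borel_measurable M" using XM by blast
  note PL = path_law_facts[OF XB]
  have \<Phi>: "?\<Phi> \<in> measurable M (PiM {0..<1} (\<lambda>_. borel))" using path_map_measurable XM .
  interpret L: prob_space ?L by (rule PL(1))
  have integral_L: "(LINT w|?L. f w) = (LINT \<omega>|M. f (?\<Phi> \<omega>))" if "f \<in> borel_measurable ?L" for f :: "_ \<Rightarrow> real"
    unfolding path_law_def using that measurable_cong_sets[OF PL(2) refl, of borel] by (intro integral_distr[OF \<Phi>]) blast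
  have w0: "AE w in ?L. w 0 = x"
    unfolding path_law_def using X0
    by (subst AE_distr_iff[OF \<Phi>]) (auto intro!: measurable_equality_set measurable_component_singleton)
  have "markov_process ?L path_filtration {0..<1} (bridge_density (gauss_transition V) y) (\<lambda>t w. w t)"
    unfolding markov_process_def
  proof (intro conjI ballI impI)
    show "transition_density {0..<1} (bridge_density (gauss_transition V) y)" by (rule transition_density_bridge_gauss[OF V])
    show "adapted path_filtration {0..<1} (\<lambda>t w. w t)"
      unfolding adapted_def by (auto intro: measurable_coordinate_natural_filtration)
    fix s t :: real and A :: "real set"
    assume st: "s \<in> {0..<1}" "t \<in> {0..<1}" "s < t" and A[measurable]: "A \<in> sets borel"
    define m where "m = (V 1 - V t) / (V 1 - V s)"
    define \<tau> where "\<tau> = (V t - V s) * (V 1 - V t) / (V 1 - V s)"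
    have "0 < V t - V s" "0 < V 1 - V t" "0 < V 1 - V s" using V st by (auto simp: strict_mono_on_def)
    then have \<tau>: "0 < \<tau>" by (simp add: \<tau>_def)
    obtain G where G: "gauss_indep M (F s) G \<tau>" "AE \<omega> in M. X t \<omega> = (y + m * (X s \<omega> - y)) + G \<omega>"
      using X[of s t] st by (auto simp: m_def \<tau>_def)
    have subF: "subalgebra M (F s)" using subalgebra_F st by auto
    let ?k = "\<lambda>u. LINT v:A|lborel. gauss_kernel \<tau> (v - (y + m * (u - y)))"
    have YF: "(\<lambda>\<omega>. y + m * (X s \<omega> - y)) \<in> borel_measurable (F s)" using XF[OF st(1)] by measurable
    have k_meas[measurable]: "?k \<in> borel_measurable borel" by measurable
    have k01: "0 \<le> ?k u" "?k u \<le> 1" for u using set_integral_gauss_kernel[OF \<tau> A] by auto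
    have ws: "(\<lambda>w. w s) \<in> borel_measurable ?L" "(\<lambda>w. w t) \<in> borel_measurable ?L" using PL(4) st by auto
    have wsF: "(\<lambda>w. w s) \<in> borel_measurable (path_filtration s)"
      by (rule measurable_coordinate_natural_filtration) (use st in auto)
    have "AE w in ?L. real_cond_exp ?L (path_filtration s) (\<lambda>w. indicator A (w t)) w = ?k (w s)"
    proof (rule sigma_finite_subalgebra.real_cond_exp_charact[OF L.sigma_finite_subalgebraI[OF PL(5)]])
      show "integrable ?L (\<lambda>w. indicator A (w t) :: real)"
        using ws by (intro L.integrable_const_bound[where B=1]) auto
      show "integrable ?L (\<lambda>w. ?k (w s))"
        using k01 measurable_compose[OF ws(1) k_meas] by (intro L.integrable_const_bound[where B=1]) auto
      show "(\<lambda>w. ?k (w s)) \<in> borel_measurable (path_filtration s)" using measurable_compose[OF wsF k_meas] .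
      fix D assume D: "D \<in> sets (path_filtration s)"
      then have DL[measurable]: "D \<in> sets ?L" using PL(5)[of s] by (auto simp: subalgebra_def)
      have "?\<Phi> \<in> measurable (F s) (path_filtration s)"
      proof (rule measurable_natural_filtration)
        show "?\<Phi> \<in> space (F s) \<rightarrow> space (PiM {0..<1} (\<lambda>_. borel))"
          by (auto simp: space_PiM)
        show "(\<lambda>\<omega>. ?\<Phi> \<omega> r) \<in> borel_measurable (F s)" if "r \<in> {0..<1}" "r \<le> s" for r
          using measurable_from_subalg[OF F_mono XF[OF that(1)], of s] that st by auto
      qed
      from measurable_sets[OF this D]
      have C: "?\<Phi> -` D \<inter> space M \<in> sets (F s)" using subF by (simp add: subalgebra_def)
      have "(LINT w:D|?L. indicator A (w t)) = (LINT \<omega>|M. indicator D (?\<Phi> \<omega>) * (indicator A (X t \<omega>) :: real))"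
        unfolding set_lebesgue_integral_def using st ws by (subst integral_L) auto
      also have "\<dots> = (LINT \<omega>:(?\<Phi> -` D \<inter> space M)|M. indicator A (X t \<omega>))"
        unfolding set_lebesgue_integral_def by (intro Bochner_Integration.integral_cong) (auto split: split_indicator)
      also have "\<dots> = (LINT \<omega>:(?\<Phi> -` D \<inter> space M)|M. (indicator A ((y + m * (X s \<omega> - y)) + G \<omega>) :: real))"
      proof -
        have [measurable]: "?\<Phi> -` D \<inter> space M \<in> events" "X t \<in> borel_measurable M" "X s \<in> borel_measurable M"
          "G \<in> borel_measurable M"
          using C subF XM st gauss_indep_measurable[OF G(1)] by (auto simp: subalgebra_def)
        show ?thesis unfolding set_lebesgue_integral_def
          by (rule integral_cong_AE) (use G(2) in \<open>auto elim: eventually_mono\<close>)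
      qed
      also have "\<dots> = (LINT \<omega>:(?\<Phi> -` D \<inter> space M)|M. ?k (X s \<omega>))"
        by (rule gauss_indep_set_integral[OF G(1) subF \<tau> YF A C])
      also have "\<dots> = (LINT \<omega>|M. indicator D (?\<Phi> \<omega>) * ?k (X s \<omega>))"
        unfolding set_lebesgue_integral_def[of M] by (intro Bochner_Integration.integral_cong) (auto split: split_indicator)
      also have "\<dots> = (LINT w:D|?L. ?k (w s))"
        unfolding set_lebesgue_integral_def[of ?L] using st measurable_compose[OF ws(1) k_meas]
        by (subst integral_L) auto
      finally show "(LINT w:D|?L. indicator A (w t)) = (LINT w:D|?L. ?k (w s))" .
    qed
    moreover have "bridge_density (gauss_transition V) y s u t v = gauss_kernel \<tau> (v - (y + m * (u - y)))" for u v
      unfolding m_def \<tau>_def using bridge_density_gauss[OF V, of s t] st by simp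
    ultimately show "AE w in ?L. real_cond_exp ?L (path_filtration s) (\<lambda>w. indicator A (w t)) w =
        (LINT v:A|lborel. bridge_density (gauss_transition V) y s (w s) t v)" by simp
  qed
  then show ?thesis using PL(1-3) w0 by (simp add: is_bridge_law_def)
qed

end

section \<open>Bridges of a diffusion have the stated drift\<close>

text \<open>This covers the one-sided derivative at 0 as well: a connected set with more than one
  point has no isolated points.\<close>

lemma has_real_derivative_unique_half_open:
  fixes f :: "real \<Rightarrow> real"
  assumes "t \<in> {0..<1}" "(f has_real_derivative a) (at t within {0..<1})" "(f has_real_derivative b) (at t within {0..<1})"
  shows "a = b"
proof (rule vector_derivative_unique_within)
  have "t islimpt {0..<1}"
  proof (rule connected_imp_perfect)
    show "{0..<1} \<noteq> {x}" for x :: real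
    proof
      assume "{0..<1} = {x}"
      then have "0 \<in> {x}" "1 / 2 \<in> {x}" by (simp_all flip: \<open>{0..<1} = {x}\<close>)
      then show False by simp
    qed
  qed (use assms in \<open>auto intro: convex_connected\<close>)
  then show "at t within {0..<1} \<noteq> bot" by (simp add: trivial_limit_within)
qed (use assms in \<open>simp_all add: has_real_derivative_iff_has_vector_derivative\<close>)

locale pinned_family = gaussian_driver +
  fixes B :: "real \<Rightarrow> 'a \<Rightarrow> real" and h \<sigma> \<sigma>' :: "real \<Rightarrow> real" and X :: "real \<Rightarrow> real \<Rightarrow> real \<Rightarrow> 'a \<Rightarrow> real"
  assumes adapted_B: "adapted F {0..1} B" and B_eq: "AE \<omega> in M. \<forall>t. B t \<omega> = \<beta> t \<omega>"
    and continuous_h: "continuous_on {0..<1} h" and C1_\<sigma>: "C1_deriv {0..<1} \<sigma> \<sigma>'"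
    and \<sigma>_pos: "\<And>t. t \<in> {0..<1} \<Longrightarrow> 0 < \<sigma> t"
    and solution: "\<And>x y. strong_solution M B {0..<1} (\<lambda>t z. h t * (y - z)) (\<lambda>t z. \<sigma> t) x (X x y)"
    and pinned: "\<And>x y. AE \<omega> in M. ((\<lambda>t. X x y t \<omega>) \<longlongrightarrow> y) (at_left 1)"
begin

definition V :: "real \<Rightarrow> real" where "V t = integral {0..t} (\<lambda>r. (\<sigma> r)\<^sup>2)"

abbreviation "e \<equiv> integrating_factor h"

definition g :: "real \<Rightarrow> real" where "g t = e t * \<sigma> t"

definition g' :: "real \<Rightarrow> real" where "g' t = h t * e t * \<sigma> t + \<sigma>' t * e t"

definition J :: "real \<Rightarrow> 'a \<Rightarrow> real" where "J t \<omega> = W g g' t \<omega>"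

definition v :: "real \<Rightarrow> real" where "v t = integral {0..t} (\<lambda>r. (g r)\<^sup>2)"

lemmas T = time_set_half_open

lemma C1_e: "C1_deriv {0..<1} e (\<lambda>t. h t * e t)"
  by (rule C1_deriv_integrating_factor[OF T continuous_h])

lemma C1_g: "C1_deriv {0..<1} g g'"
  unfolding g_def[abs_def] g'_def[abs_def] by (rule C1_deriv_mult[OF C1_e C1_\<sigma>])

lemma e_pos: "0 < e t" by (rule integrating_factor_pos)

lemma V_deriv: "t \<in> {0..<1} \<Longrightarrow> (V has_real_derivative (\<sigma> t)\<^sup>2) (at t within {0..<1})"
  unfolding V_def[abs_def]
  by (intro has_derivative_integral_time_set[OF T] continuous_intros C1_derivD(3)[OF C1_\<sigma>])

lemma v_deriv: "t \<in> {0..<1} \<Longrightarrow> (v has_real_derivative (g t)\<^sup>2) (at t within {0..<1})"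
  unfolding v_def[abs_def]
  by (intro has_derivative_integral_time_set[OF T] continuous_intros C1_derivD(3)[OF C1_g])

lemma V_zero: "V 0 = 0" and v_zero: "v 0 = 0"
  by (simp_all add: V_def v_def)

lemma V_strict_mono: "0 \<le> s \<Longrightarrow> s < t \<Longrightarrow> t < 1 \<Longrightarrow> V s < V t"
  unfolding V_def using \<sigma>_pos
  by (intro integral_time_set_strict_mono[OF T] continuous_intros C1_derivD(3)[OF C1_\<sigma>]) (auto simp: less_imp_neq[symmetric])

lemma v_strict_mono: "0 \<le> s \<Longrightarrow> s < t \<Longrightarrow> t < 1 \<Longrightarrow> v s < v t"
  unfolding v_def using \<sigma>_pos e_pos
  by (intro integral_time_set_strict_mono[OF T] continuous_intros C1_derivD(3)[OF C1_g])
    (auto simp: g_def less_imp_neq[symmetric])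

lemma J_zero: "J 0 \<omega> = 0" by (simp add: J_def W_zero)

lemma J_gauss: "0 \<le> s \<Longrightarrow> s \<le> t \<Longrightarrow> t < 1 \<Longrightarrow> gauss_indep M (F s) (\<lambda>\<omega>. J t \<omega> - J s \<omega>) (v t - v s)"
  unfolding J_def v_def by (rule W_gauss[OF T C1_g]) auto

lemma X_measurable: "t \<in> {0..<1} \<Longrightarrow> X x y t \<in> borel_measurable (F t)"
  by (rule strong_solution_adapted[OF adapted_B solution])

lemma X_measurable_M: "t \<in> {0..<1} \<Longrightarrow> X x y t \<in> borel_measurable M"
  using measurable_from_subalg[OF subalgebra_F X_measurable] by auto

lemma X_representation: "AE \<omega> in M. \<forall>t\<in>{0..<1}. e t * (X x y t \<omega> - y) = x - y + J t \<omega>"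
  using linear_sde_solution[OF adapted_B B_eq continuous_h C1_\<sigma> solution[of y x]]
  unfolding J_def g_def[abs_def] g'_def[abs_def] .

lemma X_marginal:
  assumes t: "0 < t" "t < 1"
  shows "distributed M lborel (X x y t) (\<lambda>z. ennreal (gauss_kernel (v t / (e t)\<^sup>2) (z - (y + (x - y) / e t))))"
proof -
  have v: "0 < v t" using v_strict_mono[of 0 t] t by (simp add: v_zero)
  have "gauss_indep M (F 0) (J t) (v t)" using J_gauss[of 0 t] t by (simp add: J_zero v_zero)
  from gauss_indep_distributed[OF this v]
  have "distributed M lborel (\<lambda>\<omega>. (y + (x - y) / e t) + 1 / e t * J t \<omega>)
      (normal_density ((y + (x - y) / e t) + 1 / e t * 0) (\<bar>1 / e t\<bar> * sqrt (v t)))"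
    using v e_pos[of t] by (intro normal_density_affine) auto
  moreover have "\<bar>1 / e t\<bar> * sqrt (v t) = sqrt (v t / (e t)\<^sup>2)"
    using e_pos[of t] by (simp add: real_sqrt_divide)
  ultimately have D: "distributed M lborel (\<lambda>\<omega>. (y + (x - y) / e t) + 1 / e t * J t \<omega>)
      (\<lambda>z. ennreal (gauss_kernel (v t / (e t)\<^sup>2) (z - (y + (x - y) / e t))))"
    using v e_pos[of t] by (simp add: normal_density_eq_gauss_kernel)
  have "AE \<omega> in M. X x y t \<omega> = (y + (x - y) / e t) + 1 / e t * J t \<omega>"
    using X_representation[of x y]
  proof eventually_elim
    fix \<omega> assume "\<forall>t\<in>{0..<1}. e t * (X x y t \<omega> - y) = x - y + J t \<omega>"
    then have "e t * (X x y t \<omega> - y) = x - y + J t \<omega>" using t by simp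
    then show "X x y t \<omega> = (y + (x - y) / e t) + 1 / e t * J t \<omega>"
      using e_pos[of t] by (simp add: field_simps)
  qed
  then have "distr M lborel (X x y t) = distr M lborel (\<lambda>\<omega>. (y + (x - y) / e t) + 1 / e t * J t \<omega>)"
    using D X_measurable_M[of t] t by (intro distr_cong_AE) (auto simp: distributed_def)
  then show ?thesis using D X_measurable_M[of t] t by (simp add: distributed_def)
qed

lemma e_at_left: "((\<lambda>t. 1 / e t) \<longlongrightarrow> 0) (at_left 1)"
proof -
  have "AE \<omega> in M. ((\<lambda>t. 1 / e t) \<longlongrightarrow> 0) (at_left 1)"
    using X_representation[of 0 0] X_representation[of 1 0] pinned[of 0 0] pinned[of 1 0]
  proof eventually_elim
    fix \<omega> assume R: "\<forall>t\<in>{0..<1}. e t * (X 0 0 t \<omega> - 0) = 0 - 0 + J t \<omega>" "\<forall>t\<in>{0..<1}. e t * (X 1 0 t \<omega> - 0) = 1 - 0 + J t \<omega>"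
      and L: "((\<lambda>t. X 0 0 t \<omega>) \<longlongrightarrow> 0) (at_left 1)" "((\<lambda>t. X 1 0 t \<omega>) \<longlongrightarrow> 0) (at_left 1)"
    have "((\<lambda>t. X 1 0 t \<omega> - X 0 0 t \<omega>) \<longlongrightarrow> 0) (at_left 1)" using tendsto_diff[OF L(2,1)] by simp
    moreover have "\<forall>\<^sub>F t in at_left 1. X 1 0 t \<omega> - X 0 0 t \<omega> = 1 / e t"
    proof (rule eventually_at_leftI[of 0])
      fix t :: real assume "t \<in> {0<..<1}"
      then have "e t * (X 1 0 t \<omega> - X 0 0 t \<omega>) = 1" using R by (simp add: right_diff_distrib)
      then show "X 1 0 t \<omega> - X 0 0 t \<omega> = 1 / e t" using e_pos[of t] by (simp add: field_simps)
    qed simp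
    ultimately show "((\<lambda>t. 1 / e t) \<longlongrightarrow> 0) (at_left 1)" by (rule Lim_transform_eventually)
  qed
  \<comment> \<open>The claim does not involve \<omega>, and the whole space is not a null
    set.\<close>
  then show ?thesis by simp
qed

text \<open>The right-hand side does not depend on \<open>t\<close>.\<close>

lemma bridge_cross_ratio:
  assumes p: "\<And>s u t w. 0 \<le> s \<Longrightarrow> s < t \<Longrightarrow> t \<le> 1 \<Longrightarrow> 0 < p s u t w"
    and L: "\<And>x y. is_bridge_law p x y (path_law M (X x y))" and t: "0 < t" "t < 1"
  shows "(e t - 1) / v t = ln (p 0 1 1 1 * p 0 0 1 0 / (p 0 1 1 0 * p 0 0 1 1))"
proof -
  let ?n = "\<lambda>x y z. gauss_kernel (v t / (e t)\<^sup>2) (z - (y + (x - y) / e t))"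
  have v: "0 < v t" using v_strict_mono[of 0 t] t by (simp add: v_zero)
  have "AE z in lborel. ennreal (?n x y z) = ennreal (bridge_density p y 0 x t z)" for x y
    by (rule distributed_unique[OF X_marginal[OF t] bridge_law_marginal[OF X_measurable_M L t]])
  then have *: "AE z in lborel. ?n x y z = bridge_density p y 0 x t z" for x y
  proof (rule AE_mp, intro AE_I2 impI)
    fix z assume "ennreal (?n x y z) = ennreal (bridge_density p y 0 x t z)"
    moreover have "0 < bridge_density p y 0 x t z" using p t by (simp add: bridge_density_def)
    ultimately show "?n x y z = bridge_density p y 0 x t z" by (simp add: gauss_kernel_pos less_imp_le)
  qed
  have nb: "ae_filter lborel \<noteq> (bot :: real filter)" by (simp add: ae_filter_eq_bot_iff)
  \<comment> \<open>The exceptional null set depends on \<open>x\<close> and \<open>y\<close>; as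
    the cross ratio does not depend on \<open>z\<close>, one point outside all four null sets is
    enough.\<close>
  have ae: "AE z in lborel. ?n 0 0 z = bridge_density p 0 0 0 t z \<and> ?n 1 1 z = bridge_density p 1 0 1 t z \<and>
      ?n 1 0 z = bridge_density p 0 0 1 t z \<and> ?n 0 1 z = bridge_density p 1 0 0 t z"
    using *[of 0 0] *[of 1 1] *[of 1 0] *[of 0 1] by eventually_elim simp
  obtain z where z: "?n 0 0 z = bridge_density p 0 0 0 t z" "?n 1 1 z = bridge_density p 1 0 1 t z"
      "?n 1 0 z = bridge_density p 0 0 1 t z" "?n 0 1 z = bridge_density p 1 0 0 t z"
    using eventually_happens'[OF nb ae] by (elim exE conjE)
  \<comment> \<open>Each factor \<open>p 0 x t z\<close> and each factor \<open>p t z 1 y\<close>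
    occurs once above and once below the line. The mixed pairs form the numerator because
    \<open>p 0 x 1 y\<close> stands in the denominator of the bridge density.\<close>
  have "p 0 1 1 1 * p 0 0 1 0 / (p 0 1 1 0 * p 0 0 1 1) = (?n 1 0 z * ?n 0 1 z) / (?n 0 0 z * ?n 1 1 z)"
    unfolding z bridge_density_def using p[of 0 t 0 z] p[of 0 t 1 z] p[of t 1 z 0] p[of t 1 z 1] p[of 0 1] t
    by (simp add: field_simps less_imp_neq[symmetric])
  then have "ln (p 0 1 1 1 * p 0 0 1 0 / (p 0 1 1 0 * p 0 0 1 1)) =
      ln (?n 1 0 z) + ln (?n 0 1 z) - ln (?n 0 0 z) - ln (?n 1 1 z)"
    using gauss_kernel_pos by (simp add: ln_mult ln_div less_imp_neq[symmetric])
  \<comment> \<open>All four kernels have the same variance, so their normalising terms cancel;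
    their means are \<open>0\<close>, \<open>1\<close>, \<open>1 / e t\<close> and
    \<open>1 - 1 / e t\<close>.\<close>
  also have "\<dots> = ((z\<^sup>2 + (z - 1)\<^sup>2) - (z - 1 / e t)\<^sup>2 - (z - (1 - 1 / e t))\<^sup>2) / (2 * (v t / (e t)\<^sup>2))"
    unfolding gauss_kernel_def by (simp add: diff_divide_distrib add_divide_distrib distrib_right left_diff_distrib)
  also have "(z\<^sup>2 + (z - 1)\<^sup>2) - (z - 1 / e t)\<^sup>2 - (z - (1 - 1 / e t))\<^sup>2 = 2 * (1 / e t - (1 / e t)\<^sup>2)"
    by (simp add: power2_eq_square algebra_simps)
  also have "\<dots> / (2 * (v t / (e t)\<^sup>2)) = (e t - 1) / v t"
    using e_pos[of t] v by (simp add: field_simps power2_eq_square)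
  finally show ?thesis ..
qed

lemma bridges_imp_condition:
  assumes p: "\<And>s u t w. 0 \<le> s \<Longrightarrow> s < t \<Longrightarrow> t \<le> 1 \<Longrightarrow> 0 < p s u t w"
    and L: "\<And>x y. is_bridge_law p x y (path_law M (X x y))"
  shows "\<exists>\<Sigma>. (V \<longlongrightarrow> \<Sigma>) (at_left 1) \<and> (\<forall>t\<in>{0..<1}. h t = (\<sigma> t)\<^sup>2 / (\<Sigma> - V t))"
proof -
  define \<kappa> where "\<kappa> = ln (p 0 1 1 1 * p 0 0 1 0 / (p 0 1 1 0 * p 0 0 1 1))"
  have ev: "e t - 1 - \<kappa> * v t = 0" if "t \<in> {0..<1}" for t
  proof (cases "t = 0")
    case True then show ?thesis by (simp add: integrating_factor_zero v_zero)
  next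
    case False
    then have "0 < t" "t < 1" using that by auto
    with bridge_cross_ratio[OF p L this] v_strict_mono[of 0 t] show ?thesis
      by (simp add: \<kappa>_def[symmetric] v_zero field_simps)
  qed
  have he: "h t = \<kappa> * e t * (\<sigma> t)\<^sup>2" if t: "t \<in> {0..<1}" for t
  proof -
    have "((\<lambda>t. e t - 1 - \<kappa> * v t) has_real_derivative h t * e t - 0 - \<kappa> * (g t)\<^sup>2) (at t within {0..<1})"
      by (intro DERIV_diff DERIV_cmult DERIV_const C1_derivD(1)[OF C1_e t] v_deriv[OF t])
    \<comment> \<open>By \<open>ev\<close> the function vanishes on the whole half-open interval, so
      its derivative computed termwise must be zero.\<close>
    moreover have "((\<lambda>t. e t - 1 - \<kappa> * v t) has_real_derivative 0) (at t within {0..<1})"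
      by (rule has_field_derivative_transform_within[OF DERIV_const zero_less_one t, of 0]) (simp add: ev)
    ultimately have "h t * e t - 0 - \<kappa> * (g t)\<^sup>2 = 0" by (rule has_real_derivative_unique_half_open[OF t])
    then have "e t * h t = e t * (\<kappa> * e t * (\<sigma> t)\<^sup>2)" by (simp add: g_def power2_eq_square algebra_simps)
    then show ?thesis using e_pos[of t] by simp
  qed
  have inv: "1 / e t = 1 - \<kappa> * V t" if t: "t \<in> {0..<1}" for t
  proof -
    \<comment> \<open>The derivative is \<open>\<kappa> * (\<sigma> t)\<^sup>2 - h t / e t\<close>,
      which vanishes by \<open>he\<close>.\<close>
    have "((\<lambda>t. 1 / e t + \<kappa> * V t) has_real_derivative 0) (at t within {0..<1})" if t: "t \<in> {0..<1}" for t
    proof -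
      have "((\<lambda>t. 1 / e t + \<kappa> * V t) has_real_derivative - (h t * e t) / (e t)\<^sup>2 + \<kappa> * (\<sigma> t)\<^sup>2) (at t within {0..<1})"
        using e_pos[of t] C1_derivD(1)[OF C1_e t] V_deriv[OF t]
        by (auto intro!: derivative_eq_intros simp: power2_eq_square)
      then show ?thesis using e_pos[of t] by (simp add: he[OF t] power2_eq_square)
    qed
    from zero_derivative_time_set[OF T this t] show ?thesis
      by (simp add: integrating_factor_zero V_zero)
  qed
  have "\<forall>\<^sub>F t in at_left 1. 1 - 1 / e t = \<kappa> * V t"
    by (rule eventually_at_leftI[of 0]) (use inv in auto)
  moreover have "((\<lambda>t. 1 - 1 / e t) \<longlongrightarrow> 1 - 0) (at_left 1)" by (intro tendsto_intros e_at_left)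
  ultimately have lim: "((\<lambda>t. \<kappa> * V t) \<longlongrightarrow> 1) (at_left 1)" by (simp add: Lim_transform_eventually)
  \<comment> \<open>If \<kappa> were zero, \<open>e\<close> would be constantly 1 and pinning
    impossible; here this appears as a zero function with limit 1.\<close>
  have "\<kappa> \<noteq> 0"
  proof
    assume "\<kappa> = 0"
    with lim have "((\<lambda>t::real. 0::real) \<longlongrightarrow> 1) (at_left 1)" by simp
    then show False by (simp add: tendsto_const_iff)
  qed
  show ?thesis
  proof (intro exI conjI ballI)
    show "(V \<longlongrightarrow> 1 / \<kappa>) (at_left 1)"
      using tendsto_divide[OF lim tendsto_const \<open>\<kappa> \<noteq> 0\<close>] \<open>\<kappa> \<noteq> 0\<close> by simp
    fix t :: real assume t: "t \<in> {0..<1}"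
    have "1 - \<kappa> * V t \<noteq> 0" "e t = 1 / (1 - \<kappa> * V t)"
      using inv[OF t] e_pos[of t] by (auto simp flip: inv[OF t])
    then have "h t = \<kappa> * (\<sigma> t)\<^sup>2 / (1 - \<kappa> * V t)" using he[OF t] by simp
    also have "\<dots> = (\<sigma> t)\<^sup>2 / (1 / \<kappa> - V t)"
      using \<open>\<kappa> \<noteq> 0\<close> \<open>1 - \<kappa> * V t \<noteq> 0\<close> by (simp add: field_simps)
    finally show "h t = (\<sigma> t)\<^sup>2 / (1 / \<kappa> - V t)" .
  qed
qed

end

section \<open>The stated drift gives the bridges of a Wiener integral\<close>

lemma (in prob_space) gauss_indep_abs:
  assumes G: "gauss_indep M \<F> G \<tau>" and "0 < \<tau>"
  shows "(\<integral>\<^sup>+\<omega>. ennreal \<bar>G \<omega>\<bar> \<partial>M) \<le> ennreal (sqrt \<tau>)"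
proof -
  have "(\<integral>\<^sup>+\<omega>. ennreal \<bar>G \<omega>\<bar> \<partial>M) = (\<integral>\<^sup>+x. ennreal (normal_density 0 (sqrt \<tau>) x) * ennreal \<bar>x\<bar> \<partial>lborel)"
    by (rule distributed_nn_integral[OF gauss_indep_distributed[OF assms], symmetric]) simp
  also have "\<dots> = (\<integral>\<^sup>+x. ennreal (normal_density 0 (sqrt \<tau>) x * \<bar>x\<bar>) \<partial>lborel)"
    by (simp add: ennreal_mult)
  also have "\<dots> = ennreal (sqrt \<tau> * sqrt (2 / pi))"
    using normal_moment_abs_odd[of "sqrt \<tau>" 0 0] \<open>0 < \<tau>\<close>
    by (subst nn_integral_eq_integral) (auto simp: has_bochner_integral_iff)
  also have "\<dots> \<le> ennreal (sqrt \<tau>)"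
  proof (rule ennreal_leI)
    have "sqrt (2 / pi) \<le> 1" using pi_ge_two by simp
    then show "sqrt \<tau> * sqrt (2 / pi) \<le> sqrt \<tau>"
      using mult_left_mono[of "sqrt (2 / pi)" 1 "sqrt \<tau>"] \<open>0 < \<tau>\<close> by simp
  qed
  finally show ?thesis .
qed

text \<open>Induction on the largest time \<open>b\<close>: \<open>d * Z u\<close> is
  \<open>d * Z b\<close> plus an increment after \<open>b\<close>, which is independent of all that
  precedes. The extra term \<open>d * Z u\<close> in the claim is what lets the induction hypothesis
  take up the new coefficient \<open>c b + d\<close>.\<close>

lemma (in gaussian_driver) gaussian_process_of_increments:
  assumes Z: "\<And>t. 0 \<le> t \<Longrightarrow> t \<le> 1 \<Longrightarrow> Z t \<in> borel_measurable (F t)" and Z0: "\<And>\<omega>. Z 0 \<omega> = 0"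
    and inc: "\<And>s t. 0 \<le> s \<Longrightarrow> s \<le> t \<Longrightarrow> t \<le> 1 \<Longrightarrow> gauss_indep M (F s) (\<lambda>\<omega>. Z t \<omega> - Z s \<omega>) (U t - U s)"
    and U: "\<And>s t. 0 \<le> s \<Longrightarrow> s \<le> t \<Longrightarrow> t \<le> 1 \<Longrightarrow> U s \<le> U t"
  shows "gaussian_process M {0..1} Z"
  unfolding gaussian_process_def
proof (intro conjI ballI allI impI)
  show "Z t \<in> borel_measurable M" if "t \<in> {0..1}" for t
    using measurable_from_subalg[OF subalgebra_F Z] that by auto
  have sum: "\<exists>w\<ge>0. gauss_indep M (F 0) (\<lambda>\<omega>. (\<Sum>t\<in>J. c t * Z t \<omega>) + d * Z u \<omega>) w"
    if "finite J" "\<forall>t\<in>J. 0 \<le> t \<and> t \<le> u" "0 \<le> u" "u \<le> 1" for J :: "real set" and c d u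
    using that
  proof (induction J arbitrary: u d rule: finite_linorder_max_induct)
    case empty
    have "gauss_indep M (F 0) (\<lambda>\<omega>. d * (Z u \<omega> - Z 0 \<omega>)) (d\<^sup>2 * (U u - U 0))"
      using empty by (intro gauss_indep_scale inc) auto
    then show ?case using U[of 0 u] empty by (intro exI[of _ "d\<^sup>2 * (U u - U 0)"]) (simp add: Z0)
  next
    case (insert b J)
    then have b: "0 \<le> b" "b \<le> u" "u \<le> 1" by auto
    have J: "\<forall>t\<in>J. 0 \<le> t \<and> t \<le> b" using insert by auto
    from insert.IH[OF J b(1), of "c b + d"] b obtain w where w: "0 \<le> w"
      "gauss_indep M (F 0) (\<lambda>\<omega>. (\<Sum>t\<in>J. c t * Z t \<omega>) + (c b + d) * Z b \<omega>) w" by auto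
    have ZF: "Z t \<in> borel_measurable (F b)" if "0 \<le> t" "t \<le> b" for t
      using measurable_from_subalg[OF F_mono Z, of t b] that b by auto
    have "gauss_indep M (F 0) (\<lambda>\<omega>. ((\<Sum>t\<in>J. c t * Z t \<omega>) + (c b + d) * Z b \<omega>) + d * (Z u \<omega> - Z b \<omega>))
        (w + d\<^sup>2 * (U u - U b))"
    proof (rule gauss_indep_add[OF w(2) gauss_indep_scale[OF inc[OF b]]])
      show "subalgebra (F b) (F 0)" using F_mono b by auto
      show "(\<lambda>\<omega>. (\<Sum>t\<in>J. c t * Z t \<omega>) + (c b + d) * Z b \<omega>) \<in> borel_measurable (F b)"
        using J b by (intro borel_measurable_add borel_measurable_sum borel_measurable_times borel_measurable_const ZF) auto
    qed
    moreover have "((\<Sum>t\<in>J. c t * Z t \<omega>) + (c b + d) * Z b \<omega>) + d * (Z u \<omega> - Z b \<omega>) =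
        (\<Sum>t\<in>insert b J. c t * Z t \<omega>) + d * Z u \<omega>" for \<omega>
      using insert.hyps by (subst sum.insert) (auto simp: algebra_simps)
    ultimately show ?case using w(1) U[OF b] by (intro exI[of _ "w + d\<^sup>2 * (U u - U b)"]) simp
  qed
  fix J :: "real set" and c :: "real \<Rightarrow> real" assume J: "finite J \<and> J \<subseteq> {0..1}"
  then obtain w where w: "0 \<le> w" "gauss_indep M (F 0) (\<lambda>\<omega>. \<Sum>t\<in>J. c t * Z t \<omega>) w"
    using sum[of J 1 c 0] by (auto simp: subset_iff)
  show "\<exists>m s. distr M borel (\<lambda>\<omega>. \<Sum>t\<in>J. c t * Z t \<omega>) = return borel m \<or>
      0 < s \<and> distributed M lborel (\<lambda>\<omega>. \<Sum>t\<in>J. c t * Z t \<omega>) (normal_density m s)"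
  proof (cases "w = 0")
    \<comment> \<open>Zero variance, as for the value at time 0, gives a point mass, which has no
      density.\<close>
    case True
    have "distr M borel (\<lambda>\<omega>. \<Sum>t\<in>J. c t * Z t \<omega>) = return borel 0"
    proof (rule Levy_uniqueness)
      show "real_distribution (distr M borel (\<lambda>\<omega>. \<Sum>t\<in>J. c t * Z t \<omega>))"
        using gauss_indep_measurable[OF w(2)] by (rule real_distribution_distr)
      show "real_distribution (return borel (0::real))"
        by (auto simp: real_distribution_def real_distribution_axioms_def prob_space_return)
      have "char (return borel (0::real)) u = 1" for u
        unfolding char_def by (subst integral_return) auto
      then show "char (distr M borel (\<lambda>\<omega>. \<Sum>t\<in>J. c t * Z t \<omega>)) = char (return borel 0)"
        using True by (intro ext) (simp add: gauss_indep_distr_char[OF w(2)])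
    qed
    then show ?thesis by blast
  next
    case False
    then show ?thesis using w gauss_indep_distributed[OF w(2)] by (intro exI[of _ 0] exI[of _ "sqrt w"]) auto
  qed
qed

locale bridge_family = pinned_family +
  fixes S :: real
  assumes V_tendsto: "(V \<longlongrightarrow> S) (at_left 1)"
    and h_eq: "\<And>t. t \<in> {0..<1} \<Longrightarrow> h t = (\<sigma> t)\<^sup>2 / (S - V t)"
begin

text \<open>Strictness makes the quotient in \<open>h_eq\<close> a genuine one, with positive
  denominator. The limit alone yields a weak inequality, so a time \<open>s\<close> after
  \<open>t\<close> is interposed.\<close>

lemma V_less: "t \<in> {0..<1} \<Longrightarrow> V t < S"
proof -
  assume t: "t \<in> {0..<1}"
  define s where "s = (t + 1) / 2"
  have s: "t < s" "s < 1" using t by (auto simp: s_def)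
  have "V s \<le> S"
  proof (rule tendsto_lowerbound[OF V_tendsto])
    show "\<forall>\<^sub>F r in at_left 1. V s \<le> V r"
    proof (rule eventually_at_leftI[of s])
      show "V s \<le> V r" if "r \<in> {s<..<1}" for r using V_strict_mono[of s r] that s t by auto
    qed (use s in simp)
  qed simp
  with V_strict_mono[of t s] s t show "V t < S" by auto
qed

lemma S_pos: "0 < S" using V_less[of 0] by (simp add: V_zero)

text \<open>At time 1 the limit is inserted by hand, because \<sigma> is controlled before time 1
  only.\<close>

definition VS :: "real \<Rightarrow> real" where "VS t = (if t < 1 then V t else S)"

lemma VS_strict_mono: "strict_mono_on {0..1} VS"
  using V_strict_mono V_less by (auto simp: strict_mono_on_def VS_def)

text \<open>\<open>h\<close> is the logarithmic derivative of \<open>1 / (S - V)\<close>.\<close>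

lemma e_eq: "t \<in> {0..<1} \<Longrightarrow> e t = S / (S - V t)"
proof -
  assume t: "t \<in> {0..<1}"
  have "((\<lambda>t. (S - V t) * e t) has_real_derivative 0) (at t within {0..<1})" if t: "t \<in> {0..<1}" for t
  proof -
    have "((\<lambda>t. (S - V t) * e t) has_real_derivative (0 - (\<sigma> t)\<^sup>2) * e t + h t * e t * (S - V t)) (at t within {0..<1})"
      by (intro DERIV_mult DERIV_diff DERIV_const C1_derivD(1)[OF C1_e t] V_deriv[OF t])
    then show ?thesis using V_less[OF t] by (simp add: h_eq[OF t])
  qed
  from zero_derivative_time_set[OF T this t] V_less[OF t] show "e t = S / (S - V t)"
    by (simp add: integrating_factor_zero V_zero field_simps)
qed

text \<open>The relation \<open>e - 1 = \<kappa> * v\<close> of the necessity part reappears with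
  \<open>\<kappa> = 1 / S\<close>.\<close>

lemma v_eq: "t \<in> {0..<1} \<Longrightarrow> v t = S * (e t - 1)"
proof -
  assume t: "t \<in> {0..<1}"
  have "((\<lambda>t. v t - S * (e t - 1)) has_real_derivative 0) (at t within {0..<1})" if t: "t \<in> {0..<1}" for t
  proof -
    have "((\<lambda>t. v t - S * (e t - 1)) has_real_derivative (g t)\<^sup>2 - S * (h t * e t - 0)) (at t within {0..<1})"
      by (intro DERIV_diff DERIV_cmult DERIV_const C1_derivD(1)[OF C1_e t] v_deriv[OF t])
    moreover have "(g t)\<^sup>2 - S * (h t * e t - 0) = 0"
      using V_less[OF t] by (simp add: g_def h_eq[OF t] e_eq[OF t] power2_eq_square)
    ultimately show ?thesis by simp
  qed
  from zero_derivative_time_set[OF T this t] show "v t = S * (e t - 1)"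
    by (simp add: integrating_factor_zero v_zero)
qed

text \<open>Subtracting \<open>X_representation\<close> at time \<open>s\<close> from that at time
  \<open>t\<close> expresses \<open>X x y t - y\<close> as \<open>e s / e t\<close> times
  \<open>X x y s - y\<close> plus an increment of \<open>J\<close> divided by \<open>e t\<close>.
  With \<open>e_eq\<close> and \<open>v_eq\<close>, the slope and the variance of the increment
  become those of \<open>bridge_density_gauss\<close>.\<close>

lemma bridge_law: "is_bridge_law (gauss_transition VS) x y (path_law M (X x y))"
proof (rule gauss_bridge_law[OF VS_strict_mono X_measurable])
  show "AE \<omega> in M. X x y 0 \<omega> = x" using solution[of y x] by (simp add: strong_solution_def)
  fix s t :: real assume st: "0 \<le> s" "s < t" "t < 1"
  then have st': "s \<in> {0..<1}" "t \<in> {0..<1}" by auto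
  have pos: "0 < S - V s" "0 < S - V t" using V_less st' by auto
  have "gauss_indep M (F s) (\<lambda>\<omega>. 1 / e t * (J t \<omega> - J s \<omega>)) ((1 / e t)\<^sup>2 * (v t - v s))"
    using st by (intro gauss_indep_scale J_gauss) auto
  moreover have "(1 / e t)\<^sup>2 * (v t - v s) = (VS t - VS s) * (VS 1 - VS t) / (VS 1 - VS s)"
  proof -
    have "v t - v s = S * (S / (S - V t) - S / (S - V s))"
      by (simp add: v_eq[OF st'(1)] v_eq[OF st'(2)] e_eq[OF st'(1)] e_eq[OF st'(2)] algebra_simps)
    also have "S / (S - V t) - S / (S - V s) = S * (V t - V s) / ((S - V t) * (S - V s))"
      using pos by (simp add: diff_frac_eq algebra_simps)
    finally have "(1 / e t)\<^sup>2 * (v t - v s) = ((S - V t) / S)\<^sup>2 * (S * (S * (V t - V s) / ((S - V t) * (S - V s))))"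
      by (simp add: e_eq[OF st'(2)])
    also have "\<dots> = (V t - V s) * (S - V t) / (S - V s)"
    proof -
      have "(a / S)\<^sup>2 * (S * (S * d / (a * b))) = d * a / b" if "0 < a" "0 < b" for a b d
        using that S_pos by (simp add: field_simps power2_eq_square)
      from this[OF pos(2,1)] show ?thesis .
    qed
    finally show ?thesis using st by (simp add: VS_def)
  qed
  moreover have "AE \<omega> in M. X x y t \<omega> = y + (VS 1 - VS t) / (VS 1 - VS s) * (X x y s \<omega> - y) + 1 / e t * (J t \<omega> - J s \<omega>)"
    using X_representation[of x y]
  proof eventually_elim
    fix \<omega> assume R: "\<forall>t\<in>{0..<1}. e t * (X x y t \<omega> - y) = x - y + J t \<omega>"
    have "J t \<omega> - J s \<omega> = e t * (X x y t \<omega> - y) - e s * (X x y s \<omega> - y)" using R st' by simp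
    then have "1 / e t * (J t \<omega> - J s \<omega>) = X x y t \<omega> - y - e s / e t * (X x y s \<omega> - y)"
      using e_pos[of t] by (simp add: diff_divide_distrib)
    moreover have "e s / e t = (VS 1 - VS t) / (VS 1 - VS s)"
      using pos st S_pos by (simp add: VS_def e_eq[OF st'(1)] e_eq[OF st'(2)])
    ultimately show "X x y t \<omega> = y + (VS 1 - VS t) / (VS 1 - VS s) * (X x y s \<omega> - y) + 1 / e t * (J t \<omega> - J s \<omega>)"
      by simp
  qed
  ultimately show "\<exists>G. gauss_indep M (F s) G ((VS t - VS s) * (VS 1 - VS t) / (VS 1 - VS s)) \<and>
      (AE \<omega> in M. X x y t \<omega> = y + (VS 1 - VS t) / (VS 1 - VS s) * (X x y s \<omega> - y) + G \<omega>)"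
    by (intro exI[of _ "\<lambda>\<omega>. 1 / e t * (J t \<omega> - J s \<omega>)"]) simp
qed

section \<open>Convergence at time 1 of the Wiener integral of \<sigma>\<close>

lemma J_continuous: "continuous_on {0..<1} (\<lambda>t. J t \<omega>)"
  unfolding J_def by (rule continuous_on_wiener_integral[OF T C1_g continuous_driver_time_set[OF T]])

lemma J_measurable: "t \<in> {0..<1} \<Longrightarrow> J t \<in> borel_measurable M"
  unfolding J_def[abs_def] by (rule W_measurable_M[OF T C1_g])

lemma J_abs: "r \<in> {0..<1} \<Longrightarrow> (\<integral>\<^sup>+\<omega>. ennreal \<bar>J r \<omega>\<bar> \<partial>M) \<le> ennreal (S / sqrt (S - V r))"
proof (cases "r = 0")
  case True then show ?thesis by (simp add: J_zero)
next
  case False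
  assume r: "r \<in> {0..<1}"
  have v: "0 < v r" using v_strict_mono[of 0 r] r False by (simp add: v_zero)
  have "gauss_indep M (F 0) (J r) (v r)" using J_gauss[of 0 r] r by (simp add: J_zero v_zero)
  from gauss_indep_abs[OF this v] have "(\<integral>\<^sup>+\<omega>. ennreal \<bar>J r \<omega>\<bar> \<partial>M) \<le> ennreal (sqrt (v r))" .
  also have "\<dots> \<le> ennreal (S / sqrt (S - V r))"
  proof (rule ennreal_leI)
    \<comment> \<open>Here \<open>v r\<close> equals
      \<open>S\<^sup>2 / (S - V r) - S\<close>.\<close>
    have "v r \<le> S\<^sup>2 / (S - V r)"
      using S_pos by (simp add: v_eq[OF r] e_eq[OF r] right_diff_distrib power2_eq_square)
    then have "sqrt (v r) \<le> sqrt (S\<^sup>2 / (S - V r))" by simp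
    then show "sqrt (v r) \<le> S / sqrt (S - V r)" using S_pos by (simp add: real_sqrt_divide)
  qed
  finally show ?thesis .
qed

text \<open>The integrand is the bound of \<open>J_abs\<close> times
  \<open>(\<sigma> r)\<^sup>2\<close>, the derivative of \<open>V\<close>. Its primitive
  \<open>- 2 * S * sqrt (S - V r)\<close> has a finite limit at time 1, even where the integrand
  itself is unbounded.\<close>

lemma dominating_function_integrable:
  "set_integrable lborel {0<..<1} (\<lambda>r. S * (\<sigma> r)\<^sup>2 / sqrt (S - V r))"
proof -
  let ?P = "\<lambda>r. - 2 * S * sqrt (S - V r)"
  have at: "at x within {0..<1} = at x" if "0 < x" "x < 1" for x :: real
    using that by (intro at_within_interior) (auto simp: interior_atLeastLessThan)
  have cV: "continuous_on {0..<1} V" by (rule DERIV_continuous_on[OF V_deriv])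
  have "set_integrable lborel (einterval (ereal 0) (ereal 1)) (\<lambda>r. S * (\<sigma> r)\<^sup>2 / sqrt (S - V r))"
  proof (rule interval_integral_FTC_nonneg(1))
    fix x assume "ereal 0 < ereal x" "ereal x < ereal 1"
    then have x: "0 < x" "x < 1" "x \<in> {0..<1}" by auto
    have V': "(V has_real_derivative (\<sigma> x)\<^sup>2) (at x)" using V_deriv[OF x(3)] at[OF x(1,2)] by simp
    show "DERIV ?P x :> S * (\<sigma> x)\<^sup>2 / sqrt (S - V x)"
      using V_less[OF x(3)] by (auto intro!: derivative_eq_intros V' simp: field_simps)
    have "isCont \<sigma> x" using C1_derivD(1)[OF C1_\<sigma> x(3)] at[OF x(1,2)] DERIV_isCont by fastforce
    then show "isCont (\<lambda>r. S * (\<sigma> r)\<^sup>2 / sqrt (S - V r)) x"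
      using V_less[OF x(3)] DERIV_isCont[OF V'] by (intro continuous_intros) auto
  next
    show "AE x in lborel. ereal 0 < ereal x \<longrightarrow> ereal x < ereal 1 \<longrightarrow> 0 \<le> S * (\<sigma> x)\<^sup>2 / sqrt (S - V x)"
      using S_pos V_less by (intro AE_I2) (auto intro!: divide_nonneg_nonneg simp: less_imp_le)
    have "(V \<longlongrightarrow> V 0) (at 0 within {0..<1})" using cV by (auto simp: continuous_on_def)
    then have "(V \<longlongrightarrow> V 0) (at 0 within {0..1/2})" by (rule tendsto_within_subset) auto
    then have "(V \<longlongrightarrow> 0) (at_right 0)" by (simp add: V_zero at_within_Icc_at_right)
    then show "((?P \<circ> real_of_ereal) \<longlongrightarrow> - 2 * S * sqrt (S - 0)) (at_right (ereal 0))"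
      unfolding ereal_tendsto_simps by (intro tendsto_intros)
    show "((?P \<circ> real_of_ereal) \<longlongrightarrow> - 2 * S * sqrt (S - S)) (at_left (ereal 1))"
      unfolding ereal_tendsto_simps by (intro tendsto_intros V_tendsto)
  qed simp
  then show ?thesis by simp
qed

text \<open>With \<open>a = 1 / e\<close>, integration by parts gives \<open>\<integral> \<sigma> d\<beta> = a J + S\<^sup>-\<^sup>1 \<integral> J \<sigma>\<^sup>2 dr\<close>.  The first term
  tends to \<open>0\<close> since \<open>X 0 0\<close> is pinned, and \<open>E |J r|\<close> is small enough for the second one to
  converge absolutely.\<close>

lemma W_\<sigma>_eq:
  assumes t: "t \<in> {0..<1}"
  shows "W \<sigma> \<sigma>' t \<omega> = 1 / e t * J t \<omega> + integral {0..t} (\<lambda>r. J r \<omega> * (\<sigma> r)\<^sup>2) / S"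
proof -
  let ?a' = "\<lambda>t. - (h t * e t) / (e t)\<^sup>2"
  have a: "C1_deriv {0..<1} (\<lambda>t. 1 / e t) ?a'"
  proof -
    have "((\<lambda>t. 1 / e t) has_real_derivative ?a' t) (at t within {0..<1})" if "t \<in> {0..<1}" for t
      using e_pos[of t] C1_derivD(1)[OF C1_e that] by (auto intro!: derivative_eq_intros simp: power2_eq_square)
    moreover have "continuous_on {0..<1} ?a'"
      using e_pos by (intro continuous_intros C1_derivD(2,3)[OF C1_e]) (auto simp: less_imp_neq[symmetric])
    ultimately show ?thesis by (simp add: C1_deriv_def)
  qed
  have "W (\<lambda>t. 1 / e t * g t) (\<lambda>t. ?a' t * g t + g' t * (1 / e t)) t \<omega> =
      1 / e t * J t \<omega> - integral {0..t} (\<lambda>r. J r \<omega> * ?a' r)"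
    unfolding J_def by (rule wiener_integral_mult[OF T a C1_g continuous_driver_time_set[OF T] t])
  \<comment> \<open>The factors \<open>1 / e\<close> and \<open>g = e * \<sigma>\<close> multiply to
    \<sigma>, so that \<open>wiener_integral_mult\<close> speaks about the integral of \<sigma>
    itself.\<close>
  moreover have "(\<lambda>t. 1 / e t * g t) = \<sigma>" using e_pos by (intro ext) (simp add: g_def less_imp_neq[symmetric])
  moreover have "(\<lambda>t. ?a' t * g t + g' t * (1 / e t)) = \<sigma>'"
    using e_pos by (intro ext) (simp add: g_def g'_def field_simps power2_eq_square less_imp_neq[symmetric])
  moreover have "integral {0..t} (\<lambda>r. J r \<omega> * ?a' r) = integral {0..t} (\<lambda>r. - (1 / S) * (J r \<omega> * (\<sigma> r)\<^sup>2))"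
  proof (rule integral_cong)
    fix r assume "r \<in> {0..t}"
    then have r: "r \<in> {0..<1}" using t by auto
    have "?a' r = - h r / e r" using e_pos[of r] by (simp add: power2_eq_square)
    \<comment> \<open>Since \<open>1 / e r\<close> is \<open>(S - V r) / S\<close>, the denominator
      of \<open>h r\<close> cancels.\<close>
    also have "\<dots> = - (1 / S) * (\<sigma> r)\<^sup>2" using V_less[OF r] S_pos by (simp add: h_eq[OF r] e_eq[OF r])
    finally show "J r \<omega> * ?a' r = - (1 / S) * (J r \<omega> * (\<sigma> r)\<^sup>2)" by simp
  qed
  ultimately show ?thesis by simp
qed

lemma W_\<sigma>_converges: "AE \<omega> in M. \<exists>l. ((\<lambda>t. W \<sigma> \<sigma>' t \<omega>) \<longlongrightarrow> l) (at_left 1)"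
proof -
  let ?K = "\<lambda>r \<omega>. J r \<omega> * (\<sigma> r)\<^sup>2"
  interpret P: pair_sigma_finite M lborel ..
  have K_cont: "continuous_on {0..<1} (\<lambda>r. ?K r \<omega>)" for \<omega>
    by (intro continuous_intros J_continuous C1_derivD(3)[OF C1_\<sigma>])
  have K[measurable]: "(\<lambda>(\<omega>, r). indicator {0..<1} r * ?K r \<omega>) \<in> borel_measurable (M \<Otimes>\<^sub>M borel)"
    using J_measurable K_cont by (intro borel_measurable_continuous_process borel_measurable_times) auto
  then have K'[measurable]: "(\<lambda>(\<omega>, r). ennreal \<bar>indicator {0..<1} r * ?K r \<omega>\<bar>) \<in> borel_measurable (M \<Otimes>\<^sub>M lborel)"
    by (simp add: case_prod_beta)
  \<comment> \<open>Tonelli turns the bound on the mean of \<open>\<bar>J r \<omega>\<bar>\<close>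
    into almost sure finiteness of the absolute integral up to time 1.\<close>
  have "(\<integral>\<^sup>+\<omega>. (\<integral>\<^sup>+r. ennreal \<bar>indicator {0..<1} r * ?K r \<omega>\<bar> \<partial>lborel) \<partial>M) =
      (\<integral>\<^sup>+r. (\<integral>\<^sup>+\<omega>. ennreal \<bar>indicator {0..<1} r * ?K r \<omega>\<bar> \<partial>M) \<partial>lborel)"
    by (rule P.Fubini'[symmetric]) (rule K')
  also have "\<dots> \<le> (\<integral>\<^sup>+r. ennreal (norm (indicator {0<..<1} r *\<^sub>R (S * (\<sigma> r)\<^sup>2 / sqrt (S - V r)))) \<partial>lborel)"
  proof (rule nn_integral_mono)
    fix r :: real
    show "(\<integral>\<^sup>+\<omega>. ennreal \<bar>indicator {0..<1} r * ?K r \<omega>\<bar> \<partial>M) \<le> ennreal (norm (indicator {0<..<1} r *\<^sub>R (S * (\<sigma> r)\<^sup>2 / sqrt (S - V r))))"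
    proof (cases "r \<in> {0<..<1}")
      case True
      then have r: "r \<in> {0..<1}" by auto
      have [measurable]: "J r \<in> borel_measurable M" using J_measurable[OF r] .
      have "(\<integral>\<^sup>+\<omega>. ennreal \<bar>indicator {0..<1} r * ?K r \<omega>\<bar> \<partial>M) = (\<integral>\<^sup>+\<omega>. ennreal ((\<sigma> r)\<^sup>2) * ennreal \<bar>J r \<omega>\<bar> \<partial>M)"
        using r by (intro nn_integral_cong) (simp add: abs_mult ennreal_mult mult.commute)
      also have "\<dots> = ennreal ((\<sigma> r)\<^sup>2) * (\<integral>\<^sup>+\<omega>. ennreal \<bar>J r \<omega>\<bar> \<partial>M)" by (intro nn_integral_cmult) simp
      also have "\<dots> \<le> ennreal ((\<sigma> r)\<^sup>2) * ennreal (S / sqrt (S - V r))" by (intro mult_left_mono J_abs[OF r]) simp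
      also have "\<dots> = ennreal (norm (indicator {0<..<1} r *\<^sub>R (S * (\<sigma> r)\<^sup>2 / sqrt (S - V r))))"
        using True S_pos V_less[OF r] by (simp add: ennreal_mult[symmetric] mult.commute)
      finally show ?thesis .
    next
      case False
      \<comment> \<open>The dominating function lives on the open interval; the point 0, which it
        misses, is harmless because \<open>J\<close> vanishes there.\<close>
      then have "r = 0 \<or> r \<notin> {0..<1}" by auto
      then show ?thesis by (auto simp: J_zero)
    qed
  qed
  also have "\<dots> < \<infinity>"
    using dominating_function_integrable unfolding set_integrable_def integrable_iff_bounded by blast
  finally have "(\<integral>\<^sup>+\<omega>. (\<integral>\<^sup>+r. ennreal \<bar>indicator {0..<1} r * ?K r \<omega>\<bar> \<partial>lborel) \<partial>M) \<noteq> \<infinity>" by simp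
  moreover have "(\<lambda>\<omega>. \<integral>\<^sup>+r. ennreal \<bar>indicator {0..<1} r * ?K r \<omega>\<bar> \<partial>lborel) \<in> borel_measurable M"
    using lborel.borel_measurable_nn_integral_fst[OF K'] by simp
  ultimately have "AE \<omega> in M. (\<integral>\<^sup>+r. ennreal \<bar>indicator {0..<1} r * ?K r \<omega>\<bar> \<partial>lborel) \<noteq> \<infinity>"
    by (intro nn_integral_PInf_AE) auto
  then show ?thesis
    using AE_space X_representation[of 0 0] pinned[of 0 0]
  proof eventually_elim
    fix \<omega> assume fin: "(\<integral>\<^sup>+r. ennreal \<bar>indicator {0..<1} r * ?K r \<omega>\<bar> \<partial>lborel) \<noteq> \<infinity>" and \<omega>: "\<omega> \<in> space M"
      and R: "\<forall>t\<in>{0..<1}. e t * (X 0 0 t \<omega> - 0) = 0 - 0 + J t \<omega>" and L: "((\<lambda>t. X 0 0 t \<omega>) \<longlongrightarrow> 0) (at_left 1)"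
    let ?f = "\<lambda>r. indicator {0..<1} r * ?K r \<omega>"
    have "?f \<in> borel_measurable lborel"
      using measurable_compose[OF measurable_Pair1'[OF \<omega>] K] by simp
    then have "integrable lborel ?f" using fin by (intro integrableI_bounded) (auto simp: top.not_eq_extremum)
    \<comment> \<open>Extended by zero, the integrand is integrable on the closed interval, so its
      indefinite integral is continuous up to time 1.\<close>
    then have "?f integrable_on {0..1}"
      using integrable_on_subinterval[OF integrable_on_lborel, of ?f 0 1] by simp
    then have "continuous_on {0..1} (\<lambda>t. integral {0..t} ?f)" by (rule indefinite_integral_continuous_1)
    then have "((\<lambda>t. integral {0..t} ?f) \<longlongrightarrow> integral {0..1} ?f) (at 1 within {0..1})"
      by (auto simp: continuous_on_def)
    then have "((\<lambda>t. integral {0..t} ?f) \<longlongrightarrow> integral {0..1} ?f) (at_left 1)"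
      by (simp add: at_within_Icc_at_left)
    from tendsto_add[OF L tendsto_divide[OF this tendsto_const, of S]] S_pos
    have "((\<lambda>t. X 0 0 t \<omega> + integral {0..t} ?f / S) \<longlongrightarrow> 0 + integral {0..1} ?f / S) (at_left 1)" by simp
    moreover have "\<forall>\<^sub>F t in at_left 1. X 0 0 t \<omega> + integral {0..t} ?f / S = W \<sigma> \<sigma>' t \<omega>"
    proof (rule eventually_at_leftI[of 0])
      fix t :: real assume "t \<in> {0<..<1}"
      then have t: "t \<in> {0..<1}" by auto
      have "integral {0..t} ?f = integral {0..t} (\<lambda>r. ?K r \<omega>)" using t by (intro integral_cong) auto
      moreover have "X 0 0 t \<omega> = 1 / e t * J t \<omega>" using R t e_pos[of t] by (auto simp: field_simps)
      ultimately show "X 0 0 t \<omega> + integral {0..t} ?f / S = W \<sigma> \<sigma>' t \<omega>" by (simp add: W_\<sigma>_eq[OF t])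
    qed simp
    ultimately show "\<exists>l. ((\<lambda>t. W \<sigma> \<sigma>' t \<omega>) \<longlongrightarrow> l) (at_left 1)" using Lim_transform_eventually by blast
  qed
qed

section \<open>The diffusion on the closed time interval\<close>

text \<open>On the null set where the Wiener integral diverges at time \<open>1\<close>, \<open>lim\<close> is arbitrary.\<close>

definition Z :: "real \<Rightarrow> 'a \<Rightarrow> real" where
  "Z t \<omega> = (if t < 1 then W \<sigma> \<sigma>' t \<omega> else lim (\<lambda>n. W \<sigma> \<sigma>' (uniform_subdivision 0 1 n n) \<omega>))"

text \<open>A sequence replaces the full left limit so that \<open>Z 1\<close> comes from countably
  many measurable functions.\<close>

lemma penultimate_point:
  "uniform_subdivision 0 1 n n \<in> {0..<1}" "(\<lambda>n. uniform_subdivision 0 1 n n) \<longlonglongrightarrow> 1"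
proof -
  have eq: "uniform_subdivision 0 1 n n = 1 - inverse (real (Suc n))" for n
    by (simp add: uniform_subdivision_def field_simps)
  have "0 < inverse (real (Suc n))" "inverse (real (Suc n)) \<le> 1" by (simp_all add: field_simps)
  then show "uniform_subdivision 0 1 n n \<in> {0..<1}" unfolding eq by auto
  have "(\<lambda>n. 1 - inverse (real (Suc n))) \<longlonglongrightarrow> 1 - 0"
    by (intro tendsto_diff tendsto_const LIMSEQ_inverse_real_of_nat)
  then show "(\<lambda>n. uniform_subdivision 0 1 n n) \<longlonglongrightarrow> 1" unfolding eq by simp
qed

lemma at_left_one_seq:
  assumes "(f \<longlongrightarrow> l) (at_left (1::real))"
  shows "(\<lambda>n. f (uniform_subdivision 0 1 n n)) \<longlonglongrightarrow> l"
proof (rule filterlim_compose[OF assms])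
  show "filterlim (\<lambda>n. uniform_subdivision 0 1 n n) (at_left 1) sequentially"
    unfolding filterlim_at using penultimate_point by (auto intro!: always_eventually simp: less_imp_neq)
qed

lemma Z_tendsto: "AE \<omega> in M. ((\<lambda>t. W \<sigma> \<sigma>' t \<omega>) \<longlongrightarrow> Z 1 \<omega>) (at_left 1)"
  using W_\<sigma>_converges
proof eventually_elim
  fix \<omega> assume "\<exists>l. ((\<lambda>t. W \<sigma> \<sigma>' t \<omega>) \<longlongrightarrow> l) (at_left 1)"
  then obtain l where l: "((\<lambda>t. W \<sigma> \<sigma>' t \<omega>) \<longlongrightarrow> l) (at_left 1)" ..
  from limI[OF at_left_one_seq[OF l]] show "((\<lambda>t. W \<sigma> \<sigma>' t \<omega>) \<longlongrightarrow> Z 1 \<omega>) (at_left 1)"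
    using l by (simp add: Z_def)
qed

lemma W_\<sigma>_continuous: "continuous_on {0..<1} (\<lambda>t. W \<sigma> \<sigma>' t \<omega>)"
  by (rule continuous_on_wiener_integral[OF T C1_\<sigma> continuous_driver_time_set[OF T]])

lemma Z_continuous: "AE \<omega> in M. continuous_on {0..1} (\<lambda>t. Z t \<omega>)"
  using Z_tendsto
proof eventually_elim
  fix \<omega> assume lim: "((\<lambda>t. W \<sigma> \<sigma>' t \<omega>) \<longlongrightarrow> Z 1 \<omega>) (at_left 1)"
  show "continuous_on {0..1} (\<lambda>t. Z t \<omega>)"
    unfolding continuous_on_def
  proof
    fix t :: real assume t: "t \<in> {0..1}"
    show "((\<lambda>t. Z t \<omega>) \<longlongrightarrow> Z t \<omega>) (at t within {0..1})"
    proof (cases "t = 1")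
      case True
      have "\<forall>\<^sub>F r in at_left 1. W \<sigma> \<sigma>' r \<omega> = Z r \<omega>"
        by (rule eventually_at_leftI[of 0]) (auto simp: Z_def)
      from Lim_transform_eventually[OF lim this] True show ?thesis by (simp add: at_within_Icc_at_left)
    next
      case False
      then have t': "t \<in> {0..<1}" using t by auto
      have "((\<lambda>t. W \<sigma> \<sigma>' t \<omega>) \<longlongrightarrow> W \<sigma> \<sigma>' t \<omega>) (at t within {0..<1})"
        using W_\<sigma>_continuous t' by (auto simp: continuous_on_def)
      moreover have "\<forall>\<^sub>F r in at t within {0..<1}. W \<sigma> \<sigma>' r \<omega> = Z r \<omega>"
        by (auto simp: eventually_at_filter Z_def)
      ultimately have "((\<lambda>t. Z t \<omega>) \<longlongrightarrow> Z t \<omega>) (at t within {0..<1})"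
        using t' by (simp add: Z_def Lim_transform_eventually)
      moreover have "at t within {0..1} = at t within {0..<1}"
        by (rule at_within_nhd[of _ "{..<1}"]) (use t' in auto)
      ultimately show ?thesis by simp
    qed
  qed
qed

lemma Z_measurable:
  assumes "0 \<le> t" "t \<le> 1"
  shows "Z t \<in> borel_measurable (F t)"
proof (cases "t < 1")
  case True
  then show ?thesis using W_measurable[OF T C1_\<sigma>, of t] assms by (simp add: Z_def[abs_def])
next
  case False
  have "W \<sigma> \<sigma>' (uniform_subdivision 0 1 n n) \<in> borel_measurable (F 1)" for n
    using measurable_from_subalg[OF F_mono W_measurable[OF T C1_\<sigma> penultimate_point(1)[of n]]] penultimate_point(1)[of n]
    by auto
  \<comment> \<open>\<open>lim\<close> of a sequence of measurable functions is measurable whether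
    or not the sequence converges.\<close>
  then show ?thesis using False assms by (simp add: Z_def[abs_def] borel_measurable_lim_metric)
qed

lemma Z_measurable_M: "0 \<le> t \<Longrightarrow> t \<le> 1 \<Longrightarrow> Z t \<in> borel_measurable M"
  using measurable_from_subalg[OF subalgebra_F Z_measurable] .

lemma Z_zero: "Z 0 \<omega> = 0" by (simp add: Z_def W_zero)

lemma Z_gauss:
  assumes "0 \<le> s" "s \<le> t" "t \<le> 1"
  shows "gauss_indep M (F s) (\<lambda>\<omega>. Z t \<omega> - Z s \<omega>) (VS t - VS s)"
proof -
  consider "t < 1" | "s = 1" "t = 1" | "s < 1" "t = 1" using assms by linarith
  then show ?thesis
  proof cases
    case 1
    then show ?thesis using W_gauss[OF T C1_\<sigma>, of t s] assms by (simp add: Z_def VS_def V_def)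
  next
    case 2
    then show ?thesis by (simp add: gauss_indep_zero)
  next
    case 3
    \<comment> \<open>The maximum keeps the approximating times from falling below \<open>s\<close>,
      as increments from \<open>s\<close> require.\<close>
    define r where "r n = max s (uniform_subdivision 0 1 n n)" for n
    have r: "s \<le> r n" "r n < 1" for n using 3 penultimate_point(1)[of n] by (auto simp: r_def)
    have lim: "filterlim r (at_left 1) sequentially"
    proof -
      have "r \<longlonglongrightarrow> max s 1" unfolding r_def by (intro tendsto_max tendsto_const penultimate_point)
      then show ?thesis using r 3 unfolding filterlim_at by (auto intro!: always_eventually simp: less_imp_neq)
    qed
    have "gauss_indep M (F s) (\<lambda>\<omega>. Z 1 \<omega> - Z s \<omega>) (S - V s)"
    proof (rule gauss_indep_LIMSEQ[OF prob_space_axioms])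
      show "gauss_indep M (F s) (\<lambda>\<omega>. W \<sigma> \<sigma>' (r n) \<omega> - W \<sigma> \<sigma>' s \<omega>) (V (r n) - V s)" for n
        unfolding V_def using r assms by (intro W_gauss[OF T C1_\<sigma>]) (auto intro: order_trans)
      show "subalgebra M (F s)" using subalgebra_F assms by auto
      show "(\<lambda>\<omega>. Z 1 \<omega> - Z s \<omega>) \<in> borel_measurable M" using assms by (intro borel_measurable_diff Z_measurable_M) auto
      show "AE \<omega> in M. (\<lambda>n. W \<sigma> \<sigma>' (r n) \<omega> - W \<sigma> \<sigma>' s \<omega>) \<longlonglongrightarrow> Z 1 \<omega> - Z s \<omega>"
        using Z_tendsto
      proof eventually_elim
        fix \<omega> assume "((\<lambda>t. W \<sigma> \<sigma>' t \<omega>) \<longlongrightarrow> Z 1 \<omega>) (at_left 1)"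
        from filterlim_compose[OF this lim]
        show "(\<lambda>n. W \<sigma> \<sigma>' (r n) \<omega> - W \<sigma> \<sigma>' s \<omega>) \<longlonglongrightarrow> Z 1 \<omega> - Z s \<omega>"
          using 3 by (intro tendsto_diff) (simp_all add: Z_def)
      qed
      show "(\<lambda>n. V (r n) - V s) \<longlonglongrightarrow> S - V s"
        by (intro tendsto_diff tendsto_const filterlim_compose[OF V_tendsto lim])
    qed
    then show ?thesis using 3 by (simp add: VS_def)
  qed
qed

lemma Z_markov: "markov_process M F {0..1} (gauss_transition VS) Z"
  unfolding markov_process_def
proof (intro conjI ballI impI)
  show "transition_density {0..1} (gauss_transition VS)" by (rule transition_density_gauss[OF VS_strict_mono])
  show "adapted F {0..1} Z" using Z_measurable by (simp add: adapted_def)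
  fix s t :: real and A :: "real set" assume st: "s \<in> {0..1}" "t \<in> {0..1}" "s < t" and A: "A \<in> sets borel"
  have "0 < VS t - VS s" using VS_strict_mono st by (auto simp: strict_mono_on_def)
  moreover have "gauss_indep M (F s) (\<lambda>\<omega>. Z t \<omega> - Z s \<omega>) (VS t - VS s)" using Z_gauss st by auto
  moreover have "subalgebra M (F s)" "Z s \<in> borel_measurable (F s)" "Z t \<in> borel_measurable M"
    using subalgebra_F Z_measurable Z_measurable_M st by auto
  ultimately show "AE \<omega> in M. real_cond_exp M (F s) (\<lambda>\<omega>. indicator A (Z t \<omega>)) \<omega> =
      (LINT v:A|lborel. gauss_transition VS s (Z s \<omega>) t v)"
    unfolding gauss_transition_def using A by (intro gauss_indep_cond_exp) auto
qed

lemma Z_gaussian: "gaussian_process M {0..1} Z"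
  by (rule gaussian_process_of_increments[OF Z_measurable Z_zero Z_gauss])
    (use VS_strict_mono in \<open>auto simp: strict_mono_on_def le_less\<close>)

text \<open>The values at time \<open>1\<close> were fixed by continuity, so they are the expected ones when \<open>\<sigma>\<close> extends.\<close>

lemma extension_to_time_set:
  assumes T': "time_set T'" "C1_deriv T' \<sigma> \<sigma>'"
  shows "t \<in> T' \<Longrightarrow> VS t = integral {0..t} (\<lambda>r. (\<sigma> r)\<^sup>2)"
    "AE \<omega> in M. \<forall>t\<in>T'. Z t \<omega> = W \<sigma> \<sigma>' t \<omega>"
proof -
  have left_limit: "f 1 = l" if "T' = {0..1}" "continuous_on T' f" "(f \<longlongrightarrow> l) (at_left 1)" for f :: "real \<Rightarrow> real" and l
  proof -
    have "(f \<longlongrightarrow> f 1) (at 1 within {0..1})" using that(1,2) by (auto simp: continuous_on_def)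
    then have "(f \<longlongrightarrow> f 1) (at_left 1)" by (simp add: at_within_Icc_at_left)
    from tendsto_unique[OF _ this that(3)] show ?thesis by simp
  qed
  have closed: "T' = {0..1} \<and> t = 1" if "t \<in> T'" "\<not> t < 1" for t
    using T'(1) that by (auto simp: time_set_def)
  show "VS t = integral {0..t} (\<lambda>r. (\<sigma> r)\<^sup>2)" if t: "t \<in> T'" for t
  proof (cases "t < 1")
    case False
    have "continuous_on T' V" unfolding V_def[abs_def]
      by (rule DERIV_continuous_on[OF has_derivative_integral_time_set[OF T'(1)]])
        (intro continuous_intros C1_derivD(3)[OF T'(2)])
    with left_limit[OF _ _ V_tendsto] closed[OF t False] show ?thesis by (simp add: VS_def V_def)
  qed (simp add: VS_def V_def)
  show "AE \<omega> in M. \<forall>t\<in>T'. Z t \<omega> = W \<sigma> \<sigma>' t \<omega>"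
    using Z_tendsto
  proof eventually_elim
    fix \<omega> assume lim: "((\<lambda>t. W \<sigma> \<sigma>' t \<omega>) \<longlongrightarrow> Z 1 \<omega>) (at_left 1)"
    show "\<forall>t\<in>T'. Z t \<omega> = W \<sigma> \<sigma>' t \<omega>"
    proof
      fix t assume t: "t \<in> T'"
      show "Z t \<omega> = W \<sigma> \<sigma>' t \<omega>"
      proof (cases "t < 1")
        case False
        have "continuous_on T' (\<lambda>t. W \<sigma> \<sigma>' t \<omega>)"
          by (rule continuous_on_wiener_integral[OF T' continuous_driver_time_set[OF T'(1)]])
        with left_limit[OF _ _ lim] closed[OF t False] show ?thesis by simp
      qed (simp add: Z_def)
    qed
  qed
qed

lemma Z_regular:
  assumes BM: "brownian_motion M F B" and T': "time_set T'" "C1_deriv T' \<sigma> \<sigma>'" and pos: "\<And>t. t \<in> T' \<Longrightarrow> 0 < \<sigma> t"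
  shows "regular_ito_diffusion T' M F B (\<lambda>t z. 0) (\<lambda>t z. \<sigma> t) (gauss_transition VS) Z"
proof -
  note ext = extension_to_time_set[OF T']
  have T01: "0 \<le> t" "t \<le> 1" if "t \<in> T'" for t using time_set(2,3)[OF T'(1) that] .
  have BM': "B t \<in> borel_measurable M" if "0 \<le> t" "t \<le> 1" for t
    using adapted_B that measurable_from_subalg[OF subalgebra_F, of t "B t"] by (simp add: adapted_def)
  have "is_ito_integral M B T' (\<lambda>t \<omega>. \<sigma> t) Z"
  proof (rule W_ito_integral[OF T' _ BM' Z_measurable_M])
    show "AE \<omega> in M. \<forall>t\<in>{0..1}. B t \<omega> = \<beta> t \<omega>" using B_eq by (auto elim: eventually_mono)
    show "AE \<omega> in M. Z t \<omega> = W \<sigma> \<sigma>' t \<omega>" if "t \<in> T'" for t using ext(2) that by (auto elim: eventually_mono)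
  qed (use T01 in auto)
  then have sde: "sde_solution M F B T' (\<lambda>t z. 0) (\<lambda>t z. \<sigma> t) Z"
    using Z_measurable T01 Z_continuous continuous_on_subset[OF _ time_set(8)[OF T'(1)]]
    by (auto simp: sde_solution_def adapted_def Z_zero elim!: eventually_mono)
  \<comment> \<open>\<open>VS\<close> is defined by cases, but on \<open>T'\<close> it coincides
    with the integral and inherits its derivative, also at time 1 if that belongs to
    \<open>T'\<close>.\<close>
  have dV: "(VS has_real_derivative (\<sigma> t)\<^sup>2) (at t within T')" if t: "t \<in> T'" for t
    by (rule has_field_derivative_transform_within[OF has_derivative_integral_time_set[OF T'(1) _ t] zero_less_one t])
      (auto simp: ext(1) intro!: continuous_intros C1_derivD(3)[OF T'(2)])
  have "C1_deriv T' (\<lambda>t. (\<sigma> t)\<^sup>2) (\<lambda>t. \<sigma>' t * \<sigma> t + \<sigma>' t * \<sigma> t)"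
    using C1_deriv_mult[OF T'(2) T'(2)] by (simp add: power2_eq_square)
  note reg = gauss_transition_regular[OF T'(1) VS_strict_mono dV this]
  have "C12_on T' (\<lambda>t z. 0)"
    by (rule C12_on_time_function[of _ "\<lambda>_. 0" "\<lambda>_. 0"]) (simp add: C1_deriv_def)
  then show ?thesis
    unfolding regular_ito_diffusion_def
    using usual BM Z_continuous sde C12_on_time_function[OF T'(2)] pos Z_markov reg by (intro conjI ballI allI) simp_all
qed

end

text \<open>A formula cannot quantify over the type of the underlying space. Hence the equivalence
  speaks of diffusions on spaces of type \<open>'a\<close>, and the second conjunct frees the
  necessity from this choice. The third keeps the given space and the given \<open>B\<close>, which
  is more than existence, and reaches the closed interval when \<sigma> does.\<close>

theorem theorem3p5:
  fixes M :: "'a measure" and F :: "real \<Rightarrow> 'a measure" and B :: "real \<Rightarrow> 'a \<Rightarrow> real"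
    and h \<sigma> :: "real \<Rightarrow> real"
    and X :: "real \<Rightarrow> real \<Rightarrow> real \<Rightarrow> 'a \<Rightarrow> real"
  defines "V \<equiv> (\<lambda>t. integral {0..t} (\<lambda>r. (\<sigma> r)\<^sup>2))"
  defines "cond \<equiv> (\<exists>\<Sigma>. (V \<longlongrightarrow> \<Sigma>) (at_left 1) \<and> (\<forall>t\<in>{0..<1}. h t = (\<sigma> t)\<^sup>2 / (\<Sigma> - V t)))"
  assumes "usual_filtered_space M F" and "brownian_motion M F B"
    and "C1_on {0..<1} h" and "C1_on {0..<1} \<sigma>" and "\<And>t. t \<in> {0..<1} \<Longrightarrow> 0 < \<sigma> t"
    and solution: "\<And>x y. strong_solution M B {0..<1} (\<lambda>t z. h t * (y - z)) (\<lambda>t z. \<sigma> t) x (X x y)"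
    and pinned: "\<And>x y. AE \<omega> in M. ((\<lambda>t. X x y t \<omega>) \<longlongrightarrow> y) (at_left 1)"
  shows
    "((\<exists>(N :: 'a measure) G W b \<rho> p Z.
         regular_ito_diffusion {0..<1} N G W b \<rho> p Z \<and> corresponds_to_bridges M X p) \<longleftrightarrow> cond) \<and>
     ((\<exists>(N :: 'b measure) G W b \<rho> p Z.
         regular_ito_diffusion {0..<1} N G W b \<rho> p Z \<and> corresponds_to_bridges M X p) \<longrightarrow> cond) \<and>
     (cond \<longrightarrow> (\<forall>T. T = {0..<1} \<or> T = {0..1} \<and> C1_on {0..1} \<sigma> \<and> 0 < \<sigma> 1 \<longrightarrow>
         (\<exists>p Z. regular_ito_diffusion T M F B (\<lambda>t z. 0) (\<lambda>t z. \<sigma> t) p Z \<and>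
                corresponds_to_bridges M X p \<and> gaussian_process M {0..1} Z)))"
proof -
  obtain \<beta> where "gaussian_driver M F \<beta>" and B_eq: "AE \<omega> in M. \<forall>t. B t \<omega> = \<beta> t \<omega>"
    using gaussian_driver_exists[OF assms(3,4)] by blast
  then interpret gaussian_driver M F \<beta> by simp
  have adapted: "adapted F {0..1} B" using assms(4) by (simp add: brownian_motion_def)
  have h: "continuous_on {0..<1} h" using assms(5) by (auto simp: C1_on_iff_deriv intro: C1_derivD(3))
  \<comment> \<open>Kept general in the derivative, since the derivative of \<sigma> obtained over
    \<open>T\<close> is another witness than the one fixed over \<open>{0..<1}\<close>.\<close>
  have family: "pinned_family M F \<beta> B h \<sigma> \<sigma>' X" if "C1_deriv {0..<1} \<sigma> \<sigma>'" for \<sigma>'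
    by unfold_locales (use adapted B_eq h that assms(7) solution pinned in auto)
  obtain \<sigma>' where \<sigma>': "C1_deriv {0..<1} \<sigma> \<sigma>'" using assms(6) by (auto simp: C1_on_iff_deriv)
  then interpret P: pinned_family M F \<beta> B h \<sigma> \<sigma>' X by (rule family)
  have V_eq: "P.V = V" by (simp add: fun_eq_iff P.V_def V_def)
  have necessary: cond
    if pos: "\<And>s u t w. 0 \<le> s \<Longrightarrow> s < t \<Longrightarrow> t \<le> 1 \<Longrightarrow> 0 < p s u t w" and "corresponds_to_bridges M X p" for p
    using P.bridges_imp_condition[of p, OF pos] that(2) by (simp add: cond_def V_eq corresponds_to_bridges_def)
  have sufficient: "\<exists>p Z. regular_ito_diffusion T M F B (\<lambda>t z. 0) (\<lambda>t z. \<sigma> t) p Z \<and>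
      corresponds_to_bridges M X p \<and> gaussian_process M {0..1} Z"
    if cond: cond and T: "T = {0..<1} \<or> T = {0..1} \<and> C1_on {0..1} \<sigma> \<and> 0 < \<sigma> 1" for T
  proof -
    have T': "time_set T" using T by (auto simp: time_set_def)
    obtain \<sigma>'' where C: "C1_deriv T \<sigma> \<sigma>''" using T assms(6) by (auto simp: C1_on_iff_deriv)
    interpret Q: pinned_family M F \<beta> B h \<sigma> \<sigma>'' X
      by (rule family[OF C1_deriv_subset[OF C time_set(7)[OF T']]])
    have V_eq': "Q.V = V" by (simp add: fun_eq_iff Q.V_def V_def)
    obtain S where S: "(V \<longlongrightarrow> S) (at_left 1)" "\<forall>t\<in>{0..<1}. h t = (\<sigma> t)\<^sup>2 / (S - V t)"
      using cond by (auto simp: cond_def)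
    interpret Q: bridge_family M F \<beta> B h \<sigma> \<sigma>'' X S
      by unfold_locales (use S in \<open>auto simp: V_eq'\<close>)
    have "0 < \<sigma> t" if "t \<in> T" for t using T that assms(7)[of t] by (cases "t = 1") auto
    from Q.Z_regular[OF assms(4) T' C this] Q.bridge_law Q.Z_gaussian
    show ?thesis by (auto simp: corresponds_to_bridges_def)
  qed
  show ?thesis
  proof (intro conjI iffI impI allI)
    assume "\<exists>(N :: 'a measure) G W b \<rho> p Z. regular_ito_diffusion {0..<1} N G W b \<rho> p Z \<and> corresponds_to_bridges M X p"
    then show cond by (elim exE conjE) (rule necessary, auto simp: regular_ito_diffusion_def)
  next
    assume "\<exists>(N :: 'b measure) G W b \<rho> p Z. regular_ito_diffusion {0..<1} N G W b \<rho> p Z \<and> corresponds_to_bridges M X p"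
    then show cond by (elim exE conjE) (rule necessary, auto simp: regular_ito_diffusion_def)
  next
    assume cond
    from sufficient[OF this, of "{0..<1}"]
    show "\<exists>(N :: 'a measure) G W b \<rho> p Z. regular_ito_diffusion {0..<1} N G W b \<rho> p Z \<and> corresponds_to_bridges M X p"
      by blast
  qed (rule sufficient)
qed

end
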